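(* Let $H\in(\tfrac12,1)$ and let $(L_t)_{t\in\mathbb{R}}$ be a real-valued two-sided Lévy process that is purely non-Gaussian (no Gaussian component), with $\mathbf{E}[L_1^2]<\infty$ and $\mathbf{E}[L_1]=0$. Let $(X_t)_{t\geqslant0}$ be the fractional Lévy process $$X_t=\int_{-\infty}^t C_H\Big((t-s)_+^{H-\frac12}-(-s)_+^{H-\frac12}\Big)\,\mathrm{d}L_s,\quad t\geqslant0,\qquad C_H=\frac{\sqrt{2H\sin(\pi H)\Gamma(2H)}}{\Gamma(H+\frac12)}.$$ If the Lévy measure $\Lambda$ of $L$ satisfies $$\Lambda\big((-\varepsilon,0)\big)>0\quad\text{and}\quad\Lambda\big((0,\varepsilon)\big)>0\quad\text{for any }\varepsilon>0,$$ then $(X_t)_{t\in[0,T]}$ has conditional full support (CFS) with respect to $\big(\mathscr{F}^{L,\mathrm{inc}}_t\big)_{t\in[0,T]}$ for any $T>0$.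
   Context: $x_+=\max\{x,0\}$ and $\Gamma$ is the gamma function. The two-sided Lévy process is obtained from a càdlàg Lévy process $(L_t)_{t\geqslant0}$ and an independent copy $L'$ by $L_t=-L'_{(-t)-}$ for $t<0$. The stochastic integral is in the sense of Rajput and Rosiński (limit in probability of integrals of simple deterministic functions); under the stated assumptions it is well-defined and $X$ has a continuous modification (a known result of Marquardt), with which $X$ is identified. Filtration: $\mathscr{F}^{L,\mathrm{inc}}_t=\sigma(L_u-L_v:-\infty<v<u\leqslant t)$. CFS: a continuous real-valued process $Y=(Y_t)_{t\in[0,T]}$ has conditional full support with respect to a filtration $(\mathscr{F}_t)_{t\in[0,T]}$ if it is adapted to it and, for any $t_0\in[0,T)$, any continuous $f:[t_0,T]\to\mathbb{R}$ with $f(t_0)=0$ and any $\varepsilon>0$, $\mathbf{P}\big[\sup_{t\in[t_0,T]}|Y_t-Y_{t_0}-f(t)|<\varepsilon\,\big|\,\mathscr{F}_{t_0}\big]>0$ almost surely. *)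

theory Defs
  imports "HOL-Probability.Probability"
begin

section \<open>L\'evy processes\<close>

definition cadlag_on_nonneg :: "(real \<Rightarrow> real) \<Rightarrow> bool" where
  "cadlag_on_nonneg f \<longleftrightarrow>
     (\<forall>t\<ge>0. (f \<longlongrightarrow> f t) (at_right t)) \<and> (\<forall>t>0. \<exists>l. (f \<longlongrightarrow> l) (at_left t))"

text \<open>Only the restriction of \<open>Z\<close> to nonnegative times matters here. Stochastic continuity is
  not listed, since it follows from right-continuity and stationarity of the increments.\<close>

definition levy_process :: "'a measure \<Rightarrow> (real \<Rightarrow> 'a \<Rightarrow> real) \<Rightarrow> bool" where
  "levy_process M Z \<longleftrightarrow>
     (\<forall>t\<ge>0. Z t \<in> borel_measurable M) \<and>
     (\<forall>\<omega>\<in>space M. cadlag_on_nonneg (\<lambda>t. Z t \<omega>)) \<and>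
     (AE \<omega> in M. Z 0 \<omega> = 0) \<and>
     (\<forall>(n::nat) (\<tau>::nat \<Rightarrow> real). 0 \<le> \<tau> 0 \<longrightarrow> strict_mono_on {..n} \<tau> \<longrightarrow>
        prob_space.indep_vars M (\<lambda>_. borel) (\<lambda>i \<omega>. Z (\<tau> (Suc i)) \<omega> - Z (\<tau> i) \<omega>) {..<n}) \<and>
     (\<forall>s\<ge>0. \<forall>h\<ge>0. distr M borel (\<lambda>\<omega>. Z (s + h) \<omega> - Z s \<omega>) = distr M borel (Z h))"

definition nonneg_path :: "(real \<Rightarrow> 'a \<Rightarrow> real) \<Rightarrow> 'a \<Rightarrow> real \<Rightarrow> real" where
  "nonneg_path Z \<omega> = (\<lambda>t\<in>{0..}. Z t \<omega>)"

definition independent_copy ::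
  "'a measure \<Rightarrow> (real \<Rightarrow> 'a \<Rightarrow> real) \<Rightarrow> (real \<Rightarrow> 'a \<Rightarrow> real) \<Rightarrow> bool" where
  "independent_copy M Z Z' \<longleftrightarrow>
     prob_space.indep_var M (PiM {0..} (\<lambda>_. borel)) (nonneg_path Z)
                            (PiM {0..} (\<lambda>_. borel)) (nonneg_path Z') \<and>
     distr M (PiM {0..} (\<lambda>_. borel)) (nonneg_path Z') =
     distr M (PiM {0..} (\<lambda>_. borel)) (nonneg_path Z)"

text \<open>The last conjunct says that \<open>L t = - L' ((-t)-)\<close> for \<open>t < 0\<close>.\<close>

definition two_sided_levy_process :: "'a measure \<Rightarrow> (real \<Rightarrow> 'a \<Rightarrow> real) \<Rightarrow> bool" where
  "two_sided_levy_process M L \<longleftrightarrow> levy_process M L \<and>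
     (\<exists>L'. levy_process M L' \<and> independent_copy M L L' \<and>
        (\<forall>t<0. \<forall>\<omega>\<in>space M. ((\<lambda>s. L' s \<omega>) \<longlongrightarrow> - L t \<omega>) (at_left (- t))))"

definition levy_measure :: "real measure \<Rightarrow> bool" where
  "levy_measure \<Lambda> \<longleftrightarrow> sets \<Lambda> = sets borel \<and> emeasure \<Lambda> {0} = 0 \<and>
     (\<integral>\<^sup>+ x. ennreal (min 1 (x\<^sup>2)) \<partial>\<Lambda>) < \<infinity>"

text \<open>The L\'evy-Khintchine representation with drift \<open>b\<close>, Gaussian variance \<open>c\<close> and L\'evy
  measure \<open>\<Lambda>\<close>, for the truncation function \<open>x \<mapsto> x 1(\<bar>x\<bar> \<le> 1)\<close>. The choice of truncation
  affects \<open>b\<close> only.\<close>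

definition levy_exponent :: "real \<Rightarrow> real \<Rightarrow> real measure \<Rightarrow> real \<Rightarrow> complex" where
  "levy_exponent b c \<Lambda> u =
     \<i> * complex_of_real (u * b) - complex_of_real (c * u\<^sup>2 / 2) +
     (CLINT x|\<Lambda>. iexp (u * x) - 1 - \<i> * complex_of_real (u * x * indicator {-1..1} x))"

definition characteristic_triplet ::
  "'a measure \<Rightarrow> (real \<Rightarrow> 'a \<Rightarrow> real) \<Rightarrow> real \<Rightarrow> real \<Rightarrow> real measure \<Rightarrow> bool" where
  "characteristic_triplet M L b c \<Lambda> \<longleftrightarrow> 0 \<le> c \<and> levy_measure \<Lambda> \<and>
     (\<forall>t\<ge>0. \<forall>u. char (distr M borel (L t)) u = exp (complex_of_real t * levy_exponent b c \<Lambda> u))"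

text \<open>The natural filtration of the increments, over the whole past and without null sets
  added.\<close>

definition increment_filtration ::
  "'a measure \<Rightarrow> (real \<Rightarrow> 'a \<Rightarrow> real) \<Rightarrow> real \<Rightarrow> 'a measure" where
  "increment_filtration M L t = sigma (space M)
     {(\<lambda>\<omega>. L u \<omega> - L v \<omega>) -` B \<inter> space M | u v B. v < u \<and> u \<le> t \<and> B \<in> sets borel}"

lemma two_sided_levy_measurable:
  assumes "two_sided_levy_process M L"
  shows "L t \<in> borel_measurable M"
proof (cases "0 \<le> t")
  case True
  then show ?thesis
    using assms by (simp add: two_sided_levy_process_def levy_process_def)
next
  case False
  obtain L' where L': "levy_process M L'"
    and lim: "\<And>\<omega>. \<omega> \<in> space M \<Longrightarrow> ((\<lambda>s. L' s \<omega>) \<longlongrightarrow> - L t \<omega>) (at_left (- t))"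
    using assms False unfolding two_sided_levy_process_def by (meson not_le)
  define r :: "nat \<Rightarrow> real" where "r n = - t + t / real (Suc n)" for n
  have r_less: "r n < - t" for n
    using False by (simp add: r_def divide_neg_pos)
  have r_nonneg: "0 \<le> r n" for n
  proof -
    have "- t / real (Suc n) \<le> - t / 1"
      using False by (intro divide_left_mono) auto
    then show ?thesis
      by (simp add: r_def)
  qed
  have "r \<longlonglongrightarrow> - t + 0"
    unfolding r_def by (intro tendsto_add tendsto_const LIMSEQ_Suc lim_const_over_n)
  then have r: "filterlim r (at_left (- t)) sequentially"
    unfolding filterlim_at using r_less by (auto intro!: always_eventually simp: less_le)
  have "(\<lambda>n. - L' (r n) \<omega>) \<longlonglongrightarrow> L t \<omega>" if "\<omega> \<in> space M" for \<omega>
    using tendsto_minus[OF filterlim_compose[OF lim[OF that] r]] by simp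
  moreover have "(\<lambda>\<omega>. - L' (r n) \<omega>) \<in> borel_measurable M" for n
    using L' r_nonneg by (intro borel_measurable_uminus) (simp add: levy_process_def)
  ultimately show ?thesis
    by (rule borel_measurable_LIMSEQ_real)
qed

lemma subalgebra_increment_filtration:
  assumes "two_sided_levy_process M L"
  shows "subalgebra M (increment_filtration M L t)"
proof -
  let ?G = "{(\<lambda>\<omega>. L u \<omega> - L v \<omega>) -` B \<inter> space M | u v B. v < u \<and> u \<le> t \<and> B \<in> sets borel}"
  have "(\<lambda>\<omega>. L u \<omega> - L v \<omega>) \<in> borel_measurable M" for u v
    by (intro borel_measurable_diff two_sided_levy_measurable[OF assms])
  then have G: "?G \<subseteq> sets M"
    by (blast intro: measurable_sets)
  then have "?G \<subseteq> Pow (space M)"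
    by blast
  then show ?thesis
    unfolding subalgebra_def increment_filtration_def
    using sets.sigma_sets_subset[OF G] by simp
qed

section \<open>The integral of Rajput and Rosi\'nski\<close>

definition converges_in_probability ::
  "'a measure \<Rightarrow> (nat \<Rightarrow> 'a \<Rightarrow> real) \<Rightarrow> ('a \<Rightarrow> real) \<Rightarrow> bool" where
  "converges_in_probability M Z W \<longleftrightarrow>
     (\<forall>n. Z n \<in> borel_measurable M) \<and> W \<in> borel_measurable M \<and>
     (\<forall>\<epsilon>>0. (\<lambda>n. measure M {\<omega>\<in>space M. \<epsilon> < \<bar>Z n \<omega> - W \<omega>\<bar>}) \<longlonglongrightarrow> 0)"

text \<open>The \<open>\<delta>\<close>-ring on which the random measure driven by \<open>L\<close> lives.\<close>

abbreviation bounded_borel :: "real set set" where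
  "bounded_borel \<equiv> {A \<in> sets borel. bounded A}"

text \<open>The independently scattered random measure \<open>N\<close> with \<open>N (s, t] = L t - L s\<close>; it is
  determined by \<open>L\<close> up to almost sure equality of each \<open>N A\<close>.\<close>

definition levy_random_measure ::
  "'a measure \<Rightarrow> (real \<Rightarrow> 'a \<Rightarrow> real) \<Rightarrow> (real set \<Rightarrow> 'a \<Rightarrow> real) \<Rightarrow> bool" where
  "levy_random_measure M L N \<longleftrightarrow>
     (\<forall>A\<in>bounded_borel. N A \<in> borel_measurable M) \<and>
     (\<forall>s t. s < t \<longrightarrow> (AE \<omega> in M. N {s<..t} \<omega> = L t \<omega> - L s \<omega>)) \<and>
     (\<forall>A::nat \<Rightarrow> real set. range A \<subseteq> bounded_borel \<longrightarrow> disjoint_family A \<longrightarrow>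
        prob_space.indep_vars M (\<lambda>_. borel) (\<lambda>i. N (A i)) UNIV \<and>
        (bounded (\<Union>i. A i) \<longrightarrow> (AE \<omega> in M. (\<lambda>i. N (A i) \<omega>) sums N (\<Union>i. A i) \<omega>)))"

definition simple_integrand :: "(real \<Rightarrow> real) \<Rightarrow> bool" where
  "simple_integrand g \<longleftrightarrow> simple_function borel g \<and> bounded {x. g x \<noteq> 0}"

definition simple_integral_over ::
  "(real set \<Rightarrow> 'a \<Rightarrow> real) \<Rightarrow> real set \<Rightarrow> (real \<Rightarrow> real) \<Rightarrow> 'a \<Rightarrow> real" where
  "simple_integral_over N A g \<omega> = (\<Sum>y\<in>range g - {0}. y * N (A \<inter> g -` {y}) \<omega>)"

text \<open>\<open>I\<close> is (a version of) the integral of \<open>g\<close> over \<open>A\<close> with respect to \<open>L\<close>. As in Rajput and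
  Rosi\'nski, the integrals of the approximating simple functions have to converge over every
  Borel set \<open>B\<close>, which makes the limit independent of the approximating sequence. Stationarity of
  the increments makes the control measure of a nonzero L\'evy process equivalent to Lebesgue
  measure.\<close>

definition has_levy_integral ::
  "'a measure \<Rightarrow> (real \<Rightarrow> 'a \<Rightarrow> real) \<Rightarrow> real set \<Rightarrow> (real \<Rightarrow> real) \<Rightarrow> ('a \<Rightarrow> real) \<Rightarrow> bool" where
  "has_levy_integral M L A g I \<longleftrightarrow>
     (\<exists>N h. levy_random_measure M L N \<and>
        (\<forall>n. simple_integrand (h n)) \<and>
        (AE x in lborel. (\<lambda>n. h n x) \<longlonglongrightarrow> g x) \<and>
        (\<forall>B\<in>sets borel. \<exists>W. converges_in_probability M (\<lambda>n. simple_integral_over N B (h n)) W) \<and>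
        converges_in_probability M (\<lambda>n. simple_integral_over N A (h n)) I)"

section \<open>Fractional L\'evy processes and conditional full support\<close>

definition flp_constant :: "real \<Rightarrow> real" where
  "flp_constant H = sqrt (2 * H * sin (pi * H) * Gamma (2 * H)) / Gamma (H + 1/2)"

definition flp_kernel :: "real \<Rightarrow> real \<Rightarrow> real \<Rightarrow> real" where
  "flp_kernel H t s =
     flp_constant H * (max (t - s) 0 powr (H - 1/2) - max (- s) 0 powr (H - 1/2))"

text \<open>\<open>X\<close> is a continuous version of the fractional L\'evy process driven by \<open>L\<close>.\<close>

definition fractional_levy_process ::
  "'a measure \<Rightarrow> (real \<Rightarrow> 'a \<Rightarrow> real) \<Rightarrow> real \<Rightarrow> (real \<Rightarrow> 'a \<Rightarrow> real) \<Rightarrow> bool" where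
  "fractional_levy_process M L H X \<longleftrightarrow>
     (\<forall>t\<ge>0. has_levy_integral M L {..t} (flp_kernel H t) (X t)) \<and>
     (\<forall>\<omega>\<in>space M. continuous_on {0..} (\<lambda>t. X t \<omega>))"

definition conditional_full_support ::
  "'a measure \<Rightarrow> (real \<Rightarrow> 'a measure) \<Rightarrow> real \<Rightarrow> (real \<Rightarrow> 'a \<Rightarrow> real) \<Rightarrow> bool" where
  "conditional_full_support M F T Y \<longleftrightarrow>
     (\<forall>\<omega>\<in>space M. continuous_on {0..T} (\<lambda>t. Y t \<omega>)) \<and>
     (\<forall>t\<in>{0..T}. Y t \<in> borel_measurable (F t)) \<and>
     (\<forall>t0\<in>{0..<T}. \<forall>f. continuous_on {t0..T} f \<longrightarrow> f t0 = 0 \<longrightarrow> (\<forall>\<epsilon>>0.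
        AE \<omega> in M. 0 < real_cond_exp M (F t0)
          (indicator {\<omega>\<in>space M. (SUP t\<in>{t0..T}. \<bar>Y t \<omega> - Y t0 \<omega> - f t\<bar>) < \<epsilon>}) \<omega>))"

text \<open>An integral process is determined up to null sets only, whereas conditional full support
  demands adaptedness to a filtration that need not contain the null sets. Assertions about such
  processes are therefore made up to indistinguishability; between continuous processes this is the
  same as being modifications of each other.\<close>

definition indistinguishable ::
  "'a measure \<Rightarrow> (real \<Rightarrow> 'a \<Rightarrow> real) \<Rightarrow> (real \<Rightarrow> 'a \<Rightarrow> real) \<Rightarrow> bool" where
  "indistinguishable M X Y \<longleftrightarrow> (AE \<omega> in M. \<forall>t\<ge>0. X t \<omega> = Y t \<omega>)"

end

(*
  For 0 <= s <= t the variable X_t is the sum of the integrals of the kernel over (-infinity, s] and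
  over (s, t]. The first is almost surely measurable with respect to the past of s, because the
  random measure of a set in the past is. The second is almost surely the pathwise integral
  C INT_s^t a (t - r)^(a - 1) (L_r - L_s) dr with a = H - 1/2. This needs the uniqueness of the
  integral, which is the Vitali-Hahn-Saks phenomenon: convergence over every Borel set rules out an
  escape of mass, by a gliding hump argument, and on the sets where the integrands converge boundedly
  the L^2 isometry applies.

  The pathwise integral is continuous in the path for the supremum norm and, by the Beta integral,
  maps paths built from the powers (r - s)^(k - a) to polynomials. So it suffices that L - L_s follows
  any continuous function starting in 0 with positive probability. In a short time D, L makes a jump of
  a prescribed small size with probability at least c D, while an excursion that returns has
  probability O(D^2). Since small jumps of both signs are available, L can be steered along the
  function by always jumping against the sign of the current error.

  Conditionally on the past of s, the first summand is known and the second one is independent of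
  it. Countably many polynomials approximate every function that has to be reached, which gives
  conditional full support.
*)
theory Submission
  imports Defs
begin

text \<open>Two difficulties shape the development. First, an integral is known only through some
  sequence of simple functions converging almost everywhere, without a bound, and nothing is known
  about second moments over (-infinity, s]. So the isometry is proved on \<open>{0<..}\<close>,
  where the future part lives because s \<ge> 0, while the past part keeps only almost sure
  measurability, which survives limits in probability. Independence across s is read off the random
  measure, whose values on disjoint sets are independent on the whole line.

  Second, the filtration need not contain the null sets. Measurable versions of past parts are
  chosen time by time, so only countably many may be used together: rational times for the adapted
  version, rational times and s for the supremum, rational coefficients for the targets.

  The pathwise formula is an integration by parts: a (t - r)^(a - 1) is minus the derivative of (t -
  r)^a, the boundary terms vanish because the kernel is 0 at t and L - L_s is 0 at s, and the
  singularity at t is integrable as a > 0. Since a < 1, the exponents k - a with k \<ge> 1 are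
  positive.\<close>

section \<open>Independence of past and future increments\<close>

text \<open>Finite joint probabilities do not see null sets. This turns the independence of the
  values of N on intervals into independence of the increments of L, which agree with them only
  almost surely.\<close>

lemma (in prob_space) indep_vars_cong_AE:
  assumes X: "indep_vars S X I"
    and Y: "\<And>i. i \<in> I \<Longrightarrow> random_variable (S i) (Y i)"
    and eq: "\<And>i. i \<in> I \<Longrightarrow> AE \<omega> in M. X i \<omega> = Y i \<omega>"
  shows "indep_vars S Y I"
proof -
  have rvX: "\<And>i. i \<in> I \<Longrightarrow> random_variable (S i) (X i)"
    and ind: "indep_sets (\<lambda>i. {X i -` A \<inter> space M |A. A \<in> sets (S i)}) I"
    using X unfolding indep_vars_def2 by auto
  have "indep_sets (\<lambda>i. {Y i -` A \<inter> space M |A. A \<in> sets (S i)}) I"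
  proof (rule indep_setsI)
    fix i assume "i \<in> I"
    then show "{Y i -` A \<inter> space M |A. A \<in> sets (S i)} \<subseteq> events"
      using Y by (auto intro: measurable_sets)
  next
    fix A J assume J: "J \<noteq> {}" "J \<subseteq> I" "finite J"
      and "\<forall>j\<in>J. A j \<in> {Y j -` A \<inter> space M |A. A \<in> sets (S j)}"
    then obtain B where B: "\<And>j. j \<in> J \<Longrightarrow> B j \<in> sets (S j)" "\<And>j. j \<in> J \<Longrightarrow> A j = Y j -` B j \<inter> space M"
      unfolding Ball_def mem_Collect_eq by metis
    have mX: "X j -` B j \<inter> space M \<in> events" and mY: "Y j -` B j \<inter> space M \<in> events" if "j \<in> J" for j
      using that J B rvX Y by (auto intro!: measurable_sets)
    have e: "AE \<omega> in M. \<forall>j\<in>J. X j \<omega> = Y j \<omega>"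
      using J eq by (intro AE_finite_allI) auto
    have "prob (\<Inter>j\<in>J. A j) = prob (\<Inter>j\<in>J. X j -` B j \<inter> space M)"
    proof (rule finite_measure_eq_AE)
      show "AE x in M. (x \<in> \<Inter> (A ` J)) = (x \<in> (\<Inter>j\<in>J. X j -` B j \<inter> space M))"
        using e by eventually_elim (use B J in auto)
      show "\<Inter> (A ` J) \<in> events"
        using J B(2) mY by (intro sets.finite_INT) auto
      show "(\<Inter>j\<in>J. X j -` B j \<inter> space M) \<in> events"
        using J mX by (intro sets.finite_INT) auto
    qed
    also have "\<dots> = (\<Prod>j\<in>J. prob (X j -` B j \<inter> space M))"
      using J B by (intro indep_setsD[OF ind]) auto
    also have "\<dots> = (\<Prod>j\<in>J. prob (A j))"
    proof (intro prod.cong refl finite_measure_eq_AE)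
      fix j assume j: "j \<in> J"
      show "AE x in M. (x \<in> X j -` B j \<inter> space M) = (x \<in> A j)"
        using e by eventually_elim (use B j in auto)
      show "X j -` B j \<inter> space M \<in> events" "A j \<in> events"
        using j B mX mY by auto
    qed
    finally show "prob (\<Inter> (A ` J)) = (\<Prod>j\<in>J. prob (A j))" .
  qed
  then show ?thesis
    unfolding indep_vars_def2 using Y by auto
qed

text \<open>Independence on the whole line comes from \<open>N\<close>, while \<open>levy\<close>
  supplies stationarity and path regularity, which are stated for nonnegative times. Mean and
  variance are therefore computed on that half-line.\<close>

locale centered_levy = prob_space M for M :: "'a measure" +
  fixes L :: "real \<Rightarrow> 'a \<Rightarrow> real" and N :: "real set \<Rightarrow> 'a \<Rightarrow> real"
  assumes levy: "levy_process M L"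
    and L_measurable[measurable]: "\<And>t. L t \<in> borel_measurable M"
    and random_measure: "levy_random_measure M L N"
    and square_integrable: "integrable M (\<lambda>\<omega>. (L 1 \<omega>)\<^sup>2)"
    and mean_zero: "expectation (L 1) = 0"
begin

lemma N_measurable: "A \<in> bounded_borel \<Longrightarrow> N A \<in> borel_measurable M"
  using random_measure unfolding levy_random_measure_def by blast

lemma N_Ioc: "s < t \<Longrightarrow> AE \<omega> in M. N {s<..t} \<omega> = L t \<omega> - L s \<omega>"
  using random_measure unfolding levy_random_measure_def by blast

lemma N_indep:
  fixes A :: "nat \<Rightarrow> real set"
  assumes "range A \<subseteq> bounded_borel" "disjoint_family A"
  shows "indep_vars (\<lambda>_. borel) (\<lambda>i. N (A i)) UNIV"
  using assms random_measure unfolding levy_random_measure_def by blast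

lemma N_sums:
  fixes A :: "nat \<Rightarrow> real set"
  assumes "range A \<subseteq> bounded_borel" "disjoint_family A" "bounded (\<Union>i. A i)"
  shows "AE \<omega> in M. (\<lambda>i. N (A i) \<omega>) sums N (\<Union>i. A i) \<omega>"
  using assms random_measure unfolding levy_random_measure_def by blast

text \<open>Indexing by an arbitrary set of times serves the past \<open>{..t}\<close>, the future
  \<open>{t..}\<close>, a window \<open>{s..t}\<close> and the finite sets of the independence proof
  alike.\<close>

definition increments :: "real set \<Rightarrow> 'a measure" where
  "increments I = sigma (space M)
     {(\<lambda>\<omega>. L u \<omega> - L v \<omega>) -` B \<inter> space M | u v B. u \<in> I \<and> v \<in> I \<and> B \<in> sets borel}"

lemma space_increments[simp]: "space (increments I) = space M"
  unfolding increments_def by (rule space_measure_of) auto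

lemma sets_increments:
  "sets (increments I) = sigma_sets (space M)
     {(\<lambda>\<omega>. L u \<omega> - L v \<omega>) -` B \<inter> space M | u v B. u \<in> I \<and> v \<in> I \<and> B \<in> sets borel}"
  unfolding increments_def by (subst sets_measure_of) auto

lemma increments_measurable:
  assumes "u \<in> I" "v \<in> I"
  shows "(\<lambda>\<omega>. L u \<omega> - L v \<omega>) \<in> borel_measurable (increments I)"
proof (rule measurableI)
  fix B :: "real set" assume "B \<in> sets borel"
  then show "(\<lambda>\<omega>. L u \<omega> - L v \<omega>) -` B \<inter> space (increments I) \<in> sets (increments I)"
    using assms unfolding sets_increments space_increments by (intro sigma_sets.Basic) blast
qed auto

lemma sets_increments_mono: "I \<subseteq> J \<Longrightarrow> sets (increments I) \<subseteq> sets (increments J)"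
  unfolding sets_increments by (intro sigma_sets_mono') blast

lemma sets_increments_subset:
  assumes "space S = space M"
    and "\<And>u v. u \<in> I \<Longrightarrow> v \<in> I \<Longrightarrow> (\<lambda>\<omega>. L u \<omega> - L v \<omega>) \<in> borel_measurable S"
  shows "sets (increments I) \<subseteq> sets S"
proof -
  have "sigma_sets (space S) {(\<lambda>\<omega>. L u \<omega> - L v \<omega>) -` B \<inter> space M | u v B. u \<in> I \<and> v \<in> I \<and> B \<in> sets borel}
    \<subseteq> sets S"
  proof (rule sets.sigma_sets_subset, safe)
    fix u v and B :: "real set" assume "u \<in> I" "v \<in> I" "B \<in> sets borel"
    then show "(\<lambda>\<omega>. L u \<omega> - L v \<omega>) -` B \<inter> space M \<in> sets S"
      using measurable_sets[OF assms(2)[of u v], of B] assms(1) by simp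
  qed
  then show ?thesis
    using assms by (simp add: sets_increments)
qed

lemma sets_increments_events: "sets (increments I) \<subseteq> events"
  by (rule sets_increments_subset) auto

lemma subalgebra_increments: "subalgebra M (increments I)"
  by (simp add: subalgebra_def sets_increments_events)

text \<open>The filtration uses pairs \<open>v < u\<close> only; reversing a pair changes a sign and
  equal times give 0, so both families generate the same sigma-algebra.\<close>

lemma sets_increment_filtration: "sets (increment_filtration M L t) = sets (increments {..t})"
proof
  have "sigma_sets (space M) {(\<lambda>\<omega>. L u \<omega> - L v \<omega>) -` B \<inter> space M |u v B. v < u \<and> u \<le> t \<and> B \<in> sets borel}
     \<subseteq> sigma_sets (space M) {(\<lambda>\<omega>. L u \<omega> - L v \<omega>) -` B \<inter> space M | u v B. u \<in> {..t} \<and> v \<in> {..t} \<and> B \<in> sets borel}"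
  proof (intro sigma_sets_mono' subsetI, clarify)
    fix u v and B :: "real set" assume "v < u" "u \<le> t" "B \<in> sets borel"
    then show "\<exists>u' v' B'. (\<lambda>\<omega>. L u \<omega> - L v \<omega>) -` B \<inter> space M = (\<lambda>\<omega>. L u' \<omega> - L v' \<omega>) -` B' \<inter> space M \<and>
       u' \<in> {..t} \<and> v' \<in> {..t} \<and> B' \<in> sets borel"
      by (intro exI[of _ u] exI[of _ v] exI[of _ B]) auto
  qed
  then show "sets (increment_filtration M L t) \<subseteq> sets (increments {..t})"
    unfolding sets_increments unfolding increment_filtration_def
    by (subst sets_measure_of) auto
  let ?F = "increment_filtration M L t"
  have sp: "space ?F = space M"
    unfolding increment_filtration_def by (rule space_measure_of) auto
  have *: "(\<lambda>\<omega>. L u \<omega> - L v \<omega>) \<in> borel_measurable ?F" if "v < u" "u \<le> t" for u v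
  proof (rule measurableI)
    fix B :: "real set" assume "B \<in> sets borel"
    then show "(\<lambda>\<omega>. L u \<omega> - L v \<omega>) -` B \<inter> space ?F \<in> sets ?F"
      using that unfolding sp unfolding increment_filtration_def
      by (subst sets_measure_of) (auto intro!: sigma_sets.Basic)
  qed auto
  show "sets (increments {..t}) \<subseteq> sets ?F"
  proof (rule sets_increments_subset[OF sp])
    fix u v :: real assume uv: "u \<in> {..t}" "v \<in> {..t}"
    consider "v < u" | "u = v" | "u < v" by linarith
    then show "(\<lambda>\<omega>. L u \<omega> - L v \<omega>) \<in> borel_measurable ?F"
    proof cases
      case 1 then show ?thesis using * uv by auto
    next
      case 2 then show ?thesis by simp
    next
      case 3
      then have "(\<lambda>\<omega>. - (L v \<omega> - L u \<omega>)) \<in> borel_measurable ?F"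
        using * uv by (intro borel_measurable_uminus) auto
      then show ?thesis by simp
    qed
  qed
qed

lemma measurable_increment_filtration:
  "f \<in> borel_measurable (increment_filtration M L t) \<longleftrightarrow> f \<in> borel_measurable (increments {..t})"
  by (rule arg_cong[where f="\<lambda>S. f \<in> S"], rule measurable_cong_sets[OF sets_increment_filtration refl])

text \<open>All times are merged into one increasing list. Consecutive increments are almost surely
  values of \<open>N\<close> on disjoint cells, hence independent; increments of \<open>J\<close>
  telescope over the cells before \<open>t\<close>, those of \<open>K\<close> over the cells after
  it.\<close>

lemma indep_finite_increments:
  assumes J: "finite J" "J \<subseteq> {..t}" and K: "finite K" "K \<subseteq> {t..}"
    and a: "a \<in> sets (increments J)" and b: "b \<in> sets (increments K)"
  shows "prob (a \<inter> b) = prob a * prob b"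
proof -
  \<comment> \<open>\<open>t\<close> is inserted so that no cell straddles it.\<close>
  define xs where "xs = sorted_list_of_set (insert t (J \<union> K))"
  have fin: "finite (insert t (J \<union> K))" using J K by auto
  have set_xs: "set xs = insert t (J \<union> K)" and sorted: "sorted_wrt (<) xs"
    unfolding xs_def using set_sorted_list_of_set[OF fin] strict_sorted_list_of_set by blast+
  obtain m where m: "m < length xs" "xs ! m = t"
    using in_set_conv_nth[of t xs] unfolding set_xs by auto
  have less: "xs ! i < xs ! j" if "i < j" "j < length xs" for i j
    using sorted that by (simp add: sorted_wrt_nth_less)
  \<comment> \<open>\<open>N_indep\<close> speaks of infinite sequences of sets, so indices past the
    last cell are padded by the empty set and the increment 0.\<close>
  define X where "X i \<omega> = (if Suc i < length xs then L (xs ! Suc i) \<omega> - L (xs ! i) \<omega> else 0)" for i \<omega>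
  define A where "A i = (if Suc i < length xs then {xs ! i<..xs ! Suc i} else {})" for i
  have disj: "A i \<inter> A j = {}" if "i < j" for i j
  proof (cases "Suc j < length xs")
    case True
    then have "xs ! Suc i \<le> xs ! j"
      using that less[of "Suc i" j] by (cases "Suc i = j") auto
    then show ?thesis by (auto simp: A_def)
  qed (auto simp: A_def)
  have "disjoint_family A"
    unfolding disjoint_family_on_def using disj by (metis Int_commute nat_neq_iff)
  moreover have "range A \<subseteq> bounded_borel" by (auto simp: A_def)
  ultimately have ind: "indep_vars (\<lambda>_. borel) (\<lambda>i. N (A i)) {..<length xs - 1}"
    using N_indep[of A] indep_vars_subset by blast
  have X: "indep_vars (\<lambda>_. borel) X {..<length xs - 1}"
  proof (rule indep_vars_cong_AE[OF ind])
    fix i assume "i \<in> {..<length xs - 1}"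
    then have i: "Suc i < length xs" by auto
    show "random_variable borel (X i)" using i by (simp add: X_def[abs_def])
    show "AE \<omega> in M. N (A i) \<omega> = X i \<omega>"
      using N_Ioc[OF less[of i "Suc i"]] i by (simp add: X_def A_def)
  qed
  have tele: "L (xs ! k) \<omega> - L (xs ! l) \<omega> = (\<Sum>i=l..<k. X i \<omega>)" if "l \<le> k" "k < length xs" for k l \<omega>
    using that
  proof (induction k rule: dec_induct)
    case (step n) then show ?case by (simp add: X_def)
  qed simp
  \<comment> \<open>Every increment with endpoints among \<open>xs ! p\<close>, ...,
    \<open>xs ! q\<close> is, up to sign, a sum of the \<open>X i\<close> with i in
    \<open>{p..<q}\<close>, so its events are preimages under that vector. Independence of the two
    grouped vectors then applies.\<close>
  have *: "sets (increments R) \<subseteq> sets (vimage_algebra (space M) (\<lambda>\<omega>. \<lambda>i\<in>Q. X i \<omega>) (PiM Q (\<lambda>_. borel)))"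
    if R: "R \<subseteq> ((!) xs) ` {p..q}" and Q: "Q = {p..<q}" "q < length xs" for R Q p q
  proof (rule sets_increments_subset)
    let ?V = "vimage_algebra (space M) (\<lambda>\<omega>. \<lambda>i\<in>Q. X i \<omega>) (PiM Q (\<lambda>_. borel::real measure))"
    show "space ?V = space M" by simp
    have Xm: "X i \<in> borel_measurable ?V" if "i \<in> Q" for i
    proof -
      have "(\<lambda>\<omega>. \<lambda>i\<in>Q. X i \<omega>) \<in> measurable ?V (PiM Q (\<lambda>_. borel))"
        by (rule measurable_vimage_algebra1) (auto simp: space_PiM)
      from measurable_compose[OF this measurable_component_singleton[OF that]]
      have "(\<lambda>\<omega>. (\<lambda>i\<in>Q. X i \<omega>) i) \<in> borel_measurable ?V" .
      then show ?thesis using that by simp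
    qed
    have le: "(\<lambda>\<omega>. L (xs ! k) \<omega> - L (xs ! l) \<omega>) \<in> borel_measurable ?V" if "p \<le> l" "l \<le> k" "k \<le> q" for k l
      unfolding tele[OF that(2) order.strict_trans1[OF that(3) Q(2)]]
      by (intro borel_measurable_sum Xm) (use that Q in auto)
    fix u v assume "u \<in> R" "v \<in> R"
    then obtain k l where kl: "u = xs ! k" "v = xs ! l" "k \<in> {p..q}" "l \<in> {p..q}"
      using R by blast
    show "(\<lambda>\<omega>. L u \<omega> - L v \<omega>) \<in> borel_measurable ?V"
    proof (cases "l \<le> k")
      case True then show ?thesis using le[of l k] kl by auto
    next
      case False
      then have "(\<lambda>\<omega>. - (L (xs ! l) \<omega> - L (xs ! k) \<omega>)) \<in> borel_measurable ?V"
        using kl by (intro borel_measurable_uminus le) auto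
      then show ?thesis using kl by simp
    qed
  qed
  have J1: "J \<subseteq> ((!) xs) ` {0..m}"
  proof
    fix u assume u: "u \<in> J"
    then obtain k where k: "k < length xs" "xs ! k = u" using in_set_conv_nth[of u xs] unfolding set_xs by auto
    have "k \<le> m" using less[of m k] k m u J by force
    then show "u \<in> ((!) xs) ` {0..m}" using k by auto
  qed
  have K1: "K \<subseteq> ((!) xs) ` {m..length xs - 1}"
  proof
    fix u assume u: "u \<in> K"
    then obtain k where k: "k < length xs" "xs ! k = u" using in_set_conv_nth[of u xs] unfolding set_xs by auto
    have "m \<le> k" using less[of k m] k m u K by force
    then show "u \<in> ((!) xs) ` {m..length xs - 1}" using k by auto
  qed
  have mlast: "length xs - 1 < length xs" using m by simp
  have iv: "indep_var (PiM {0..<m} (\<lambda>_. borel)) (\<lambda>\<omega>. restrict (\<lambda>i. X i \<omega>) {0..<m})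
                  (PiM {m..<length xs - 1} (\<lambda>_. borel)) (\<lambda>\<omega>. restrict (\<lambda>i. X i \<omega>) {m..<length xs - 1})"
    using m by (intro indep_var_restrict[OF X]) auto
  obtain a' where a': "a' \<in> sets (PiM {0..<m} (\<lambda>_. borel::real measure))"
      "a = (\<lambda>\<omega>. restrict (\<lambda>i. X i \<omega>) {0..<m}) -` a' \<inter> space M"
    using *[OF J1 refl m(1)] a by (subst (asm) sets_vimage_algebra2) (auto simp: space_PiM)
  obtain b' where b': "b' \<in> sets (PiM {m..<length xs - 1} (\<lambda>_. borel::real measure))"
      "b = (\<lambda>\<omega>. restrict (\<lambda>i. X i \<omega>) {m..<length xs - 1}) -` b' \<inter> space M"
    using *[OF K1 refl mlast] b by (subst (asm) sets_vimage_algebra2) (auto simp: space_PiM)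
  have "a \<inter> b = (\<lambda>\<omega>. (restrict (\<lambda>i. X i \<omega>) {0..<m}, restrict (\<lambda>i. X i \<omega>) {m..<length xs - 1})) -` (a' \<times> b') \<inter> space M"
    using a' b' by auto
  then show ?thesis
    using indep_varD[OF iv a'(1) b'(1)] a'(2) b'(2) by simp
qed

text \<open>Events that depend on finitely many times form an intersection-stable generator, since
  two finite sets of times lie in their union; a pi-lambda argument carries the product formula to
  the full sigma-algebras.\<close>

lemma indep_past_future:
  assumes a: "a \<in> sets (increments {..t})" and b: "b \<in> sets (increments {t..})"
  shows "prob (a \<inter> b) = prob a * prob b"
proof -
  define G where "G I = (\<Union>J\<in>{J. finite J \<and> J \<subseteq> I}. sets (increments J))" for I
  have G_ev: "G I \<subseteq> events" for I
    unfolding G_def using sets_increments_events by blast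
  have "Int_stable (G I)" for I
  proof (rule Int_stableI)
    fix a b assume "a \<in> G I" "b \<in> G I"
    then obtain J K where JK: "finite J" "J \<subseteq> I" "finite K" "K \<subseteq> I" "a \<in> sets (increments J)" "b \<in> sets (increments K)"
      unfolding G_def by auto
    have "a \<in> sets (increments (J \<union> K))" "b \<in> sets (increments (J \<union> K))"
      using JK sets_increments_mono[of J "J \<union> K"] sets_increments_mono[of K "J \<union> K"] by auto
    then have "a \<inter> b \<in> sets (increments (J \<union> K))" by blast
    then show "a \<inter> b \<in> G I"
      unfolding G_def using JK by (intro UN_I[of "J \<union> K"]) auto
  qed
  moreover have "indep_set (G {..t}) (G {t..})"
  proof (rule indep_setI[OF G_ev G_ev])
    fix a b assume "a \<in> G {..t}" "b \<in> G {t..}"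
    then show "prob (a \<inter> b) = prob a * prob b"
      unfolding G_def using indep_finite_increments by auto
  qed
  ultimately have "indep_set (sigma_sets (space M) (G {..t})) (sigma_sets (space M) (G {t..}))"
    by (intro indep_set_sigma_sets)
  moreover have "sets (increments I) \<subseteq> sigma_sets (space M) (G I)" for I
    unfolding sets_increments[of I]
  proof (rule sigma_sets_mono', safe)
    fix u v and B :: "real set" assume "u \<in> I" "v \<in> I" "B \<in> sets borel"
    moreover have "(\<lambda>\<omega>. L u \<omega> - L v \<omega>) -` B \<inter> space M \<in> sets (increments {u, v})"
      using measurable_sets[OF increments_measurable[of u "{u,v}" v] \<open>B \<in> sets borel\<close>] by simp
    ultimately show "(\<lambda>\<omega>. L u \<omega> - L v \<omega>) -` B \<inter> space M \<in> G I"
      unfolding G_def by (intro UN_I[of "{u, v}"]) auto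
  qed
  ultimately show ?thesis
    using a b by (metis (no_types) indep_setD subsetD)
qed

end

section \<open>Moments\<close>

text \<open>Additivity and nonnegativity give monotonicity. Comparing n * t with the integers around
  it confines n times the difference f t - t * f 1 to a bounded range for every n, which forces the
  difference to be 0.\<close>

lemma additive_nonneg_linear:
  fixes f :: "real \<Rightarrow> real"
  assumes add: "\<And>x y. 0 \<le> x \<Longrightarrow> 0 \<le> y \<Longrightarrow> f (x + y) = f x + f y"
    and nonneg: "\<And>x. 0 \<le> x \<Longrightarrow> 0 \<le> f x"
    and t: "0 \<le> t"
  shows "f t = t * f 1"
proof -
  have f0: "f 0 = 0"
    using add[of 0 0] by simp
  have mult: "f (real n * x) = real n * f x" if "0 \<le> x" for n x
  proof (induction n)
    case (Suc n)
    have "f (real n * x + x) = f (real n * x) + f x"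
      using that by (intro add) auto
    then show ?case
      using Suc by (simp add: algebra_simps)
  qed (simp add: f0)
  have mono: "f x \<le> f y" if "0 \<le> x" "x \<le> y" for x y
    using add[of x "y - x"] nonneg[of "y - x"] that by simp
  have bound: "\<bar>f t - t * f 1\<bar> * real n \<le> f 1" for n
  proof -
    define k where "k = nat \<lfloor>real n * t\<rfloor>"
    have k: "real k \<le> real n * t" "real n * t \<le> real k + 1"
      unfolding k_def using t by (auto simp: of_nat_nat)
    have "real k * f 1 \<le> real n * f t"
      using mono[of "real k" "real n * t"] k mult[of 1 k] mult[of t n] t by simp
    moreover have "real n * f t \<le> (real k + 1) * f 1"
      using mono[of "real n * t" "real (Suc k)"] k mult[of 1 "Suc k"] mult[of t n] t by (simp add: add.commute)
    moreover have "real k * f 1 \<le> real n * t * f 1" "real n * t * f 1 \<le> (real k + 1) * f 1"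
      using k nonneg[of 1] by (auto intro!: mult_right_mono)
    ultimately have "\<bar>real n * f t - real n * t * f 1\<bar> \<le> f 1"
      by (simp add: abs_le_iff algebra_simps)
    also have "real n * f t - real n * t * f 1 = (f t - t * f 1) * real n"
      by (simp add: algebra_simps)
    finally show ?thesis by (simp add: abs_mult)
  qed
  show ?thesis
  proof (rule ccontr)
    assume "f t \<noteq> t * f 1"
    then have "0 < \<bar>f t - t * f 1\<bar>" by simp
    then obtain n where "f 1 < real n * \<bar>f t - t * f 1\<bar>"
      using ex_less_of_nat_mult by blast
    then show False using bound[of n] by (simp add: mult.commute)
  qed
qed

section \<open>Square integrable and independent random variables\<close>

context prob_space
begin

lemma square_integrable_product:
  fixes X Y :: "'a \<Rightarrow> real"
  assumes [measurable]: "X \<in> borel_measurable M" "Y \<in> borel_measurable M"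
    and "integrable M (\<lambda>\<omega>. (X \<omega>)\<^sup>2)" "integrable M (\<lambda>\<omega>. (Y \<omega>)\<^sup>2)"
  shows "integrable M (\<lambda>\<omega>. X \<omega> * Y \<omega>)"
proof (rule Bochner_Integration.integrable_bound)
  show "integrable M (\<lambda>\<omega>. (X \<omega>)\<^sup>2 + (Y \<omega>)\<^sup>2)"
    using assms by simp
  have "\<bar>x * y\<bar> \<le> x\<^sup>2 + y\<^sup>2" for x y :: real
  proof -
    have "0 \<le> (\<bar>x\<bar> - \<bar>y\<bar>)\<^sup>2" "0 \<le> \<bar>x\<bar> * \<bar>y\<bar>" by auto
    then have "\<bar>x\<bar> * \<bar>y\<bar> \<le> x\<^sup>2 + y\<^sup>2"
      unfolding power2_diff power2_abs by linarith
    then show ?thesis by (simp add: abs_mult)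
  qed
  then show "AE \<omega> in M. norm (X \<omega> * Y \<omega>) \<le> norm ((X \<omega>)\<^sup>2 + (Y \<omega>)\<^sup>2)"
    by simp
qed simp

lemma square_integrable_add:
  fixes X Y :: "'a \<Rightarrow> real"
  assumes "X \<in> borel_measurable M" "Y \<in> borel_measurable M"
    and "integrable M (\<lambda>\<omega>. (X \<omega>)\<^sup>2)" "integrable M (\<lambda>\<omega>. (Y \<omega>)\<^sup>2)"
  shows "integrable M (\<lambda>\<omega>. (X \<omega> + Y \<omega>)\<^sup>2)"
  unfolding power2_sum using assms square_integrable_product[OF assms] by (simp add: mult.assoc)

lemma square_integrable_diff:
  fixes X Y :: "'a \<Rightarrow> real"
  assumes "X \<in> borel_measurable M" "Y \<in> borel_measurable M"
    and "integrable M (\<lambda>\<omega>. (X \<omega>)\<^sup>2)" "integrable M (\<lambda>\<omega>. (Y \<omega>)\<^sup>2)"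
  shows "integrable M (\<lambda>\<omega>. (X \<omega> - Y \<omega>)\<^sup>2)"
  unfolding power2_diff using assms square_integrable_product[OF assms] by (simp add: mult.assoc)

lemma indep_var_commute:
  assumes "indep_var S X T Y"
  shows "indep_var T Y S X"
proof -
  have "prob (b \<inter> a) = prob b * prob a" if "prob (a \<inter> b) = prob a * prob b" for a b
    using that by (simp add: Int_commute mult.commute)
  then show ?thesis
    using assms unfolding indep_var_eq indep_sets2_eq by blast
qed

text \<open>By Fubini on the product of the two laws, \<open>X + y\<close> is square integrable for
  almost every constant \<open>y\<close>, and one such \<open>y\<close> suffices.\<close>

lemma indep_var_square_integrable:
  fixes X Y :: "'a \<Rightarrow> real"
  assumes ind: "indep_var borel X borel Y"
    and int: "integrable M (\<lambda>\<omega>. (X \<omega> + Y \<omega>)\<^sup>2)"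
  shows "integrable M (\<lambda>\<omega>. (X \<omega>)\<^sup>2)"
proof -
  have [measurable]: "X \<in> borel_measurable M" "Y \<in> borel_measurable M"
    using indep_var_rv1[OF ind] indep_var_rv2[OF ind] by auto
  let ?X = "distr M borel X" and ?Y = "distr M borel Y"
  interpret X: prob_space ?X by (rule prob_space_distr) simp
  interpret Y: prob_space ?Y by (rule prob_space_distr) simp
  interpret XY: pair_prob_space ?Y ?X ..
  have ind': "?Y \<Otimes>\<^sub>M ?X = distr M (borel \<Otimes>\<^sub>M borel) (\<lambda>\<omega>. (Y \<omega>, X \<omega>))"
    using indep_var_distribution_eq[of borel Y borel X] indep_var_commute[OF ind] by blast
  have "integrable (distr M (borel \<Otimes>\<^sub>M borel) (\<lambda>\<omega>. (Y \<omega>, X \<omega>))) (\<lambda>(y, x). (x + y)\<^sup>2)"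
    by (subst integrable_distr_eq) (use int in \<open>auto simp: split_beta\<close>)
  then have "integrable (?Y \<Otimes>\<^sub>M ?X) (\<lambda>(y, x). (x + y)\<^sup>2)"
    by (simp add: ind')
  then have "AE y in ?Y. integrable ?X (\<lambda>x. (x + y)\<^sup>2)"
    using XY.AE_integrable_fst by force
  then obtain y where y: "integrable ?X (\<lambda>x. (x + y)\<^sup>2)"
    using Y.AE_False by (metis (mono_tags, lifting) eventually_mono)
  then have "integrable M (\<lambda>\<omega>. (X \<omega> + y)\<^sup>2)"
    by (subst (asm) integrable_distr_eq) auto
  then have "integrable M (\<lambda>\<omega>. ((X \<omega> + y) - y)\<^sup>2)"
    by (intro square_integrable_diff) auto
  then show ?thesis by simp
qed

lemma indep_var_expectation_square_add:
  fixes X Y :: "'a \<Rightarrow> real"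
  assumes ind: "indep_var borel X borel Y"
    and sq: "integrable M (\<lambda>\<omega>. (X \<omega>)\<^sup>2)" "integrable M (\<lambda>\<omega>. (Y \<omega>)\<^sup>2)"
    and zero: "expectation X = 0"
  shows "expectation (\<lambda>\<omega>. (X \<omega> + Y \<omega>)\<^sup>2) = expectation (\<lambda>\<omega>. (X \<omega>)\<^sup>2) + expectation (\<lambda>\<omega>. (Y \<omega>)\<^sup>2)"
proof -
  have rv[measurable]: "X \<in> borel_measurable M" "Y \<in> borel_measurable M"
    using indep_var_rv1[OF ind] indep_var_rv2[OF ind] by auto
  have i: "integrable M X" "integrable M Y"
    using sq by (auto intro: square_integrable_imp_integrable)
  have "expectation (\<lambda>\<omega>. X \<omega> * Y \<omega>) = 0"
    using indep_var_lebesgue_integral[OF ind i] zero by simp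
  moreover have "integrable M (\<lambda>\<omega>. X \<omega> * Y \<omega>)"
    using square_integrable_product[OF rv sq] .
  ultimately show ?thesis
    unfolding power2_sum using sq by (simp add: mult.assoc)
qed

end

section \<open>Mean and variance of the driving process\<close>

context centered_levy
begin

lemma indep_var_past_future:
  assumes f: "f \<in> borel_measurable (increments {..t})" and g: "g \<in> borel_measurable (increments {t..})"
  shows "indep_var (borel::real measure) f (borel::real measure) g"
proof -
  have rv: "random_variable borel f" "random_variable borel g"
    using f g measurable_from_subalg[OF subalgebra_increments] by blast+
  have sub: "sigma_sets (space M) {f -` A \<inter> space M | A. A \<in> sets borel} \<subseteq> sets (increments I)"
    if "f \<in> borel_measurable (increments I)" for f :: "'a \<Rightarrow> real" and I
  proof -
    have "sigma_sets (space (increments I)) {f -` A \<inter> space M | A. A \<in> sets borel} \<subseteq> sets (increments I)"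
      by (rule sets.sigma_sets_subset) (use measurable_sets[OF that] in auto)
    then show ?thesis by simp
  qed
  show ?thesis
    unfolding indep_var_eq
  proof (intro conjI rv indep_setI)
    fix a b assume "a \<in> sigma_sets (space M) {f -` A \<inter> space M | A. A \<in> sets borel}"
      "b \<in> sigma_sets (space M) {g -` A \<inter> space M | A. A \<in> sets borel}"
    then show "prob (a \<inter> b) = prob a * prob b"
      using sub[OF f] sub[OF g] by (intro indep_past_future) auto
  qed (use sub[OF f] sub[OF g] sets_increments_events in blast)+
qed

lemma indep_var_increments:
  assumes "s \<le> t" "t \<le> u"
  shows "indep_var borel (\<lambda>\<omega>. L t \<omega> - L s \<omega>) borel (\<lambda>\<omega>. L u \<omega> - L t \<omega>)"
  using assms by (intro indep_var_past_future[of _ t] increments_measurable) auto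

lemma L_zero: "AE \<omega> in M. L 0 \<omega> = 0"
  using levy unfolding levy_process_def by (elim conjE)

lemma distr_increment:
  "0 \<le> s \<Longrightarrow> 0 \<le> h \<Longrightarrow> distr M borel (\<lambda>\<omega>. L (s + h) \<omega> - L s \<omega>) = distr M borel (L h)"
  using levy unfolding levy_process_def by blast

lemma right_continuous: "\<omega> \<in> space M \<Longrightarrow> 0 \<le> t \<Longrightarrow> ((\<lambda>s. L s \<omega>) \<longlongrightarrow> L t \<omega>) (at_right t)"
  using levy unfolding levy_process_def cadlag_on_nonneg_def by blast

lemma integrable_increment_iff:
  fixes f :: "real \<Rightarrow> real"
  assumes [measurable]: "f \<in> borel_measurable borel" and "0 \<le> s" "0 \<le> h"
  shows "integrable M (\<lambda>\<omega>. f (L (s + h) \<omega> - L s \<omega>)) \<longleftrightarrow> integrable M (\<lambda>\<omega>. f (L h \<omega>))"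
  using integrable_distr_eq[of "\<lambda>\<omega>. L (s + h) \<omega> - L s \<omega>" M borel f]
    integrable_distr_eq[of "L h" M borel f] distr_increment[of s h] assms by simp

lemma expectation_increment:
  fixes f :: "real \<Rightarrow> real"
  assumes [measurable]: "f \<in> borel_measurable borel" and "0 \<le> s" "0 \<le> h"
  shows "expectation (\<lambda>\<omega>. f (L (s + h) \<omega> - L s \<omega>)) = expectation (\<lambda>\<omega>. f (L h \<omega>))"
  using integral_distr[of "\<lambda>\<omega>. L (s + h) \<omega> - L s \<omega>" M borel f]
    integral_distr[of "L h" M borel f] distr_increment[of s h] assms by simp

text \<open>For h \<le> 1 the variable \<open>L 1\<close> is the sum of the independent increments
  over [0, h] and [h, 1], so the first one is square integrable. Stationarity then allows steps of
  length 1.\<close>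

lemma L_square_integrable:
  assumes "0 \<le> t"
  shows "integrable M (\<lambda>\<omega>. (L t \<omega>)\<^sup>2)"
proof -
  have small: "integrable M (\<lambda>\<omega>. (L h \<omega>)\<^sup>2)" if h: "0 \<le> h" "h \<le> 1" for h
  proof -
    have "integrable M (\<lambda>\<omega>. ((L h \<omega> - L 0 \<omega>) + (L 1 \<omega> - L h \<omega>))\<^sup>2)"
    proof (rule integrable_cong_AE_imp[OF square_integrable])
      show "AE \<omega> in M. (L 1 \<omega>)\<^sup>2 = (L h \<omega> - L 0 \<omega> + (L 1 \<omega> - L h \<omega>))\<^sup>2"
        using L_zero by eventually_elim simp
    qed simp
    from indep_var_square_integrable[OF indep_var_increments this] h
    have "integrable M (\<lambda>\<omega>. (L h \<omega> - L 0 \<omega>)\<^sup>2)" by simp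
    then show ?thesis
    proof (rule integrable_cong_AE_imp)
      show "AE \<omega> in M. (L h \<omega> - L 0 \<omega>)\<^sup>2 = (L h \<omega>)\<^sup>2"
        using L_zero by eventually_elim simp
    qed simp
  qed
  have bounded: "0 \<le> t \<Longrightarrow> t \<le> real n \<Longrightarrow> integrable M (\<lambda>\<omega>. (L t \<omega>)\<^sup>2)" for n t
  proof (induction n arbitrary: t)
    case 0
    then show ?case using small[of t] by simp
  next
    case (Suc n)
    show ?case
    proof (cases "t \<le> 1")
      case False
      then have *: "integrable M (\<lambda>\<omega>. (L (t - 1) \<omega>)\<^sup>2)"
        using Suc by simp
      have "integrable M (\<lambda>\<omega>. (L t \<omega> - L (t - 1) \<omega>)\<^sup>2)"
        using integrable_increment_iff[of "\<lambda>x. x\<^sup>2" "t - 1" 1] square_integrable False by simp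
      then have "integrable M (\<lambda>\<omega>. ((L t \<omega> - L (t - 1) \<omega>) + L (t - 1) \<omega>)\<^sup>2)"
        using * by (intro square_integrable_add) auto
      then show ?thesis by simp
    qed (use Suc small in simp)
  qed
  obtain n where "t \<le> real n"
    using real_arch_simple by blast
  then show ?thesis
    using bounded[of t n] assms by simp
qed

lemma increment_square_integrable:
  "0 \<le> s \<Longrightarrow> 0 \<le> t \<Longrightarrow> integrable M (\<lambda>\<omega>. (L t \<omega> - L s \<omega>)\<^sup>2)"
  by (rule square_integrable_diff) (simp_all add: L_square_integrable)

lemma L_integrable: "0 \<le> t \<Longrightarrow> integrable M (L t)"
  by (rule square_integrable_imp_integrable) (simp_all add: L_square_integrable)

lemma expectation_L_add:
  assumes "0 \<le> s" "0 \<le> h"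
  shows "expectation (L (s + h)) = expectation (L s) + expectation (L h)"
proof -
  have "expectation (\<lambda>\<omega>. L (s + h) \<omega> - L s \<omega>) = expectation (L h)"
    using expectation_increment[of "\<lambda>x. x" s h] assms by simp
  then show ?thesis
    using L_integrable assms by simp
qed

text \<open>Variances rather than second moments are added because the means at times other than 1
  are not yet known to vanish.\<close>

lemma variance_L_add:
  assumes "0 \<le> s" "0 \<le> h"
  shows "variance (L (s + h)) = variance (L s) + variance (L h)"
proof -
  let ?m = "\<lambda>t. expectation (L t)"
  have ind: "indep_var borel ((\<lambda>x. x - ?m s) \<circ> (\<lambda>\<omega>. L s \<omega> - L 0 \<omega>)) borel ((\<lambda>x. x - ?m h) \<circ> (\<lambda>\<omega>. L (s + h) \<omega> - L s \<omega>))"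
    using assms by (intro indep_var_compose[OF indep_var_increments]) auto
  have Z: "AE \<omega> in M. L s \<omega> - L 0 \<omega> = L s \<omega>"
    using L_zero by eventually_elim simp
  have "expectation (\<lambda>\<omega>. ((L s \<omega> - L 0 \<omega> - ?m s) + (L (s + h) \<omega> - L s \<omega> - ?m h))\<^sup>2) =
    expectation (\<lambda>\<omega>. (L s \<omega> - L 0 \<omega> - ?m s)\<^sup>2) + expectation (\<lambda>\<omega>. (L (s + h) \<omega> - L s \<omega> - ?m h)\<^sup>2)"
  proof (rule indep_var_expectation_square_add)
    show "indep_var borel (\<lambda>\<omega>. L s \<omega> - L 0 \<omega> - ?m s) borel (\<lambda>\<omega>. L (s + h) \<omega> - L s \<omega> - ?m h)"
      using ind by (simp add: comp_def)
    show "integrable M (\<lambda>\<omega>. (L s \<omega> - L 0 \<omega> - ?m s)\<^sup>2)"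
      using assms by (intro square_integrable_diff[of "\<lambda>\<omega>. L s \<omega> - L 0 \<omega>" "\<lambda>_. ?m s"]) (auto simp: increment_square_integrable)
    show "integrable M (\<lambda>\<omega>. (L (s + h) \<omega> - L s \<omega> - ?m h)\<^sup>2)"
      using assms by (intro square_integrable_diff[of "\<lambda>\<omega>. L (s + h) \<omega> - L s \<omega>" "\<lambda>_. ?m h"]) (auto simp: increment_square_integrable)
    have "expectation (\<lambda>\<omega>. L s \<omega> - L 0 \<omega>) = ?m s"
      by (rule integral_cong_AE) (use Z in auto)
    moreover have "integrable M (\<lambda>\<omega>. L s \<omega> - L 0 \<omega>)"
      using assms L_integrable by auto
    ultimately show "expectation (\<lambda>\<omega>. L s \<omega> - L 0 \<omega> - ?m s) = 0"
      by (simp add: prob_space)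
  qed
  moreover have "expectation (\<lambda>\<omega>. ((L s \<omega> - L 0 \<omega> - ?m s) + (L (s + h) \<omega> - L s \<omega> - ?m h))\<^sup>2) = variance (L (s + h))"
  proof (rule integral_cong_AE)
    show "AE \<omega> in M. ((L s \<omega> - L 0 \<omega> - ?m s) + (L (s + h) \<omega> - L s \<omega> - ?m h))\<^sup>2 = (L (s + h) \<omega> - ?m (s + h))\<^sup>2"
      using L_zero
      by eventually_elim (use expectation_L_add[OF assms] in \<open>simp add: algebra_simps\<close>)
  qed auto
  moreover have "expectation (\<lambda>\<omega>. (L s \<omega> - L 0 \<omega> - ?m s)\<^sup>2) = variance (L s)"
    by (rule integral_cong_AE) (use Z in auto)
  moreover have "expectation (\<lambda>\<omega>. (L (s + h) \<omega> - L s \<omega> - ?m h)\<^sup>2) = variance (L h)"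
    using expectation_increment[of "\<lambda>x. (x - ?m h)\<^sup>2" s h] assms by simp
  ultimately show ?thesis by simp
qed

definition sigma2 :: real where "sigma2 = expectation (\<lambda>\<omega>. (L 1 \<omega>)\<^sup>2)"

lemma variance_L: "0 \<le> t \<Longrightarrow> variance (L t) = t * sigma2"
  using additive_nonneg_linear[of "\<lambda>t. variance (L t)" t] variance_L_add variance_positive mean_zero
  by (simp add: sigma2_def)

lemma sigma2_nonneg: "0 \<le> sigma2"
  by (simp add: sigma2_def)

lemma expectation_L:
  assumes t: "0 \<le> t"
  shows "expectation (L t) = 0"
proof -
  define c where "c = expectation (L t)"
  \<comment> \<open>What remains of t after removing the largest multiple of 1 / (n + 1); at such
    multiples the mean vanishes because it does at 1.\<close>
  define h where "h n = t - real (nat \<lfloor>t * real (Suc n)\<rfloor>) / real (Suc n)" for n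
  have mult: "expectation (L (real k * x)) = real k * expectation (L x)" if "0 \<le> x" for k x
  proof (induction k)
    case 0
    have "expectation (L 0) = expectation (\<lambda>_. 0)"
      by (rule integral_cong_AE) (use L_zero in auto)
    then show ?case by simp
  next
    case (Suc k)
    have "expectation (L (real k * x + x)) = expectation (L (real k * x)) + expectation (L x)"
      using that by (intro expectation_L_add) auto
    then show ?case using Suc by (simp add: algebra_simps)
  qed
  have h: "0 \<le> h n" "h n \<le> 1 / real (Suc n)" for n
  proof -
    define d k where "d = real (Suc n)" and "k = real (nat \<lfloor>t * d\<rfloor>)"
    have "k \<le> t * d" "t * d - k \<le> 1" "0 < d"
      using t unfolding k_def by (auto simp: of_nat_nat d_def simp del: of_nat_Suc) linarith
    then have "k / d \<le> t" "t - k / d \<le> 1 / d"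
      by (auto simp: pos_divide_le_eq pos_le_divide_eq left_diff_distrib)
    then show "0 \<le> h n" "h n \<le> 1 / real (Suc n)"
      unfolding h_def k_def d_def by auto
  qed
  have mh: "expectation (L (h n)) = c" for n
  proof -
    let ?k = "nat \<lfloor>t * real (Suc n)\<rfloor>"
    have "expectation (L (1 / real (Suc n))) = 0"
      using mult[of "1 / real (Suc n)" "Suc n"] mean_zero by (simp del: of_nat_Suc)
    then have "expectation (L (real ?k / real (Suc n))) = 0"
      using mult[of "1 / real (Suc n)" ?k] by simp
    moreover have "expectation (L (real ?k / real (Suc n) + h n)) = c"
      by (simp add: h_def c_def)
    ultimately show ?thesis
      using expectation_L_add[of "real ?k / real (Suc n)" "h n"] h[of n] by simp
  qed
  have h0: "h \<longlonglongrightarrow> 0"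
    by (rule tendsto_sandwich[OF _ _ tendsto_const LIMSEQ_inverse_real_of_nat])
       (use h in \<open>auto simp: inverse_eq_divide\<close>)
  have Lh: "(\<lambda>n. L (h n) \<omega>) \<longlonglongrightarrow> L 0 \<omega>" if "\<omega> \<in> space M" for \<omega>
  proof -
    have "continuous (at_right 0) (\<lambda>s. L s \<omega>)"
      using right_continuous[OF that, of 0] by (simp add: continuous_within)
    then have "continuous (at 0 within {0..}) (\<lambda>s. L s \<omega>)"
      by (simp add: continuous_within at_within_Ici_at_right)
    then show ?thesis
      using h0 h by (auto simp: continuous_within_sequentially comp_def)
  qed
  \<comment> \<open>Truncation by 1 permits dominated convergence, and the truncated quantity is at
    most the variance \<open>h n * sigma2\<close>.\<close>
  have "(\<lambda>n. expectation (\<lambda>\<omega>. min 1 ((L (h n) \<omega> - c)\<^sup>2))) \<longlonglongrightarrow> expectation (\<lambda>\<omega>. min 1 (c\<^sup>2))"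
  proof (rule integral_dominated_convergence[where w="\<lambda>_. 1"])
    show "AE \<omega> in M. (\<lambda>n. min 1 ((L (h n) \<omega> - c)\<^sup>2)) \<longlonglongrightarrow> min 1 (c\<^sup>2)"
      using L_zero AE_space
    proof eventually_elim
      case (elim \<omega>)
      have "(\<lambda>n. min 1 ((L (h n) \<omega> - c)\<^sup>2)) \<longlonglongrightarrow> min 1 ((L 0 \<omega> - c)\<^sup>2)"
        by (intro tendsto_intros Lh elim)
      then show ?case using elim by simp
    qed
  qed auto
  moreover have "(\<lambda>n. expectation (\<lambda>\<omega>. min 1 ((L (h n) \<omega> - c)\<^sup>2))) \<longlonglongrightarrow> 0"
  proof (rule tendsto_sandwich[OF _ _ tendsto_const])
    show "(\<lambda>n. h n * sigma2) \<longlonglongrightarrow> 0"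
      using tendsto_mult_right[OF h0, of sigma2] by simp
    show "\<forall>\<^sub>F n in sequentially. expectation (\<lambda>\<omega>. min 1 ((L (h n) \<omega> - c)\<^sup>2)) \<le> h n * sigma2"
    proof (intro always_eventually allI)
      fix n
      have i: "integrable M (\<lambda>\<omega>. (L (h n) \<omega> - c)\<^sup>2)"
        using h by (intro square_integrable_diff[of "L (h n)" "\<lambda>_. c"]) (auto simp: L_square_integrable)
      have "expectation (\<lambda>\<omega>. min 1 ((L (h n) \<omega> - c)\<^sup>2)) \<le> expectation (\<lambda>\<omega>. (L (h n) \<omega> - c)\<^sup>2)"
        using i by (intro integral_mono integrable_min) auto
      also have "\<dots> = h n * sigma2"
        using variance_L[of "h n"] h mh by simp
      finally show "expectation (\<lambda>\<omega>. min 1 ((L (h n) \<omega> - c)\<^sup>2)) \<le> h n * sigma2" .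
    qed
  qed (auto intro!: integral_nonneg_AE)
  ultimately have "min 1 (c\<^sup>2) = 0"
    using LIMSEQ_unique by (fastforce simp: prob_space)
  then show ?thesis by (auto simp: c_def min_def split: if_splits)
qed

lemma expectation_L_diff: "0 \<le> s \<Longrightarrow> 0 \<le> t \<Longrightarrow> expectation (\<lambda>\<omega>. L t \<omega> - L s \<omega>) = 0"
  using L_integrable expectation_L by simp

lemma expectation_increment_square:
  assumes "0 \<le> s" "s \<le> t"
  shows "expectation (\<lambda>\<omega>. (L t \<omega> - L s \<omega>)\<^sup>2) = sigma2 * (t - s)"
  using expectation_increment[of "\<lambda>x. x\<^sup>2" s "t - s"] variance_L[of "t - s"] expectation_L[of "t - s"] assms
  by (simp add: mult.commute)

end

section \<open>The random measure as an isometry\<close>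

text \<open>The pi-lambda theorem for half-open intervals, the empty set being one of them.
  Complements are taken in the whole line, so applications to bounded sets intersect with a fixed
  window.\<close>

lemma real_Ioc_induct [consumes 1, case_names Ioc compl union]:
  fixes A :: "real set"
  assumes A: "A \<in> sets borel"
    and Ioc: "\<And>a b. P {a<..b}"
    and compl: "\<And>A. A \<in> sets borel \<Longrightarrow> P A \<Longrightarrow> P (- A)"
    and union: "\<And>A. disjoint_family A \<Longrightarrow> (\<And>i::nat. A i \<in> sets borel) \<Longrightarrow> (\<And>i. P (A i)) \<Longrightarrow> P (\<Union>i. A i)"
  shows "P A"
proof -
  let ?G = "range (\<lambda>(a, b). {a<..b::real})"
  have sets: "sets borel = sigma_sets UNIV ?G"
    by (subst borel_sigma_sets_Ioc) (simp add: sets_measure_of)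
  have "Int_stable ?G"
    by (auto simp: Int_stable_def Int_greaterThanAtMost)
  moreover have "?G \<subseteq> Pow UNIV" by simp
  moreover have "A \<in> sigma_sets UNIV ?G" using A sets by simp
  ultimately show ?thesis
  proof (induction rule: sigma_sets_induct_disjoint)
    case empty
    show ?case using Ioc[of 0 0] by simp
  next
    case (compl A)
    then show ?case using assms(3)[of A] sets by (simp add: Compl_eq_Diff_UNIV)
  next
    case (union A)
    then show ?case using assms(4)[of A] sets by auto
  qed (auto simp: Ioc)
qed

context centered_levy
begin

text \<open>\<open>N {}\<close> is the sum of a series all of whose terms are \<open>N {}\<close>,
  and such a series converges only if the terms are 0.\<close>

lemma N_empty: "AE \<omega> in M. N {} \<omega> = 0"
proof -
  have "AE \<omega> in M. (\<lambda>i::nat. N {} \<omega>) sums N (\<Union>i::nat. {}) \<omega>"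
    by (rule N_sums) (auto simp: disjoint_family_on_def)
  then show ?thesis
    by eventually_elim (use summable_LIMSEQ_zero LIMSEQ_const_iff sums_summable in blast)
qed

lemma
  assumes A: "A \<in> bounded_borel" "B \<in> bounded_borel" "A \<inter> B = {}"
  shows N_union: "AE \<omega> in M. N (A \<union> B) \<omega> = N A \<omega> + N B \<omega>"
    and N_indep_var: "indep_var borel (N A) borel (N B)"
proof -
  have r: "range (binaryset A B) \<subseteq> bounded_borel"
    using A unfolding range_binaryset_eq by auto
  have d: "disjoint_family (binaryset A B)"
    using A by (auto simp: disjoint_family_on_def binaryset_def)
  have "AE \<omega> in M. (\<lambda>i. N (binaryset A B i) \<omega>) sums N (\<Union>i. binaryset A B i) \<omega>"
    using A by (intro N_sums[OF r d]) (simp add: UN_binaryset_eq)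
  with N_empty show "AE \<omega> in M. N (A \<union> B) \<omega> = N A \<omega> + N B \<omega>"
  proof eventually_elim
    case (elim \<omega>)
    have "(\<lambda>i. N (binaryset A B i) \<omega>) sums (\<Sum>i\<in>{0, Suc 0}. N (binaryset A B i) \<omega>)"
      by (rule sums_finite) (use elim in \<open>auto simp: binaryset_def\<close>)
    then show ?case
      using sums_unique2[OF elim(2)] by (simp add: UN_binaryset_eq) (simp add: binaryset_def)
  qed
  have "indep_vars (\<lambda>_. borel) (\<lambda>i. N (binaryset A B i)) (insert 0 {Suc 0})"
    using N_indep[OF r d] indep_vars_subset by blast
  \<comment> \<open>\<open>indep_vars_sum\<close> separates one variable from a sum of others; here
    that sum has a single term.\<close>
  from indep_vars_sum[OF _ _ this] show "indep_var borel (N A) borel (N B)"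
    by (simp add: binaryset_def)
qed

lemma N_diff:
  assumes "A \<in> bounded_borel" "B \<in> bounded_borel" "A \<subseteq> B"
  shows "AE \<omega> in M. N (B - A) \<omega> = N B \<omega> - N A \<omega>"
proof -
  have "B - A \<in> bounded_borel"
    using assms by (auto intro: bounded_subset)
  then have "AE \<omega> in M. N (A \<union> (B - A)) \<omega> = N A \<omega> + N (B - A) \<omega>"
    using assms by (intro N_union) auto
  moreover have "A \<union> (B - A) = B" using assms by blast
  ultimately show ?thesis by (auto elim: eventually_mono)
qed

text \<open>The property that the pi-lambda argument propagates. Mean zero is included because it
  cancels the cross term in second moments of disjoint unions.\<close>

definition N_isometric :: "real set \<Rightarrow> bool" where
  "N_isometric A \<longleftrightarrow> integrable M (\<lambda>\<omega>. (N A \<omega>)\<^sup>2) \<and> expectation (N A) = 0 \<and>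
     expectation (\<lambda>\<omega>. (N A \<omega>)\<^sup>2) = sigma2 * measure lborel A"

lemma N_isometric_integrable:
  "A \<in> bounded_borel \<Longrightarrow> N_isometric A \<Longrightarrow> integrable M (N A)"
  unfolding N_isometric_def using N_measurable square_integrable_imp_integrable by blast

lemma bounded_borel_measure_finite: "A \<in> bounded_borel \<Longrightarrow> emeasure lborel A < \<infinity>"
  using emeasure_bounded_finite by auto

lemma N_isometric_Ioc:
  assumes "0 \<le> a"
  shows "N_isometric {a<..b}"
proof (cases "a < b")
  case True
  have [measurable]: "N {a<..b} \<in> borel_measurable M"
    by (rule N_measurable) simp
  have ae: "AE \<omega> in M. L b \<omega> - L a \<omega> = N {a<..b} \<omega>"
    using N_Ioc[OF True] by eventually_elim simp
  have "integrable M (\<lambda>\<omega>. (N {a<..b} \<omega>)\<^sup>2)"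
    using True assms
    by (intro integrable_cong_AE_imp[OF increment_square_integrable[of a b]]) (use ae in auto)
  moreover have "expectation (N {a<..b}) = expectation (\<lambda>\<omega>. L b \<omega> - L a \<omega>)"
    by (rule integral_cong_AE) (use ae in auto)
  moreover have "expectation (\<lambda>\<omega>. (N {a<..b} \<omega>)\<^sup>2) = expectation (\<lambda>\<omega>. (L b \<omega> - L a \<omega>)\<^sup>2)"
    by (rule integral_cong_AE) (use ae in auto)
  ultimately show ?thesis
    using True assms by (simp add: N_isometric_def expectation_L_diff expectation_increment_square)
next
  case False
  have [measurable]: "N {} \<in> borel_measurable M"
    by (rule N_measurable) simp
  have "integrable M (\<lambda>\<omega>. (N {} \<omega>)\<^sup>2)"
    by (rule integrable_cong_AE_imp[of _ "\<lambda>_. 0"]) (use N_empty in auto)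
  moreover have "expectation (N {}) = expectation (\<lambda>_. 0)"
    by (rule integral_cong_AE) (use N_empty in auto)
  moreover have "expectation (\<lambda>\<omega>. (N {} \<omega>)\<^sup>2) = expectation (\<lambda>_. 0)"
    by (rule integral_cong_AE) (use N_empty in auto)
  ultimately show ?thesis
    using False by (simp add: N_isometric_def)
qed

text \<open>\<open>B\<close> is the disjoint union of \<open>A\<close> and \<open>B - A\<close>,
  whose values are independent, so the second moment of \<open>N (B - A)\<close> follows by
  subtraction once its square is known to be integrable.\<close>

lemma N_isometric_diff:
  assumes AB: "A \<in> bounded_borel" "B \<in> bounded_borel" "A \<subseteq> B"
    and "N_isometric A" "N_isometric B"
  shows "N_isometric (B - A)"
proof -
  have D: "B - A \<in> bounded_borel"
    using AB by (auto intro: bounded_subset)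
  note [measurable] = N_measurable[OF AB(1)] N_measurable[OF AB(2)] N_measurable[OF D]
  have ae: "AE \<omega> in M. N B \<omega> - N A \<omega> = N (B - A) \<omega>"
    using N_diff[OF AB] by eventually_elim simp
  have sq: "integrable M (\<lambda>\<omega>. (N A \<omega>)\<^sup>2)" "integrable M (\<lambda>\<omega>. (N B \<omega>)\<^sup>2)"
    using assms by (auto simp: N_isometric_def)
  have sqD: "integrable M (\<lambda>\<omega>. (N (B - A) \<omega>)\<^sup>2)"
    by (rule integrable_cong_AE_imp[OF square_integrable_diff[OF _ _ sq(2) sq(1)]]) (use ae in auto)
  have "expectation (N (B - A)) = expectation (\<lambda>\<omega>. N B \<omega> - N A \<omega>)"
    by (rule integral_cong_AE) (use ae in auto)
  also have "\<dots> = 0"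
    using assms by (simp add: N_isometric_integrable[OF AB(1)] N_isometric_integrable[OF AB(2)]) (simp add: N_isometric_def)
  finally have "expectation (N (B - A)) = 0" .
  moreover have "expectation (\<lambda>\<omega>. (N (B - A) \<omega>)\<^sup>2) = sigma2 * measure lborel (B - A)"
  proof -
    have "expectation (\<lambda>\<omega>. (N A \<omega> + N (B - A) \<omega>)\<^sup>2) = expectation (\<lambda>\<omega>. (N A \<omega>)\<^sup>2) + expectation (\<lambda>\<omega>. (N (B - A) \<omega>)\<^sup>2)"
      using assms by (intro indep_var_expectation_square_add N_indep_var D sq sqD) (auto simp: N_isometric_def)
    moreover have "expectation (\<lambda>\<omega>. (N A \<omega> + N (B - A) \<omega>)\<^sup>2) = expectation (\<lambda>\<omega>. (N B \<omega>)\<^sup>2)"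
    proof (rule integral_cong_AE)
      show "AE \<omega> in M. (N A \<omega> + N (B - A) \<omega>)\<^sup>2 = (N B \<omega>)\<^sup>2"
        using ae by eventually_elim (simp add: algebra_simps)
    qed auto
    moreover have "measure lborel (B - A) = measure lborel B - measure lborel A"
      using AB bounded_borel_measure_finite[OF AB(2)] by (intro measure_Diff) auto
    ultimately show ?thesis
      using assms by (simp add: N_isometric_def right_diff_distrib)
  qed
  ultimately show ?thesis
    using sqD by (simp add: N_isometric_def)
qed

lemma N_isometric_union:
  assumes AB: "A \<in> bounded_borel" "B \<in> bounded_borel" "A \<inter> B = {}"
    and "N_isometric A" "N_isometric B"
  shows "N_isometric (A \<union> B)"
proof -
  have U: "A \<union> B \<in> bounded_borel" using AB by auto
  note [measurable] = N_measurable[OF AB(1)] N_measurable[OF AB(2)] N_measurable[OF U]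
  have ae: "AE \<omega> in M. N A \<omega> + N B \<omega> = N (A \<union> B) \<omega>"
    using N_union[OF AB] by eventually_elim simp
  have sq: "integrable M (\<lambda>\<omega>. (N A \<omega>)\<^sup>2)" "integrable M (\<lambda>\<omega>. (N B \<omega>)\<^sup>2)"
    using assms by (auto simp: N_isometric_def)
  have sqU: "integrable M (\<lambda>\<omega>. (N (A \<union> B) \<omega>)\<^sup>2)"
    by (rule integrable_cong_AE_imp[OF square_integrable_add[OF _ _ sq]]) (use ae in auto)
  have "expectation (N (A \<union> B)) = expectation (\<lambda>\<omega>. N A \<omega> + N B \<omega>)"
    by (rule integral_cong_AE) (use ae in auto)
  also have "\<dots> = 0"
    using assms by (simp add: N_isometric_integrable[OF AB(1)] N_isometric_integrable[OF AB(2)]) (simp add: N_isometric_def)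
  finally have "expectation (N (A \<union> B)) = 0" .
  moreover have "expectation (\<lambda>\<omega>. (N (A \<union> B) \<omega>)\<^sup>2) = sigma2 * measure lborel (A \<union> B)"
  proof -
    have "expectation (\<lambda>\<omega>. (N A \<omega> + N B \<omega>)\<^sup>2) = expectation (\<lambda>\<omega>. (N A \<omega>)\<^sup>2) + expectation (\<lambda>\<omega>. (N B \<omega>)\<^sup>2)"
      using assms by (intro indep_var_expectation_square_add N_indep_var sq) (auto simp: N_isometric_def)
    moreover have "expectation (\<lambda>\<omega>. (N A \<omega> + N B \<omega>)\<^sup>2) = expectation (\<lambda>\<omega>. (N (A \<union> B) \<omega>)\<^sup>2)"
      by (rule integral_cong_AE) (use ae in auto)
    moreover have "measure lborel (A \<union> B) = measure lborel A + measure lborel B"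
      using AB bounded_borel_measure_finite[OF AB(1)] bounded_borel_measure_finite[OF AB(2)]
      by (intro measure_Union) auto
    ultimately show ?thesis
      using assms by (simp add: N_isometric_def distrib_left)
  qed
  ultimately show ?thesis
    using sqU by (simp add: N_isometric_def)
qed

lemma N_isometric_UN_finite:
  fixes A :: "nat \<Rightarrow> real set"
  assumes A: "\<And>i. A i \<in> bounded_borel" "disjoint_family A" and iso: "\<And>i. N_isometric (A i)"
  shows "N_isometric (\<Union>i<n. A i)"
    and "AE \<omega> in M. N (\<Union>i<n. A i) \<omega> = (\<Sum>i<n. N (A i) \<omega>)"
proof -
  have "N_isometric (\<Union>i<n. A i) \<and> (AE \<omega> in M. N (\<Union>i<n. A i) \<omega> = (\<Sum>i<n. N (A i) \<omega>))"
  proof (induction n)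
    case 0
    show ?case using N_isometric_Ioc[of 0 0] N_empty by simp
  next
    case (Suc n)
    have U: "(\<Union>i<Suc n. A i) = (\<Union>i<n. A i) \<union> A n"
      by (auto simp: less_Suc_eq)
    have B: "(\<Union>i<n. A i) \<in> bounded_borel"
      using A by (auto intro!: bounded_UN)
    have D: "(\<Union>i<n. A i) \<inter> A n = {}"
      using A(2) unfolding disjoint_family_on_def by (auto dest: less_imp_neq)
    have "AE \<omega> in M. N ((\<Union>i<n. A i) \<union> A n) \<omega> = (\<Sum>i<Suc n. N (A i) \<omega>)"
      using N_union[OF B A(1) D] conjunct2[OF Suc] by eventually_elim simp
    then show ?case
      unfolding U using N_isometric_union[OF B A(1) D _ iso] Suc by simp
  qed
  then show "N_isometric (\<Union>i<n. A i)" "AE \<omega> in M. N (\<Union>i<n. A i) \<omega> = (\<Sum>i<n. N (A i) \<omega>)"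
    by auto
qed

text \<open>The partial sums converge almost surely, so Fatou bounds the second moment of the limit.
  The inequality already makes tails negligible, which upgrades it to an equality in
  \<open>N_isometric_UN\<close>.\<close>

lemma N_square_bound_UN:
  fixes A :: "nat \<Rightarrow> real set"
  assumes A: "\<And>i. A i \<in> bounded_borel" "disjoint_family A" "bounded (\<Union>i. A i)"
    and iso: "\<And>i. N_isometric (A i)"
  shows "integrable M (\<lambda>\<omega>. (N (\<Union>i. A i) \<omega>)\<^sup>2)"
    and "expectation (\<lambda>\<omega>. (N (\<Union>i. A i) \<omega>)\<^sup>2) \<le> sigma2 * measure lborel (\<Union>i. A i)"
proof -
  let ?U = "\<Union>i. A i"
  have U: "?U \<in> bounded_borel" using A by auto
  have Un: "(\<Union>i<n. A i) \<in> bounded_borel" for n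
    using A by (auto intro!: bounded_UN)
  note [measurable] = N_measurable[OF U] N_measurable[OF A(1)] N_measurable[OF Un]
  have ae: "AE \<omega> in M. (\<lambda>n. N (\<Union>i<n. A i) \<omega>) \<longlonglongrightarrow> N ?U \<omega>"
  proof -
    have "AE \<omega> in M. \<forall>n. N (\<Union>i<n. A i) \<omega> = (\<Sum>i<n. N (A i) \<omega>)"
      using N_isometric_UN_finite(2)[OF A(1,2) iso] by (simp add: AE_all_countable)
    moreover have "AE \<omega> in M. (\<lambda>i. N (A i) \<omega>) sums N ?U \<omega>"
      using A by (intro N_sums) auto
    ultimately show ?thesis
      by eventually_elim (simp add: sums_def)
  qed
  have "(\<integral>\<^sup>+\<omega>. ennreal ((N ?U \<omega>)\<^sup>2) \<partial>M) = (\<integral>\<^sup>+\<omega>. liminf (\<lambda>n. ennreal ((N (\<Union>i<n. A i) \<omega>)\<^sup>2)) \<partial>M)"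
  proof (rule nn_integral_cong_AE)
    show "AE \<omega> in M. ennreal ((N ?U \<omega>)\<^sup>2) = liminf (\<lambda>n. ennreal ((N (\<Union>i<n. A i) \<omega>)\<^sup>2))"
      using ae
    proof eventually_elim
      case (elim \<omega>)
      then have "(\<lambda>n. ennreal ((N (\<Union>i<n. A i) \<omega>)\<^sup>2)) \<longlonglongrightarrow> ennreal ((N ?U \<omega>)\<^sup>2)"
        by (intro tendsto_ennrealI tendsto_power)
      then show ?case
        using lim_imp_Liminf[OF sequentially_bot] by metis
    qed
  qed
  also have "\<dots> \<le> liminf (\<lambda>n. \<integral>\<^sup>+\<omega>. ennreal ((N (\<Union>i<n. A i) \<omega>)\<^sup>2) \<partial>M)"
    by (rule nn_integral_liminf) measurable
  also have "\<dots> \<le> liminf (\<lambda>n::nat. ennreal (sigma2 * measure lborel ?U))"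
  proof (intro Liminf_mono always_eventually allI)
    fix n
    have iso: "N_isometric (\<Union>i<n. A i)"
      by (rule N_isometric_UN_finite[OF A(1,2) iso])
    then have "(\<integral>\<^sup>+\<omega>. ennreal ((N (\<Union>i<n. A i) \<omega>)\<^sup>2) \<partial>M) = ennreal (sigma2 * measure lborel (\<Union>i<n. A i))"
      unfolding N_isometric_def by (subst nn_integral_eq_integral) auto
    also have "\<dots> \<le> ennreal (sigma2 * measure lborel ?U)"
      using sigma2_nonneg U Un bounded_borel_measure_finite[OF U]
      by (intro ennreal_leI mult_left_mono measure_mono_fmeasurable) (auto simp: fmeasurable_def)
    finally show "(\<integral>\<^sup>+\<omega>. ennreal ((N (\<Union>i<n. A i) \<omega>)\<^sup>2) \<partial>M) \<le> ennreal (sigma2 * measure lborel ?U)" .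
  qed
  finally have *: "(\<integral>\<^sup>+\<omega>. ennreal ((N ?U \<omega>)\<^sup>2) \<partial>M) \<le> ennreal (sigma2 * measure lborel ?U)"
    by (simp add: Liminf_const)
  show i: "integrable M (\<lambda>\<omega>. (N ?U \<omega>)\<^sup>2)"
    by (rule integrableI_bounded) (use le_less_trans[OF * ennreal_less_top] in simp_all)
  show "expectation (\<lambda>\<omega>. (N ?U \<omega>)\<^sup>2) \<le> sigma2 * measure lborel ?U"
    using * nn_integral_eq_integral[OF i] sigma2_nonneg by (simp add: ennreal_le_iff)
qed

lemma expectation_le_sqrt:
  assumes [measurable]: "X \<in> borel_measurable M" and sq: "integrable M (\<lambda>\<omega>. (X \<omega>)\<^sup>2)"
  shows "\<bar>expectation X\<bar> \<le> sqrt (expectation (\<lambda>\<omega>. (X \<omega>)\<^sup>2))"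
proof -
  have i: "integrable M X" by (rule square_integrable_imp_integrable[OF _ sq]) simp
  have "(expectation X)\<^sup>2 \<le> expectation (\<lambda>\<omega>. (X \<omega>)\<^sup>2)"
    using variance_eq[OF i sq] variance_positive[of X] by linarith
  then show ?thesis
    using real_sqrt_le_mono[of "(expectation X)\<^sup>2"] by simp
qed

text \<open>The union splits into a finite head, where the isometry holds, and an independent tail
  whose second moment is at most \<open>sigma2\<close> times its vanishing measure. The square root
  of the same bound controls the mean.\<close>

lemma N_isometric_UN:
  fixes A :: "nat \<Rightarrow> real set"
  assumes A: "\<And>i. A i \<in> bounded_borel" "disjoint_family A" "bounded (\<Union>i. A i)"
    and iso: "\<And>i. N_isometric (A i)"
  shows "N_isometric (\<Union>i. A i)"
proof -
  let ?U = "\<Union>i. A i" and ?V = "\<lambda>n. \<Union>i<n. A i" and ?R = "\<lambda>n. \<Union>i. A (n + i)"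
  let ?l = "measure lborel"
  have U: "?U \<in> bounded_borel" using A by auto
  have V: "?V n \<in> bounded_borel" for n
    using A by (auto intro!: bounded_UN)
  have R: "?R n \<in> bounded_borel" for n
    using A(1) by (auto intro: bounded_subset[OF A(3)])
  note [measurable] = N_measurable[OF U] N_measurable[OF V] N_measurable[OF R]
  have UVR: "?U = ?V n \<union> ?R n" for n
  proof (intro equalityI subsetI)
    fix x assume "x \<in> ?U"
    then obtain i where i: "x \<in> A i" by blast
    show "x \<in> ?V n \<union> ?R n"
    proof (cases "i < n")
      case False
      then have "x \<in> A (n + (i - n))" using i by simp
      then show ?thesis by blast
    qed (use i in auto)
  qed auto
  have VR: "?V n \<inter> ?R n = {}" for n
  proof -
    have "A i \<inter> A (n + j) = {}" if "i < n" for i j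
      using A(2) that unfolding disjoint_family_on_def by auto
    then show ?thesis by blast
  qed
  have isoV: "N_isometric (?V n)" for n
    by (rule N_isometric_UN_finite[OF A(1,2) iso])
  have dR: "disjoint_family (\<lambda>i. A (n + i))" for n
    using A(2) unfolding disjoint_family_on_def by auto
  have sqR: "integrable M (\<lambda>\<omega>. (N (?R n) \<omega>)\<^sup>2)"
    and bR: "expectation (\<lambda>\<omega>. (N (?R n) \<omega>)\<^sup>2) \<le> sigma2 * ?l (?R n)" for n
    using N_square_bound_UN[OF A(1) dR _ iso] R by auto
  have sqU: "integrable M (\<lambda>\<omega>. (N ?U \<omega>)\<^sup>2)"
    using N_square_bound_UN[OF A iso] by auto
  have ae: "AE \<omega> in M. N (?V n) \<omega> + N (?R n) \<omega> = N ?U \<omega>" for n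
    using N_union[OF V[of n] R[of n] VR] unfolding UVR[of n, symmetric] by eventually_elim simp
  have lVR: "?l ?U = ?l (?V n) + ?l (?R n)" for n
    unfolding UVR[of n] using V[of n] R[of n] bounded_borel_measure_finite[OF V[of n]] bounded_borel_measure_finite[OF R[of n]] VR[of n]
    by (intro measure_Union) auto
  have lV: "(\<lambda>n. ?l (?V n)) \<longlonglongrightarrow> ?l ?U"
  proof -
    have "incseq ?V"
      by (fastforce simp: incseq_def)
    moreover have "(\<Union>n. ?V n) = ?U" by auto
    moreover have "range ?V \<subseteq> sets lborel" using V by auto
    moreover have "emeasure lborel (\<Union>n. ?V n) \<noteq> \<infinity>"
      using bounded_borel_measure_finite[OF U] \<open>(\<Union>n. ?V n) = ?U\<close> by auto
    ultimately show ?thesis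
      using Lim_measure_incseq[of ?V lborel] by simp
  qed
  have lR: "(\<lambda>n. sigma2 * ?l (?R n)) \<longlonglongrightarrow> 0"
  proof -
    have "?l (?R n) = ?l ?U - ?l (?V n)" for n
      using lVR[of n] by linarith
    then show ?thesis
      using tendsto_mult_left[OF tendsto_diff[OF tendsto_const lV, of "?l ?U"], of sigma2] by simp
  qed
  have iR: "integrable M (N (?R n))" for n
    by (rule square_integrable_imp_integrable[OF _ sqR]) simp
  have meanU: "expectation (N ?U) = expectation (N (?R n))" for n
  proof -
    have "expectation (N ?U) = expectation (\<lambda>\<omega>. N (?V n) \<omega> + N (?R n) \<omega>)"
      by (rule integral_cong_AE) (use ae[of n] in auto)
    then show ?thesis
      using iR N_isometric_integrable[OF V isoV] isoV[of n] by (simp add: N_isometric_def)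
  qed
  have "\<bar>expectation (N ?U)\<bar> \<le> sqrt (sigma2 * ?l (?R n))" for n
    unfolding meanU[of n]
    by (rule order_trans[OF expectation_le_sqrt[OF _ sqR[of n]] real_sqrt_le_mono[OF bR[of n]]]) simp
  moreover have "(\<lambda>n. sqrt (sigma2 * ?l (?R n))) \<longlonglongrightarrow> sqrt 0"
    by (intro tendsto_real_sqrt lR)
  ultimately have "\<bar>expectation (N ?U)\<bar> \<le> 0"
    by (intro LIMSEQ_le_const[of "\<lambda>n. sqrt (sigma2 * ?l (?R n))"]) auto
  moreover have "expectation (\<lambda>\<omega>. (N ?U \<omega>)\<^sup>2) = sigma2 * ?l ?U"
  proof -
    have sqUV: "expectation (\<lambda>\<omega>. (N ?U \<omega>)\<^sup>2) = sigma2 * ?l (?V n) + expectation (\<lambda>\<omega>. (N (?R n) \<omega>)\<^sup>2)" for n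
    proof -
      have "expectation (\<lambda>\<omega>. (N (?V n) \<omega> + N (?R n) \<omega>)\<^sup>2) = expectation (\<lambda>\<omega>. (N (?V n) \<omega>)\<^sup>2) + expectation (\<lambda>\<omega>. (N (?R n) \<omega>)\<^sup>2)"
        using isoV[of n] by (intro indep_var_expectation_square_add N_indep_var V R VR sqR) (auto simp: N_isometric_def)
      moreover have "expectation (\<lambda>\<omega>. (N (?V n) \<omega> + N (?R n) \<omega>)\<^sup>2) = expectation (\<lambda>\<omega>. (N ?U \<omega>)\<^sup>2)"
        by (rule integral_cong_AE) (use ae[of n] in auto)
      ultimately show ?thesis using isoV[of n] by (simp add: N_isometric_def)
    qed
    have "(\<lambda>n. expectation (\<lambda>\<omega>. (N (?R n) \<omega>)\<^sup>2)) \<longlonglongrightarrow> 0"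
      by (rule tendsto_sandwich[OF _ _ tendsto_const lR]) (use bR in auto)
    then have "(\<lambda>n. sigma2 * ?l (?V n) + expectation (\<lambda>\<omega>. (N (?R n) \<omega>)\<^sup>2)) \<longlonglongrightarrow> sigma2 * ?l ?U + 0"
      by (intro tendsto_add tendsto_mult tendsto_const lV)
    then show ?thesis
      unfolding sqUV[symmetric] by (intro LIMSEQ_unique[OF tendsto_const]) simp
  qed
  ultimately show ?thesis
    using sqU by (simp add: N_isometric_def)
qed

lemma N_isometric:
  assumes A: "A \<in> bounded_borel" "A \<subseteq> {0<..}"
  shows "N_isometric A"
proof -
  obtain K where K: "A \<subseteq> {-K..K}"
    using A bounded_subset_cbox_symmetric[of A] by (auto simp: cbox_interval)
  have "A \<in> sets borel" using A by simp
  \<comment> \<open>The window \<open>{0<..K}\<close> keeps complements bounded and inside the times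
    whose moments are known.\<close>
  then have "N_isometric (A \<inter> {0<..K})"
  proof (induction A rule: real_Ioc_induct)
    case (Ioc a b)
    have "{a<..b} \<inter> {0<..K} = {max a 0<..min b K}" by auto
    then show ?case using N_isometric_Ioc[of "max a 0" "min b K"] by simp
  next
    case (compl A)
    have "- A \<inter> {0<..K} = {0<..K} - A \<inter> {0<..K}" by auto
    then show ?case
      using compl N_isometric_diff[of "A \<inter> {0<..K}" "{0<..K}"] N_isometric_Ioc[of 0 K]
      by (auto simp: bounded_Int)
  next
    case (union A)
    have "N_isometric (\<Union>i. A i \<inter> {0<..K})"
      using union by (intro N_isometric_UN)
        (auto simp: disjoint_family_on_def bounded_Int intro!: bounded_subset[OF _ UN_least[OF Int_lower2], of "{0<..K}"])
    then show ?case by (simp add: Int_UN_distrib2)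
  qed
  moreover have "A \<inter> {0<..K} = A"
    using subsetD[OF A(2)] subsetD[OF K] by fastforce
  ultimately show ?thesis by simp
qed

end

section \<open>Integrals of simple functions\<close>

text \<open>Values of \<open>N\<close> and limits in probability are determined only up to null
  sets, which the increment sigma-algebras need not contain.\<close>

definition almost_measurable :: "'a measure \<Rightarrow> 'a measure \<Rightarrow> ('a \<Rightarrow> real) \<Rightarrow> bool" where
  "almost_measurable M F f \<longleftrightarrow> (\<exists>g\<in>borel_measurable F. AE \<omega> in M. f \<omega> = g \<omega>)"

lemma almost_measurableI: "g \<in> borel_measurable F \<Longrightarrow> AE \<omega> in M. f \<omega> = g \<omega> \<Longrightarrow> almost_measurable M F f"
  by (auto simp: almost_measurable_def)

lemma almost_measurable_diff:
  assumes "almost_measurable M F f" "almost_measurable M F g"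
  shows "almost_measurable M F (\<lambda>\<omega>. f \<omega> - g \<omega>)"
proof -
  obtain f' g' where [measurable]: "f' \<in> borel_measurable F" "g' \<in> borel_measurable F"
    and eq: "AE \<omega> in M. f \<omega> = f' \<omega>" "AE \<omega> in M. g \<omega> = g' \<omega>"
    using assms by (auto simp: almost_measurable_def)
  show ?thesis
    by (rule almost_measurableI[of "\<lambda>\<omega>. f' \<omega> - g' \<omega>"]) (use eq in auto)
qed

lemma almost_measurable_sum:
  assumes "finite I" "\<And>i. i \<in> I \<Longrightarrow> almost_measurable M F (f i)"
  shows "almost_measurable M F (\<lambda>\<omega>. \<Sum>i\<in>I. c i * f i \<omega>)"
proof -
  obtain g where g: "\<And>i. i \<in> I \<Longrightarrow> g i \<in> borel_measurable F" "\<And>i. i \<in> I \<Longrightarrow> AE \<omega> in M. f i \<omega> = g i \<omega>"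
    using assms(2) unfolding almost_measurable_def by metis
  have "AE \<omega> in M. \<forall>i\<in>I. f i \<omega> = g i \<omega>"
    using g assms by (intro AE_finite_allI) auto
  then have "AE \<omega> in M. (\<Sum>i\<in>I. c i * f i \<omega>) = (\<Sum>i\<in>I. c i * g i \<omega>)"
    by eventually_elim simp
  moreover have "(\<lambda>\<omega>. \<Sum>i\<in>I. c i * g i \<omega>) \<in> borel_measurable F"
    using g by (intro borel_measurable_sum borel_measurable_times) auto
  ultimately show ?thesis by (rule almost_measurableI[rotated])
qed

context prob_space
begin

text \<open>Convergence to zero in probability is convergence to zero of this functional.\<close>

definition prob_size :: "('a \<Rightarrow> real) \<Rightarrow> real" where
  "prob_size X = expectation (\<lambda>\<omega>. min 1 \<bar>X \<omega>\<bar>)"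

lemma prob_size_integrable:
  "X \<in> borel_measurable M \<Longrightarrow> integrable M (\<lambda>\<omega>. min 1 \<bar>X \<omega>\<bar>)" for X :: "'a \<Rightarrow> real"
  by (rule integrable_const_bound[of _ 1]) auto

lemma prob_size_nonneg: "0 \<le> prob_size X"
  by (auto simp: prob_size_def intro!: integral_nonneg_AE)

lemma prob_size_le_add:
  assumes [measurable]: "X \<in> borel_measurable M" "Y \<in> borel_measurable M" "Z \<in> borel_measurable M"
    and "AE \<omega> in M. \<bar>X \<omega>\<bar> \<le> \<bar>Y \<omega>\<bar> + \<bar>Z \<omega>\<bar>"
  shows "prob_size X \<le> prob_size Y + prob_size Z"
proof -
  have "prob_size X \<le> expectation (\<lambda>\<omega>. min 1 \<bar>Y \<omega>\<bar> + min 1 \<bar>Z \<omega>\<bar>)"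
    unfolding prob_size_def
  proof (rule integral_mono_AE)
    show "AE \<omega> in M. min 1 \<bar>X \<omega>\<bar> \<le> min 1 \<bar>Y \<omega>\<bar> + min 1 \<bar>Z \<omega>\<bar>"
      using assms(4) by eventually_elim linarith
  qed (use prob_size_integrable in simp_all)
  then show ?thesis
    using prob_size_integrable by (simp add: prob_size_def)
qed

lemma prob_size_cong_AE:
  assumes [measurable]: "X \<in> borel_measurable M" "Y \<in> borel_measurable M"
    and "AE \<omega> in M. X \<omega> = Y \<omega>"
  shows "prob_size X = prob_size Y"
  unfolding prob_size_def by (rule integral_cong_AE) (use assms in auto)

lemma prob_size_eq_0:
  assumes "X \<in> borel_measurable M" "prob_size X = 0"
  shows "AE \<omega> in M. X \<omega> = 0"
proof -
  have "AE \<omega> in M. min 1 \<bar>X \<omega>\<bar> = 0"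
    using integral_nonneg_eq_0_iff_AE[OF prob_size_integrable[OF assms(1)]] assms(2)
    by (simp add: prob_size_def)
  then show ?thesis
    by eventually_elim (simp add: min_def split: if_splits)
qed

lemma prob_size_le_sqrt:
  assumes [measurable]: "X \<in> borel_measurable M" and sq: "integrable M (\<lambda>\<omega>. (X \<omega>)\<^sup>2)"
  shows "prob_size X \<le> sqrt (expectation (\<lambda>\<omega>. (X \<omega>)\<^sup>2))"
proof -
  have i: "integrable M X" by (rule square_integrable_imp_integrable[OF _ sq]) simp
  have "prob_size X \<le> expectation (\<lambda>\<omega>. \<bar>X \<omega>\<bar>)"
    unfolding prob_size_def using i by (intro integral_mono prob_size_integrable) auto
  also have "\<dots> \<le> sqrt (expectation (\<lambda>\<omega>. \<bar>X \<omega>\<bar>\<^sup>2))"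
  proof -
    have "(expectation (\<lambda>\<omega>. \<bar>X \<omega>\<bar>))\<^sup>2 \<le> expectation (\<lambda>\<omega>. \<bar>X \<omega>\<bar>\<^sup>2)"
      using variance_eq[of "\<lambda>\<omega>. \<bar>X \<omega>\<bar>"] variance_positive[of "\<lambda>\<omega>. \<bar>X \<omega>\<bar>"] i sq by simp
    then show ?thesis by (rule real_le_rsqrt)
  qed
  finally show ?thesis by simp
qed

lemma converges_in_probability_prob_size:
  assumes "converges_in_probability M Z W"
  shows "(\<lambda>n. prob_size (\<lambda>\<omega>. Z n \<omega> - W \<omega>)) \<longlonglongrightarrow> 0"
proof (rule LIMSEQ_I)
  fix r :: real assume r: "0 < r"
  have [measurable]: "Z n \<in> borel_measurable M" "W \<in> borel_measurable M" for n
    using assms by (auto simp: converges_in_probability_def)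
  let ?E = "\<lambda>n. {\<omega>\<in>space M. r / 2 < \<bar>Z n \<omega> - W \<omega>\<bar>}"
  have "(\<lambda>n. prob (?E n)) \<longlonglongrightarrow> 0"
    using assms half_gt_zero[OF r] unfolding converges_in_probability_def by blast
  then obtain k where k: "\<And>n. n \<ge> k \<Longrightarrow> prob (?E n) < r / 2"
    using LIMSEQ_D[of _ 0 "r / 2"] r by fastforce
  have "norm (prob_size (\<lambda>\<omega>. Z n \<omega> - W \<omega>) - 0) < r" if "n \<ge> k" for n
  proof -
    have "prob_size (\<lambda>\<omega>. Z n \<omega> - W \<omega>) \<le> expectation (\<lambda>\<omega>. r / 2 + indicator (?E n) \<omega>)"
      unfolding prob_size_def
    proof (intro integral_mono prob_size_integrable)
      show "integrable M (\<lambda>\<omega>. r / 2 + indicator (?E n) \<omega>)"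
        by (intro Bochner_Integration.integrable_add integrable_const integrable_real_indicator)
          (auto simp: less_top[symmetric])
      show "min 1 \<bar>Z n \<omega> - W \<omega>\<bar> \<le> r / 2 + indicator (?E n) \<omega>" if "\<omega> \<in> space M" for \<omega>
        using that r by (cases "r / 2 < \<bar>Z n \<omega> - W \<omega>\<bar>") (auto simp: min_def)
    qed simp
    also have "\<dots> = r / 2 + prob (?E n)"
      by (subst Bochner_Integration.integral_add) (auto simp: prob_space less_top[symmetric])
    finally show ?thesis
      using k[OF that] prob_size_nonneg by simp
  qed
  then show "\<exists>k. \<forall>n\<ge>k. norm (prob_size (\<lambda>\<omega>. Z n \<omega> - W \<omega>) - 0) < r"
    by blast
qed

text \<open>A subsequence converges almost surely, and the pointwise \<open>lim\<close> of the
  chosen \<open>F\<close>-measurable versions along it is again \<open>F\<close>-measurable.\<close>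

lemma almost_measurable_limit:
  assumes Z[measurable]: "\<And>n. Z n \<in> borel_measurable M" "W \<in> borel_measurable M"
    and am: "\<And>n::nat. almost_measurable M F (Z n)"
    and lim: "(\<lambda>n. prob_size (\<lambda>\<omega>. Z n \<omega> - W \<omega>)) \<longlonglongrightarrow> 0"
  shows "almost_measurable M F W"
proof -
  obtain g where g: "\<And>n. g n \<in> borel_measurable F" "\<And>n. AE \<omega> in M. Z n \<omega> = g n \<omega>"
    using am unfolding almost_measurable_def by metis
  have "(\<lambda>n. \<integral>\<omega>. norm (min 1 \<bar>Z n \<omega> - W \<omega>\<bar>) \<partial>M) \<longlonglongrightarrow> 0"
    using lim by (simp add: prob_size_def)
  from tendsto_L1_AE_subseq[OF prob_size_integrable this]
  obtain r :: "nat \<Rightarrow> nat" where r: "AE \<omega> in M. (\<lambda>n. min 1 \<bar>Z (r n) \<omega> - W \<omega>\<bar>) \<longlonglongrightarrow> 0"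
    by auto
  have "AE \<omega> in M. \<forall>n. Z n \<omega> = g n \<omega>"
    using g by (simp add: AE_all_countable)
  with r have "AE \<omega> in M. W \<omega> = lim (\<lambda>n. g (r n) \<omega>)"
  proof eventually_elim
    case (elim \<omega>)
    have "(\<lambda>n. Z (r n) \<omega> - W \<omega>) \<longlonglongrightarrow> 0"
    proof (rule tendsto_rabs_zero_cancel, rule Lim_transform_eventually[OF elim(1)])
      have "eventually (\<lambda>n. min 1 \<bar>Z (r n) \<omega> - W \<omega>\<bar> < 1) sequentially"
        using order_tendstoD(2)[OF elim(1), of 1] by simp
      then show "eventually (\<lambda>n. min 1 \<bar>Z (r n) \<omega> - W \<omega>\<bar> = \<bar>Z (r n) \<omega> - W \<omega>\<bar>) sequentially"
        by eventually_elim (auto simp: min_def split: if_splits)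
    qed
    then have "(\<lambda>n. g (r n) \<omega>) \<longlonglongrightarrow> W \<omega>"
      using elim(2) by (simp add: LIM_zero_iff)
    then show ?case by (simp add: limI)
  qed
  moreover have "(\<lambda>\<omega>. lim (\<lambda>n. g (r n) \<omega>)) \<in> borel_measurable F"
    using g by (intro borel_measurable_lim_metric) auto
  ultimately show ?thesis by (rule almost_measurableI[rotated])
qed

end

section \<open>Isometry and measurability of simple integrals\<close>

context centered_levy
begin

lemma N_finite_UN:
  assumes "finite I" "\<And>i. i \<in> I \<Longrightarrow> C i \<in> bounded_borel" "disjoint_family_on C I"
  shows "AE \<omega> in M. N (\<Union>i\<in>I. C i) \<omega> = (\<Sum>i\<in>I. N (C i) \<omega>)"
  using assms
proof (induction I rule: finite_induct)
  case empty
  then show ?case using N_empty by simp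
next
  case (insert x I)
  have "AE \<omega> in M. N (C x \<union> (\<Union>i\<in>I. C i)) \<omega> = N (C x) \<omega> + N (\<Union>i\<in>I. C i) \<omega>"
  proof (rule N_union)
    show "(\<Union>i\<in>I. C i) \<in> bounded_borel"
      using insert by (auto intro!: bounded_UN sets.finite_UN)
    show "C x \<inter> (\<Union>i\<in>I. C i) = {}"
      using insert by (auto simp: disjoint_family_on_def)
  qed (use insert in auto)
  moreover have "AE \<omega> in M. N (\<Union>i\<in>I. C i) \<omega> = (\<Sum>i\<in>I. N (C i) \<omega>)"
    using insert by (auto simp: disjoint_family_on_def)
  ultimately show ?case
    by eventually_elim (use insert in simp)
qed

lemma N_orthogonal_sum:
  assumes fin: "finite I" and C: "\<And>i. i \<in> I \<Longrightarrow> C i \<in> bounded_borel" "\<And>i. i \<in> I \<Longrightarrow> C i \<subseteq> {0<..}"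
    and disj: "disjoint_family_on C I"
  shows "integrable M (\<lambda>\<omega>. (\<Sum>i\<in>I. c i * N (C i) \<omega>)\<^sup>2)"
    and "expectation (\<lambda>\<omega>. (\<Sum>i\<in>I. c i * N (C i) \<omega>)\<^sup>2) = sigma2 * (\<Sum>i\<in>I. (c i)\<^sup>2 * measure lborel (C i))"
proof -
  have iso: "N_isometric (C i)" if "i \<in> I" for i
    using C that by (intro N_isometric)
  have sq: "integrable M (\<lambda>\<omega>. (N (C i) \<omega>)\<^sup>2)" if "i \<in> I" for i
    using iso[OF that] by (simp add: N_isometric_def)
  have prod: "integrable M (\<lambda>\<omega>. N (C i) \<omega> * N (C j) \<omega>)" if "i \<in> I" "j \<in> I" for i j
    using that C by (intro square_integrable_product N_measurable sq)
  have eprod: "expectation (\<lambda>\<omega>. N (C i) \<omega> * N (C j) \<omega>) = (if i = j then sigma2 * measure lborel (C i) else 0)"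
    if "i \<in> I" "j \<in> I" for i j
  proof (cases "i = j")
    case True
    then show ?thesis using iso[OF that(1)] by (simp add: N_isometric_def power2_eq_square)
  next
    case False
    then have "C i \<inter> C j = {}" using disj that by (auto simp: disjoint_family_on_def)
    then have "indep_var borel (N (C i)) borel (N (C j))"
      using C that by (intro N_indep_var)
    from indep_var_lebesgue_integral[OF this] show ?thesis
      using False iso[OF that(1)] N_isometric_integrable iso C that by (simp add: N_isometric_def)
  qed
  have eq: "(\<lambda>\<omega>. (\<Sum>i\<in>I. c i * N (C i) \<omega>)\<^sup>2) = (\<lambda>\<omega>. \<Sum>i\<in>I. \<Sum>j\<in>I. (c i * c j) * (N (C i) \<omega> * N (C j) \<omega>))"
    by (simp add: power2_eq_square sum_product mult_ac)
  show "integrable M (\<lambda>\<omega>. (\<Sum>i\<in>I. c i * N (C i) \<omega>)\<^sup>2)"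
    unfolding eq using prod by simp
  have "expectation (\<lambda>\<omega>. (\<Sum>i\<in>I. c i * N (C i) \<omega>)\<^sup>2) = (\<Sum>i\<in>I. \<Sum>j\<in>I. (c i * c j) * (if i = j then sigma2 * measure lborel (C i) else 0))"
    unfolding eq using prod eprod by (simp add: Bochner_Integration.integral_sum)
  also have "\<dots> = (\<Sum>i\<in>I. (c i * c i) * (sigma2 * measure lborel (C i)))"
    using fin by (intro sum.cong refl) (simp add: if_distrib[of "\<lambda>x. _ * x"] sum.delta cong: if_cong)
  also have "\<dots> = sigma2 * (\<Sum>i\<in>I. (c i)\<^sup>2 * measure lborel (C i))"
    by (simp add: sum_distrib_left power2_eq_square mult_ac)
  finally show "expectation (\<lambda>\<omega>. (\<Sum>i\<in>I. c i * N (C i) \<omega>)\<^sup>2) = sigma2 * (\<Sum>i\<in>I. (c i)\<^sup>2 * measure lborel (C i))" .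
qed

lemma simple_function_preimage: "simple_function borel g \<Longrightarrow> g -` {y} \<in> sets borel"
  for g :: "real \<Rightarrow> real"
  using measurable_sets[OF borel_measurable_simple_function, of borel g "{y}"] by simp

lemma simple_function_finite_range: "simple_function borel g \<Longrightarrow> finite (range g)" for g :: "real \<Rightarrow> real"
  by (simp add: simple_function_def)

lemma simple_integrand_level_bounded:
  assumes "simple_integrand g" "A \<in> sets borel" "y \<noteq> 0"
  shows "A \<inter> g -` {y} \<in> bounded_borel"
proof -
  have "A \<inter> g -` {y} \<subseteq> {x. g x \<noteq> 0}" using assms by auto
  then show ?thesis
    using assms simple_function_preimage[of g y] bounded_subset unfolding simple_integrand_def by auto
qed

lemma simple_integral_measurable:
  assumes "simple_integrand g" "A \<in> sets borel"
  shows "simple_integral_over N A g \<in> borel_measurable M"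
  unfolding simple_integral_over_def[abs_def]
  by (intro borel_measurable_sum borel_measurable_times borel_measurable_const N_measurable
      simple_integrand_level_bounded assms) auto

lemma simple_integral_union:
  assumes g: "simple_integrand g" and A: "A \<in> sets borel" "B \<in> sets borel" "A \<inter> B = {}"
  shows "AE \<omega> in M. simple_integral_over N (A \<union> B) g \<omega> = simple_integral_over N A g \<omega> + simple_integral_over N B g \<omega>"
proof -
  have "AE \<omega> in M. \<forall>y\<in>range g - {0}. N ((A \<union> B) \<inter> g -` {y}) \<omega> = N (A \<inter> g -` {y}) \<omega> + N (B \<inter> g -` {y}) \<omega>"
  proof (rule AE_finite_allI)
    show "finite (range g - {0})"
      using g simple_function_finite_range by (auto simp: simple_integrand_def)
    fix y assume "y \<in> range g - {0}"
    then show "AE \<omega> in M. N ((A \<union> B) \<inter> g -` {y}) \<omega> = N (A \<inter> g -` {y}) \<omega> + N (B \<inter> g -` {y}) \<omega>"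
      unfolding Int_Un_distrib2 using A by (intro N_union simple_integrand_level_bounded g) auto
  qed
  then show ?thesis
    by eventually_elim (simp add: simple_integral_over_def sum.distrib[symmetric] distrib_left)
qed

text \<open>The second function \<open>h\<close> cuts the level sets of \<open>g\<close>, so that
  the integrals of \<open>g\<close> and \<open>h\<close> live on the same partition of
  \<open>A\<close>. The level 0 enters with coefficient 0; boundedness of \<open>A\<close> makes its
  cells admissible for \<open>N\<close>.\<close>

lemma simple_integral_refine:
  fixes g h :: "real \<Rightarrow> real"
  assumes g: "simple_function borel g" and h: "simple_function borel h" and A: "A \<in> bounded_borel"
  shows "AE \<omega> in M. simple_integral_over N A g \<omega> =
    (\<Sum>p\<in>range g \<times> range h. fst p * N (A \<inter> g -` {fst p} \<inter> h -` {snd p}) \<omega>)"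
proof -
  have B: "A \<inter> g -` {y} \<inter> h -` {z} \<in> bounded_borel" for y z
    using A simple_function_preimage[OF g] simple_function_preimage[OF h] by (auto simp: bounded_Int)
  have "AE \<omega> in M. \<forall>y\<in>range g. N (A \<inter> g -` {y}) \<omega> = (\<Sum>z\<in>range h. N (A \<inter> g -` {y} \<inter> h -` {z}) \<omega>)"
  proof (rule AE_finite_allI)
    show "finite (range g)" by (rule simple_function_finite_range[OF g])
    fix y
    have "AE \<omega> in M. N (\<Union>z\<in>range h. A \<inter> g -` {y} \<inter> h -` {z}) \<omega> = (\<Sum>z\<in>range h. N (A \<inter> g -` {y} \<inter> h -` {z}) \<omega>)"
      using simple_function_finite_range[OF h] B by (intro N_finite_UN) (auto simp: disjoint_family_on_def)
    moreover have "(\<Union>z\<in>range h. A \<inter> g -` {y} \<inter> h -` {z}) = A \<inter> g -` {y}" by auto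
    ultimately show "AE \<omega> in M. N (A \<inter> g -` {y}) \<omega> = (\<Sum>z\<in>range h. N (A \<inter> g -` {y} \<inter> h -` {z}) \<omega>)"
      by simp
  qed
  then show ?thesis
  proof eventually_elim
    case (elim \<omega>)
    have "simple_integral_over N A g \<omega> = (\<Sum>y\<in>range g. y * N (A \<inter> g -` {y}) \<omega>)"
      unfolding simple_integral_over_def
      using simple_function_finite_range[OF g] by (intro sum.mono_neutral_left) auto
    also have "\<dots> = (\<Sum>y\<in>range g. \<Sum>z\<in>range h. y * N (A \<inter> g -` {y} \<inter> h -` {z}) \<omega>)"
    proof (intro sum.cong refl)
      fix y assume "y \<in> range g"
      then show "y * N (A \<inter> g -` {y}) \<omega> = (\<Sum>z\<in>range h. y * N (A \<inter> g -` {y} \<inter> h -` {z}) \<omega>)"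
        using bspec[OF elim, of y] by (simp only: sum_distrib_left)
    qed
    finally show ?case
      by (simp add: sum.cartesian_product split_def)
  qed
qed

text \<open>On the common refinement the difference is a single sum over disjoint cells, to which
  orthogonality applies.\<close>

lemma simple_integral_diff_square:
  assumes g: "simple_function borel g" and h: "simple_function borel h"
    and A: "A \<in> bounded_borel" "A \<subseteq> {0<..}"
    and meas: "simple_integral_over N A g \<in> borel_measurable M" "simple_integral_over N A h \<in> borel_measurable M"
  shows "integrable M (\<lambda>\<omega>. (simple_integral_over N A g \<omega> - simple_integral_over N A h \<omega>)\<^sup>2)"
    and "expectation (\<lambda>\<omega>. (simple_integral_over N A g \<omega> - simple_integral_over N A h \<omega>)\<^sup>2) =
      sigma2 * (LINT x|lborel. indicator A x * (g x - h x)\<^sup>2)"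
proof -
  note [measurable] = meas
  let ?I = "range g \<times> range h" and ?C = "\<lambda>p. A \<inter> g -` {fst p} \<inter> h -` {snd p}"
  let ?c = "\<lambda>p. fst p - snd p :: real"
  have fin: "finite ?I"
    using simple_function_finite_range[OF g] simple_function_finite_range[OF h] by simp
  have C: "?C p \<in> bounded_borel" for p
    using A simple_function_preimage[OF g] simple_function_preimage[OF h] by (auto simp: bounded_Int)
  have Cs: "?C p \<subseteq> {0<..}" for p using A by auto
  have disj: "disjoint_family_on ?C ?I"
    unfolding disjoint_family_on_def by (auto simp: prod_eq_iff)
  \<comment> \<open>The refinement of \<open>h\<close> by \<open>g\<close> is indexed by reversed
    pairs; swapping them puts both sums over the same cells.\<close>
  have swap: "(\<Sum>p\<in>range h \<times> range g. fst p * N (A \<inter> h -` {fst p} \<inter> g -` {snd p}) \<omega>) = (\<Sum>p\<in>?I. snd p * N (?C p) \<omega>)" for \<omega>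
    by (rule sum.reindex_bij_witness[of _ prod.swap prod.swap]) (auto simp: Int_assoc Int_commute Int_left_commute)
  have ae: "AE \<omega> in M. (\<Sum>p\<in>?I. ?c p * N (?C p) \<omega>) = simple_integral_over N A g \<omega> - simple_integral_over N A h \<omega>"
    using simple_integral_refine[OF g h A(1)] simple_integral_refine[OF h g A(1)]
    unfolding swap by eventually_elim (simp add: left_diff_distrib sum_subtractf)
  have [measurable]: "N (?C p) \<in> borel_measurable M" for p
    by (rule N_measurable[OF C])
  show "integrable M (\<lambda>\<omega>. (simple_integral_over N A g \<omega> - simple_integral_over N A h \<omega>)\<^sup>2)"
    by (rule integrable_cong_AE_imp[OF N_orthogonal_sum(1)[OF fin C Cs disj, of ?c]]) (use ae in auto)
  have "expectation (\<lambda>\<omega>. (simple_integral_over N A g \<omega> - simple_integral_over N A h \<omega>)\<^sup>2) =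
      expectation (\<lambda>\<omega>. (\<Sum>p\<in>?I. ?c p * N (?C p) \<omega>)\<^sup>2)"
  proof (rule integral_cong_AE)
    show "AE \<omega> in M. (simple_integral_over N A g \<omega> - simple_integral_over N A h \<omega>)\<^sup>2 = (\<Sum>p\<in>?I. ?c p * N (?C p) \<omega>)\<^sup>2"
      using ae by eventually_elim simp
  qed auto
  also have "\<dots> = sigma2 * (\<Sum>p\<in>?I. (?c p)\<^sup>2 * measure lborel (?C p))"
    by (rule N_orthogonal_sum(2)[OF fin C Cs disj])
  also have "(\<Sum>p\<in>?I. (?c p)\<^sup>2 * measure lborel (?C p)) = (LINT x|lborel. (\<Sum>p\<in>?I. (?c p)\<^sup>2 * indicator (?C p) x))"
  proof (subst Bochner_Integration.integral_sum)
    show "integrable lborel (\<lambda>x. (?c p)\<^sup>2 * indicator (?C p) x)" for p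
      using C[of p] bounded_borel_measure_finite[OF C[of p]]
      by (intro integrable_mult_right integrable_real_indicator) auto
  qed simp
  also have "(\<lambda>x. \<Sum>p\<in>?I. (?c p)\<^sup>2 * indicator (?C p) x) = (\<lambda>x. indicator A x * (g x - h x)\<^sup>2)"
  proof
    fix x
    have "(\<Sum>p\<in>?I. (?c p)\<^sup>2 * indicator (?C p) x) = (\<Sum>p\<in>{(g x, h x)}. (?c p)\<^sup>2 * indicator (?C p) x)"
      using fin by (intro sum.mono_neutral_right) (auto simp: indicator_def)
    then show "(\<Sum>p\<in>?I. (?c p)\<^sup>2 * indicator (?C p) x) = indicator A x * (g x - h x)\<^sup>2"
      by (simp add: indicator_def)
  qed
  finally show "expectation (\<lambda>\<omega>. (simple_integral_over N A g \<omega> - simple_integral_over N A h \<omega>)\<^sup>2) =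
      sigma2 * (LINT x|lborel. indicator A x * (g x - h x)\<^sup>2)" .
qed

text \<open>Half-open intervals in the past give increments of L, and almost sure measurability
  passes to differences and to almost surely convergent series.\<close>

lemma N_past:
  assumes A: "A \<in> bounded_borel" "A \<subseteq> {..t}"
  shows "almost_measurable M (increments {..t}) (N A)"
proof -
  obtain K where K: "A \<subseteq> {-K..K}"
    using A bounded_subset_cbox_symmetric[of A] by (auto simp: cbox_interval)
  \<comment> \<open>The left end lies strictly below -K, since a half-open interval starting at -K
    could miss that point of \<open>A\<close>.\<close>
  let ?I = "{-K-1<..t}"
  have int: "B \<inter> ?I \<in> bounded_borel" if "B \<in> sets borel" for B
    using that by (auto simp: bounded_Int)
  have Ioc: "almost_measurable M (increments {..t}) (N {a<..b})" if "b \<le> t" for a b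
  proof (cases "a < b")
    case True
    then show ?thesis
      using that N_Ioc[OF True] increments_measurable[of b "{..t}" a] by (intro almost_measurableI) auto
  next
    case False
    then show ?thesis using N_empty by (intro almost_measurableI[of "\<lambda>_. 0"]) auto
  qed
  have "A \<in> sets borel" using A by simp
  then have "almost_measurable M (increments {..t}) (N (A \<inter> ?I))"
  proof (induction A rule: real_Ioc_induct)
    case (Ioc a b)
    have "{a<..b} \<inter> ?I = {max a (-K-1)<..min b t}" by auto
    then show ?case using assms(1) \<open>\<And>b a. b \<le> t \<Longrightarrow> almost_measurable M (increments {..t}) (N {a<..b})\<close> by simp
  next
    case (compl A)
    have eq: "- A \<inter> ?I = ?I - A \<inter> ?I" by auto
    obtain g where g: "g \<in> borel_measurable (increments {..t})" "AE \<omega> in M. N ?I \<omega> - N (A \<inter> ?I) \<omega> = g \<omega>"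
      using almost_measurable_diff[OF \<open>\<And>b a. b \<le> t \<Longrightarrow> almost_measurable M (increments {..t}) (N {a<..b})\<close> compl(2), of t "-K-1"]
      by (auto simp: almost_measurable_def)
    have "AE \<omega> in M. N (?I - A \<inter> ?I) \<omega> = N ?I \<omega> - N (A \<inter> ?I) \<omega>"
      using int[OF compl(1)] by (intro N_diff) auto
    then have "AE \<omega> in M. N (- A \<inter> ?I) \<omega> = g \<omega>"
      using g(2) unfolding eq by eventually_elim simp
    then show ?case using g(1) by (intro almost_measurableI)
  next
    case (union A)
    obtain g where g: "\<And>i. g i \<in> borel_measurable (increments {..t})" "\<And>i. AE \<omega> in M. N (A i \<inter> ?I) \<omega> = g i \<omega>"
      using union unfolding almost_measurable_def by metis
    have "AE \<omega> in M. (\<lambda>i. N (A i \<inter> ?I) \<omega>) sums N (\<Union>i. A i \<inter> ?I) \<omega>"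
      using union int
      by (intro N_sums) (auto simp: disjoint_family_on_def intro!: bounded_subset[OF _ UN_least[OF Int_lower2], of ?I])
    moreover have "AE \<omega> in M. \<forall>i. N (A i \<inter> ?I) \<omega> = g i \<omega>"
      using g by (simp add: AE_all_countable)
    ultimately have "AE \<omega> in M. N ((\<Union>i. A i) \<inter> ?I) \<omega> = (\<Sum>i. g i \<omega>)"
      unfolding Int_UN_distrib2 by eventually_elim (simp add: sums_iff)
    moreover have "(\<lambda>\<omega>. \<Sum>i. g i \<omega>) \<in> borel_measurable (increments {..t})"
      using g by (intro borel_measurable_suminf)
    ultimately show ?case by (intro almost_measurableI)
  qed
  moreover have "A \<inter> ?I = A"
    using subsetD[OF A(2)] subsetD[OF K] by fastforce
  ultimately show ?thesis by simp
qed

lemma simple_integral_past: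
  assumes g: "simple_integrand g"
  shows "almost_measurable M (increments {..t}) (simple_integral_over N {..t} g)"
  unfolding simple_integral_over_def[abs_def]
proof (rule almost_measurable_sum)
  show "finite (range g - {0})"
    using g simple_function_finite_range by (auto simp: simple_integrand_def)
  show "almost_measurable M (increments {..t}) (N ({..t} \<inter> g -` {y}))" if "y \<in> range g - {0}" for y
    using that by (intro N_past simple_integrand_level_bounded g) auto
qed

end

section \<open>Uniqueness of the integral\<close>

text \<open>Here \<open>u n I\<close> is the size of the n-th error on the blocks with index in
  \<open>I\<close>. If the total size tended to d > 0, then along a subsequence it would sit on
  successive finite ranges of blocks, because finite sets lose their size and tails are small for
  each fixed n. The union of every second range would make the size large and small in turn, against
  its convergence.\<close>

lemma gliding_hump:
  fixes u :: "nat \<Rightarrow> nat set \<Rightarrow> real" and \<tau> :: "nat \<Rightarrow> nat \<Rightarrow> real"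
  assumes sub: "\<And>n I J. I \<inter> J = {} \<Longrightarrow> u n (I \<union> J) \<le> u n I + u n J"
    and sub': "\<And>n I J. I \<inter> J = {} \<Longrightarrow> u n I \<le> u n (I \<union> J) + u n J"
    and nonneg: "\<And>n I. 0 \<le> u n I"
    and fin: "\<And>I. finite I \<Longrightarrow> (\<lambda>n. u n I) \<longlonglongrightarrow> 0"
    and tail: "\<And>n k I. I \<subseteq> {k..} \<Longrightarrow> u n I \<le> \<tau> n k" and \<tau>: "\<And>n. \<tau> n \<longlonglongrightarrow> 0"
    and conv: "\<And>I. convergent (\<lambda>n. u n I)"
  shows "(\<lambda>n. u n UNIV) \<longlonglongrightarrow> 0"
proof (rule ccontr)
  assume not0: "\<not> ?thesis"
  obtain d where d: "(\<lambda>n. u n UNIV) \<longlonglongrightarrow> d"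
    using conv by (auto simp: convergent_def)
  have "0 \<le> d" using LIMSEQ_le_const[OF d] nonneg by blast
  then have "0 < d" using d not0 by (cases "d = 0") auto
  \<comment> \<open>With d = 8 e, a range carries at least d - 3 e = 5 e; the rest of
    \<open>I\<close> costs at most 2 e, which leaves 3 e at even steps, while odd steps have at most
    2 e.\<close>
  define e where "e = d / 8"
  have e: "0 < e" using \<open>0 < d\<close> by (simp add: e_def)
  \<comment> \<open>A state is a pair of a time and a block boundary. The new time makes all sets of
    earlier blocks negligible, then the new boundary makes the tail negligible.\<close>
  define Q where "Q x y \<longleftrightarrow> fst x < fst y \<and> snd x < snd y \<and> (\<forall>J\<subseteq>{..<snd x}. u (fst y) J < e) \<and>
    d - e < u (fst y) UNIV \<and> \<tau> (fst y) (snd y) < e" for x y :: "nat \<times> nat"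
  have step: "\<exists>y. Q x y" for x
  proof -
    have "eventually (\<lambda>n. \<forall>J\<in>Pow {..<snd x}. u n J < e) sequentially"
      by (intro eventually_ball_finite ballI order_tendstoD(2)[OF fin e]) (auto intro: finite_subset)
    moreover have "eventually (\<lambda>n. d - e < u n UNIV) sequentially"
      using order_tendstoD(1)[OF d] e by auto
    moreover have "eventually (\<lambda>n. fst x < n) sequentially"
      by (rule eventually_gt_at_top)
    ultimately have "eventually (\<lambda>n. (\<forall>J\<in>Pow {..<snd x}. u n J < e) \<and> d - e < u n UNIV \<and> fst x < n) sequentially"
      by eventually_elim auto
    then obtain n where n: "\<forall>J\<in>Pow {..<snd x}. u n J < e" "d - e < u n UNIV" "fst x < n"
      using eventually_happens'[OF sequentially_bot] by blast
    have "eventually (\<lambda>k. \<tau> n k < e \<and> snd x < k) sequentially"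
      using order_tendstoD(2)[OF \<tau> e] by (intro eventually_conj eventually_gt_at_top)
    then obtain k where "\<tau> n k < e" "snd x < k"
      using eventually_happens'[OF sequentially_bot] by blast
    then show ?thesis using n by (intro exI[of _ "(n, k)"]) (auto simp: Q_def)
  qed
  obtain f where f: "\<And>j. Q (f j) (f (Suc j))"
    using dependent_nat_choice[of "\<lambda>_ _. True" "\<lambda>_. Q"] step by auto
  define n k where "n j = fst (f (Suc j))" and "k j = snd (f j)" for j
  have k: "k j < k (Suc j)" for j using f[of j] by (simp add: Q_def k_def)
  have "strict_mono k" using k by (simp add: strict_mono_Suc_iff)
  have "strict_mono n" using f by (simp add: strict_mono_Suc_iff n_def Q_def)
  have head: "u (n j) J < e" if "J \<subseteq> {..<k j}" for j J
    using f[of j] that by (simp add: Q_def n_def k_def)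
  have tl: "u (n j) J < e" if "J \<subseteq> {k (Suc j)..}" for j J
    using f[of j] tail[OF that, of "n j"] by (simp add: Q_def n_def k_def)
  have full: "d - e < u (n j) UNIV" for j
    using f[of j] by (simp add: Q_def n_def)
  define F where "F j = {k j..<k (Suc j)}" for j
  define I where "I = (\<Union>j\<in>{j. even j}. F j)"
  have FF: "F i \<inter> F j = {}" if "i \<noteq> j" for i j
  proof -
    have "F i \<inter> F j = {}" if "i < j" for i j
    proof -
      have "k (Suc i) \<le> k j"
        using that \<open>strict_mono k\<close> by (simp add: strict_mono_less_eq)
      then show ?thesis by (auto simp: F_def)
    qed
    then show ?thesis using that by (metis Int_commute nat_neq_iff)
  qed
  have split: "J = (J \<inter> {..<k j}) \<union> ((J \<inter> F j) \<union> (J \<inter> {k (Suc j)..}))" for j and J :: "nat set"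
    using k[of j] by (auto simp: F_def)
  have kk: "I \<inter> {..<k j} \<inter> (I \<inter> {k (Suc j)..}) = {}" for j
    using k[of j] by auto
  have even: "3 * e \<le> u (n j) I" if "even j" for j
  proof -
    have "u (n j) UNIV \<le> u (n j) {..<k j} + (u (n j) (F j) + u (n j) {k (Suc j)..})"
    proof -
      have "u (n j) UNIV \<le> u (n j) {..<k j} + u (n j) (F j \<union> {k (Suc j)..})"
      proof -
        have "{..<k j} \<inter> (F j \<union> {k (Suc j)..}) = {}" "{..<k j} \<union> (F j \<union> {k (Suc j)..}) = UNIV"
          using k[of j] by (auto simp: F_def)
        then show ?thesis using sub[of "{..<k j}" "F j \<union> {k (Suc j)..}" "n j"] by simp
      qed
      also have "u (n j) (F j \<union> {k (Suc j)..}) \<le> u (n j) (F j) + u (n j) {k (Suc j)..}"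
        by (rule sub) (auto simp: F_def)
      finally show ?thesis by simp
    qed
    then have 1: "d - 3 * e \<le> u (n j) (F j)"
      using full[of j] head[of "{..<k j}" j] tl[of "{k (Suc j)..}" j] by simp
    have "F j \<subseteq> I" using that by (auto simp: I_def)
    then have "u (n j) (F j) \<le> u (n j) I + u (n j) (I - F j)"
      using sub'[of "F j" "I - F j" "n j"] by (simp add: Un_absorb1)
    moreover have "u (n j) (I - F j) \<le> u (n j) (I \<inter> {..<k j}) + u (n j) (I \<inter> {k (Suc j)..})"
    proof -
      have "I - F j = I \<inter> {..<k j} \<union> I \<inter> {k (Suc j)..}"
        using k[of j] by (auto simp: F_def)
      then show ?thesis
        using sub[OF kk, of "n j" j] by simp
    qed
    ultimately show ?thesis
      using 1 head[of "I \<inter> {..<k j}" j] tl[of "I \<inter> {k (Suc j)..}" j] by (simp add: e_def)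
  qed
  have odd: "u (n j) I \<le> 2 * e" if "odd j" for j
  proof -
    have "F i \<inter> F j = {}" if "even i" for i
      using FF[of i j] that \<open>odd j\<close> by auto
    then have "I \<inter> F j = {}" by (auto simp: I_def)
    then have "I \<inter> {..<k j} \<union> I \<inter> {k (Suc j)..} = I"
      using split[of I j] by blast
    then have "u (n j) I \<le> u (n j) (I \<inter> {..<k j}) + u (n j) (I \<inter> {k (Suc j)..})"
      using sub[OF kk, of "n j" j] by simp
    then show ?thesis
      using head[of "I \<inter> {..<k j}" j] tl[of "I \<inter> {k (Suc j)..}" j] by simp
  qed
  obtain l where l: "(\<lambda>m. u m I) \<longlonglongrightarrow> l"
    using conv by (auto simp: convergent_def)
  have "(\<lambda>j. u (n (2 * j)) I) \<longlonglongrightarrow> l" "(\<lambda>j. u (n (2 * j + 1)) I) \<longlonglongrightarrow> l"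
    using LIMSEQ_subseq_LIMSEQ[OF l, of "\<lambda>j. n (2 * j)"] LIMSEQ_subseq_LIMSEQ[OF l, of "\<lambda>j. n (2 * j + 1)"] \<open>strict_mono n\<close>
    by (auto simp: comp_def strict_mono_def)
  from LIMSEQ_le_const[OF this(1), of "3 * e"] LIMSEQ_le_const2[OF this(2), of "2 * e"]
  have "3 * e \<le> l" "l \<le> 2 * e"
    using even odd by auto
  then show False using e by simp
qed

context centered_levy
begin

text \<open>\<open>h\<close> is an arbitrary approximating sequence, \<phi> a uniformly Cauchy one.
  Their differences tend to 0 without domination, so points are grouped into blocks by the index
  from which the difference stays at most 1. On finitely many blocks dominated convergence and the
  isometry apply, and \<open>gliding_hump\<close> excludes an escape along the blocks.\<close>

lemma simple_integrals_close:
  fixes h \<phi> :: "nat \<Rightarrow> real \<Rightarrow> real" and s t :: real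
  assumes h: "\<And>n. simple_integrand (h n)" and \<phi>: "\<And>n. simple_integrand (\<phi> n)"
    and s: "0 \<le> s"
    and lim: "AE x in lborel. x \<in> {s<..t} \<longrightarrow> (\<lambda>n. h n x - \<phi> n x) \<longlonglongrightarrow> 0"
    and conv: "\<And>B. B \<in> sets borel \<Longrightarrow> B \<subseteq> {s<..t} \<Longrightarrow>
      \<exists>W\<in>borel_measurable M. (\<lambda>n. prob_size (\<lambda>\<omega>. simple_integral_over N B (h n) \<omega> - W \<omega>)) \<longlonglongrightarrow> 0"
    and unif: "\<And>\<epsilon>. 0 < \<epsilon> \<Longrightarrow> \<exists>k. \<forall>m\<ge>k. \<forall>n\<ge>k. \<forall>x\<in>{s<..t}. \<bar>\<phi> m x - \<phi> n x\<bar> \<le> \<epsilon>"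
  shows "(\<lambda>n. prob_size (\<lambda>\<omega>. simple_integral_over N {s<..t} (h n) \<omega> - simple_integral_over N {s<..t} (\<phi> n) \<omega>)) \<longlonglongrightarrow> 0"
proof -
  define D where "D n x = h n x - \<phi> n x" for n x
  define T where "T n B \<omega> = simple_integral_over N B (h n) \<omega> - simple_integral_over N B (\<phi> n) \<omega>" for n B \<omega>
  define A where "A = {s<..t}"
  have sf: "simple_function borel (h n)" "simple_function borel (\<phi> n)" for n
    using h \<phi> by (auto simp: simple_integrand_def)
  have [measurable]: "h n \<in> borel_measurable borel" "\<phi> n \<in> borel_measurable borel" for n
    using sf by (auto intro: borel_measurable_simple_function)
  have Dm[measurable]: "D n \<in> borel_measurable borel" for n
    unfolding D_def[abs_def] by measurable
  have Sm: "simple_integral_over N B (h n) \<in> borel_measurable M" "simple_integral_over N B (\<phi> n) \<in> borel_measurable M"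
    if "B \<in> sets borel" for B n
    using that h \<phi> by (auto intro: simple_integral_measurable)
  have Tm: "T n B \<in> borel_measurable M" if "B \<in> sets borel" for n B
    unfolding T_def[abs_def] using Sm[OF that] by (intro borel_measurable_diff)
  have bb: "B \<in> bounded_borel" "B \<subseteq> {0<..}" if "B \<in> sets borel" "B \<subseteq> A" for B
  proof -
    show "B \<in> bounded_borel"
      using that bounded_subset[of "{s<..t}" B] by (auto simp: A_def)
    show "B \<subseteq> {0<..}"
      using that(2) s by (auto simp: A_def)
  qed
  have Dbound: "\<exists>K. \<forall>x. \<bar>D n x\<bar> \<le> K" for n
  proof -
    have "bounded (range (h n))" "bounded (range (\<phi> n))"
      by (intro finite_imp_bounded simple_function_finite_range sf)+
    then obtain K1 K2 where "\<And>x. norm (h n x) \<le> K1" "\<And>x. norm (\<phi> n x) \<le> K2"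
      unfolding bounded_iff by blast
    then have "\<bar>D n x\<bar> \<le> K1 + K2" for x
      unfolding D_def by (smt (verit) real_norm_def)
    then show ?thesis by blast
  qed
  have A_int: "integrable lborel (\<lambda>x. indicator A x * c)" for c :: real
    unfolding A_def using bounded_borel_measure_finite[of "{s<..t}"]
    by (intro integrable_mult_left integrable_real_indicator) auto
  have D_int: "integrable lborel (\<lambda>x. indicator B x * (D n x)\<^sup>2)" if "B \<in> sets borel" "B \<subseteq> A" for B n
  proof -
    obtain K where K: "\<And>x. \<bar>D n x\<bar> \<le> K" using Dbound by blast
    show ?thesis
    proof (rule Bochner_Integration.integrable_bound[OF A_int[of "K\<^sup>2"]])
      show "AE x in lborel. norm (indicator B x * (D n x)\<^sup>2) \<le> norm (indicator A x * K\<^sup>2)"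
      proof (rule AE_I2)
        fix x
        have "(D n x)\<^sup>2 \<le> K\<^sup>2"
          using power_mono[OF K abs_ge_zero, of x 2] by simp
        then show "norm (indicator B x * (D n x)\<^sup>2) \<le> norm (indicator A x * K\<^sup>2)"
          using that by (auto simp: indicator_def)
      qed
    qed (use that in measurable)
  qed
  have size: "prob_size (T n B) \<le> sqrt (sigma2 * (LINT x|lborel. indicator B x * (D n x)\<^sup>2))"
    if "B \<in> sets borel" "B \<subseteq> A" for n B
    using prob_size_le_sqrt[OF Tm[OF that(1)], of n] simple_integral_diff_square[OF sf bb[OF that] Sm[OF that(1)], of n n]
    by (simp add: T_def D_def)
  have T_union: "AE \<omega> in M. T n (B \<union> C) \<omega> = T n B \<omega> + T n C \<omega>"
    if "B \<in> sets borel" "C \<in> sets borel" "B \<inter> C = {}" for n B C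
    using simple_integral_union[OF h[of n] that] simple_integral_union[OF \<phi>[of n] that]
    unfolding T_def by eventually_elim simp
  define G where "G = {x. (\<lambda>n. D n x) \<longlonglongrightarrow> 0}"
  have [measurable]: "G \<in> sets borel"
    unfolding G_def by measurable
  define idx where "idx x = (LEAST m. \<forall>n\<ge>m. \<bar>D n x\<bar> \<le> 1)" for x
  have [measurable]: "idx \<in> measurable borel (count_space UNIV)"
    unfolding idx_def[abs_def] by measurable
  have idx: "\<bar>D n x\<bar> \<le> 1" if "x \<in> G" "idx x \<le> n" for n x
  proof -
    have "eventually (\<lambda>n. \<bar>D n x\<bar> < 1) sequentially"
      using that(1) order_tendstoD(2)[OF tendsto_rabs_zero, of "\<lambda>n. D n x" sequentially 1] by (simp add: G_def)
    then have "\<exists>m. \<forall>n\<ge>m. \<bar>D n x\<bar> \<le> 1"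
      unfolding eventually_sequentially using less_imp_le by blast
    then have "\<forall>n\<ge>idx x. \<bar>D n x\<bar> \<le> 1"
      unfolding idx_def by (rule LeastI_ex)
    then show ?thesis using that(2) by blast
  qed
  define B where "B I = {x\<in>A \<inter> G. idx x \<in> I}" for I
  have BA: "B I \<subseteq> A" for I by (auto simp: B_def)
  have Bs[measurable]: "B I \<in> sets borel" for I
  proof -
    have "B I = (A \<inter> G) \<inter> (idx -` I \<inter> space borel)" by (auto simp: B_def)
    moreover have "idx -` I \<inter> space borel \<in> sets borel"
      by (rule measurable_sets[of idx borel "count_space UNIV"]) auto
    ultimately show ?thesis by (simp add: A_def)
  qed
  have BU: "B (I \<union> J) = B I \<union> B J" and BI: "I \<inter> J = {} \<Longrightarrow> B I \<inter> B J = {}" for I J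
    by (auto simp: B_def)
  let ?u = "\<lambda>n I. prob_size (T n (B I))"
  have fin: "(\<lambda>n. ?u n I) \<longlonglongrightarrow> 0" if I: "finite I" for I
  proof -
    obtain m where m: "\<And>i. i \<in> I \<Longrightarrow> i \<le> m"
      using finite_nat_set_iff_bounded_le[of I] I by auto
    \<comment> \<open>Shifting the sequence by the largest block index m makes all differences at
      most 1 on these blocks.\<close>
    have "(\<lambda>n. LINT x|lborel. indicator (B I) x * (D (n + m) x)\<^sup>2) \<longlonglongrightarrow> (LINT x::real|lborel. 0)"
    proof (rule integral_dominated_convergence[where w="\<lambda>x. indicator A x * 1"])
      show "AE x in lborel. (\<lambda>n. indicator (B I) x * (D (n + m) x)\<^sup>2) \<longlonglongrightarrow> 0"
      proof (rule AE_I2)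
        fix x
        show "(\<lambda>n. indicator (B I) x * (D (n + m) x)\<^sup>2) \<longlonglongrightarrow> 0"
        proof (cases "x \<in> B I")
          case True
          then have "(\<lambda>n. D n x) \<longlonglongrightarrow> 0" by (simp add: B_def G_def)
          from tendsto_power[OF LIMSEQ_ignore_initial_segment[OF this, of m], of 2]
          show ?thesis using True by simp
        qed simp
      qed
      show "AE x in lborel. norm (indicator (B I) x * (D (n + m) x)\<^sup>2) \<le> indicator A x * 1" for n
      proof (rule AE_I2)
        fix x
        show "norm (indicator (B I) x * (D (n + m) x)\<^sup>2) \<le> indicator A x * 1"
        proof (cases "x \<in> B I")
          case True
          then have "\<bar>D (n + m) x\<bar> \<le> 1"
            using m[of "idx x"] by (intro idx) (auto simp: B_def)
          then show ?thesis using True BA[of I] by (auto simp: abs_square_le_1)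
        qed (auto simp: indicator_def)
      qed
    qed (use A_int[of 1] in measurable)
    from tendsto_real_sqrt[OF tendsto_mult_left[OF this, of sigma2]]
    have "(\<lambda>n. sqrt (sigma2 * (LINT x|lborel. indicator (B I) x * (D (n + m) x)\<^sup>2))) \<longlonglongrightarrow> 0" by simp
    from tendsto_sandwich[OF _ _ tendsto_const this, of "\<lambda>n. ?u (n + m) I"]
    have "(\<lambda>n. ?u (n + m) I) \<longlonglongrightarrow> 0"
      using prob_size_nonneg size[OF Bs BA] by auto
    then show ?thesis by (rule LIMSEQ_offset)
  qed
  define \<tau> where "\<tau> n k = sqrt (sigma2 * (LINT x|lborel. indicator (B {k..}) x * (D n x)\<^sup>2))" for n k
  have tail: "?u n I \<le> \<tau> n k" if "I \<subseteq> {k..}" for n k I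
  proof -
    have "?u n I \<le> sqrt (sigma2 * (LINT x|lborel. indicator (B I) x * (D n x)\<^sup>2))"
      by (rule size[OF Bs BA])
    also have "\<dots> \<le> \<tau> n k"
      unfolding \<tau>_def using that
      by (intro real_sqrt_le_mono mult_left_mono sigma2_nonneg integral_mono D_int Bs BA)
        (auto simp: B_def indicator_def)
    finally show ?thesis .
  qed
  have \<tau>: "\<tau> n \<longlonglongrightarrow> 0" for n
  proof -
    have "(\<lambda>k. LINT x|lborel. indicator (B {k..}) x * (D n x)\<^sup>2) \<longlonglongrightarrow> (LINT x::real|lborel. 0)"
    proof (rule integral_dominated_convergence[where w="\<lambda>x. indicator A x * (D n x)\<^sup>2"])
      show "AE x in lborel. (\<lambda>k. indicator (B {k..}) x * (D n x)\<^sup>2) \<longlonglongrightarrow> 0"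
      proof (rule AE_I2)
        fix x
        have "eventually (\<lambda>k. indicator (B {k..}) x * (D n x)\<^sup>2 = 0) sequentially"
          using eventually_gt_at_top[of "idx x"] by eventually_elim (auto simp: B_def)
        then show "(\<lambda>k. indicator (B {k..}) x * (D n x)\<^sup>2) \<longlonglongrightarrow> 0"
          by (rule tendsto_eventually)
      qed
      show "AE x in lborel. norm (indicator (B {k..}) x * (D n x)\<^sup>2) \<le> indicator A x * (D n x)\<^sup>2" for k
        using BA[of "{k..}"] by (auto simp: indicator_def)
      show "integrable lborel (\<lambda>x. indicator A x * (D n x)\<^sup>2)"
        by (rule D_int) (auto simp: A_def)
    qed measurable
    from tendsto_real_sqrt[OF tendsto_mult_left[OF this, of sigma2]]
    show ?thesis by (simp add: \<tau>_def[abs_def])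
  qed
  \<comment> \<open>The integrals of \<open>h\<close> over \<open>B I\<close> converge in
    probability, and those of \<phi> are Cauchy in mean square by uniformity. Comparing two
    differences costs e / 4 twice for the former and once for the latter.\<close>
  have conv_u: "convergent (\<lambda>n. ?u n I)" for I
  proof (rule Cauchy_convergent, rule metric_CauchyI)
    fix e :: real assume e: "0 < e"
    obtain W where W: "W \<in> borel_measurable M"
      "(\<lambda>n. prob_size (\<lambda>\<omega>. simple_integral_over N (B I) (h n) \<omega> - W \<omega>)) \<longlonglongrightarrow> 0"
      using conv[OF Bs[of I] BA[of I, unfolded A_def]] by blast
    obtain k1 where k1: "\<And>n. n \<ge> k1 \<Longrightarrow> prob_size (\<lambda>\<omega>. simple_integral_over N (B I) (h n) \<omega> - W \<omega>) < e / 4"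
      using order_tendstoD(2)[OF W(2), of "e / 4"] e by (auto simp: eventually_sequentially)
    define c where "c = sigma2 * measure lborel A"
    have c: "0 \<le> c" by (simp add: c_def sigma2_nonneg)
    \<comment> \<open>The isometry turns a uniform error \<epsilon> on \<open>A\<close> into
      \<open>sqrt c * \<epsilon>\<close>; adding 1 avoids division by 0 when c = 0.\<close>
    define \<epsilon> where "\<epsilon> = e / 4 / (sqrt c + 1)"
    have \<epsilon>: "0 < \<epsilon>" "sqrt c * \<epsilon> \<le> e / 4"
      using e c by (auto simp: \<epsilon>_def field_simps add_pos_nonneg add_nonneg_pos)
    obtain k2 where k2: "\<And>m n x. m \<ge> k2 \<Longrightarrow> n \<ge> k2 \<Longrightarrow> x \<in> A \<Longrightarrow> \<bar>\<phi> m x - \<phi> n x\<bar> \<le> \<epsilon>"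
      using unif[OF \<epsilon>(1)] unfolding A_def by blast
    have phi: "prob_size (\<lambda>\<omega>. simple_integral_over N (B I) (\<phi> m) \<omega> - simple_integral_over N (B I) (\<phi> n) \<omega>) \<le> e / 4"
      if "m \<ge> k2" "n \<ge> k2" for m n
    proof -
      note sq = simple_integral_diff_square[OF sf(2)[of m] sf(2)[of n] bb[OF Bs[of I] BA] Sm(2)[OF Bs[of I]] Sm(2)[OF Bs[of I]]]
      have "prob_size (\<lambda>\<omega>. simple_integral_over N (B I) (\<phi> m) \<omega> - simple_integral_over N (B I) (\<phi> n) \<omega>)
        \<le> sqrt (sigma2 * (LINT x|lborel. indicator (B I) x * (\<phi> m x - \<phi> n x)\<^sup>2))"
        using prob_size_le_sqrt[OF borel_measurable_diff[OF Sm(2)[OF Bs[of I], of m] Sm(2)[OF Bs[of I], of n]]] sq by simp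
      also have "\<dots> \<le> sqrt (sigma2 * (LINT x|lborel. indicator A x * \<epsilon>\<^sup>2))"
      proof (intro real_sqrt_le_mono mult_left_mono sigma2_nonneg integral_mono A_int)
        have *: "norm (indicator (B I) x * (\<phi> m x - \<phi> n x)\<^sup>2) \<le> indicator A x * \<epsilon>\<^sup>2" for x
          using BA[of I] k2[OF that, of x] \<epsilon>(1) by (auto simp: indicator_def abs_le_square_iff[symmetric])
        show "integrable lborel (\<lambda>x. indicator (B I) x * (\<phi> m x - \<phi> n x)\<^sup>2)"
          by (rule Bochner_Integration.integrable_bound[OF A_int[of "\<epsilon>\<^sup>2"]]) (use * in \<open>auto simp: order_trans[OF *]\<close>)
        show "indicator (B I) x * (\<phi> m x - \<phi> n x)\<^sup>2 \<le> indicator A x * \<epsilon>\<^sup>2" for x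
          using *[of x] by simp
      qed
      also have "(LINT x|lborel. indicator A x * \<epsilon>\<^sup>2) = measure lborel A * \<epsilon>\<^sup>2"
        by (simp add: A_def)
      also have "sqrt (sigma2 * (measure lborel A * \<epsilon>\<^sup>2)) = sqrt c * \<epsilon>"
        using \<epsilon>(1) by (simp add: c_def real_sqrt_mult)
      finally show ?thesis using \<epsilon>(2) by simp
    qed
    have le: "?u m I \<le> ?u n I + 3 * (e / 4)" if "m \<ge> max k1 k2" "n \<ge> max k1 k2" for m n
    proof -
      note [measurable] = Sm[OF Bs] Tm[OF Bs] W(1)
      let ?h = "\<lambda>n \<omega>. simple_integral_over N (B I) (h n) \<omega> - W \<omega>"
      let ?p = "\<lambda>\<omega>. simple_integral_over N (B I) (\<phi> m) \<omega> - simple_integral_over N (B I) (\<phi> n) \<omega>"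
      have "?u m I \<le> ?u n I + prob_size (\<lambda>\<omega>. T m (B I) \<omega> - T n (B I) \<omega>)"
        by (intro prob_size_le_add) auto
      also have "prob_size (\<lambda>\<omega>. T m (B I) \<omega> - T n (B I) \<omega>) \<le> prob_size (\<lambda>\<omega>. ?h m \<omega> - ?h n \<omega>) + prob_size ?p"
        by (intro prob_size_le_add) (auto simp: T_def)
      also have "prob_size (\<lambda>\<omega>. ?h m \<omega> - ?h n \<omega>) \<le> prob_size (?h m) + prob_size (?h n)"
        by (intro prob_size_le_add) auto
      finally show ?thesis
        using k1[of m] k1[of n] phi[of m n] that by simp
    qed
    show "\<exists>k. \<forall>m\<ge>k. \<forall>n\<ge>k. dist (?u m I) (?u n I) < e"
    proof (intro exI allI impI)
      fix m n assume "max k1 k2 \<le> m" "max k1 k2 \<le> n"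
      then show "dist (?u m I) (?u n I) < e"
        using le[of m n] le[of n m] e by (auto simp: dist_real_def abs_less_iff)
    qed
  qed
  have "(\<lambda>n. ?u n UNIV) \<longlonglongrightarrow> 0"
  proof (rule gliding_hump[where u="?u" and \<tau>=\<tau>])
    fix n and I J :: "nat set" assume IJ: "I \<inter> J = {}"
    note u = T_union[OF Bs Bs BI[OF IJ], of n]
    show "?u n (I \<union> J) \<le> ?u n I + ?u n J"
      unfolding BU using u Tm[OF Bs] Tm[OF sets.Un[OF Bs Bs]] by (intro prob_size_le_add) (auto elim!: eventually_mono)
    show "?u n I \<le> ?u n (I \<union> J) + ?u n J"
      unfolding BU using u Tm[OF Bs] Tm[OF sets.Un[OF Bs Bs]] by (intro prob_size_le_add) (auto elim!: eventually_mono)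
  qed (use fin tail \<tau> conv_u prob_size_nonneg in auto)
  \<comment> \<open>The points in no block form a null set, over which the isometry makes the
    integral vanish almost surely.\<close>
  moreover have "prob_size (T n A) = ?u n UNIV" for n
  proof (rule prob_size_cong_AE)
    have A: "A \<in> sets borel" by (simp add: A_def)
    have D: "A - B UNIV \<in> sets borel" "A - B UNIV \<subseteq> A" using A by auto
    have "AE x in lborel. indicator (A - B UNIV) x * (D n x)\<^sup>2 = 0"
      using lim by eventually_elim (auto simp: B_def G_def D_def A_def indicator_def)
    then have "(LINT x|lborel. indicator (A - B UNIV) x * (D n x)\<^sup>2) = 0"
      by (rule integral_eq_zero_AE)
    then have "prob_size (T n (A - B UNIV)) = 0"
      using size[OF D, of n] prob_size_nonneg[of "T n (A - B UNIV)"] by simp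
    then have "AE \<omega> in M. T n (A - B UNIV) \<omega> = 0"
      by (rule prob_size_eq_0[OF Tm[OF D(1)]])
    moreover have "AE \<omega> in M. T n (B UNIV \<union> (A - B UNIV)) \<omega> = T n (B UNIV) \<omega> + T n (A - B UNIV) \<omega>"
      using D by (intro T_union) auto
    moreover have "B UNIV \<union> (A - B UNIV) = A" using BA by auto
    ultimately show "AE \<omega> in M. T n A \<omega> = T n (B UNIV) \<omega>"
      by (auto elim: eventually_elim2)
    show "T n A \<in> borel_measurable M" "T n (B UNIV) \<in> borel_measurable M"
      using A Bs Tm by auto
  qed
  ultimately show ?thesis
    by (simp add: T_def[abs_def] A_def)
qed

end

section \<open>Riemann--Liouville integrals of paths\<close>

lemma has_bochner_integral_nonneg_Ioo:
  fixes f :: "real \<Rightarrow> real"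
  assumes m[measurable]: "f \<in> borel_measurable borel" and nonneg: "\<And>x. x \<in> {a<..<b} \<Longrightarrow> 0 \<le> f x"
    and I: "(f has_integral I) {a..b}"
  shows "has_bochner_integral lborel (\<lambda>x. indicator {a<..<b} x * f x) I"
proof -
  let ?g = "\<lambda>x. indicator {a<..<b} x * f x"
  have g0: "0 \<le> ?g x" for x using nonneg by (auto simp: indicator_def)
  have "(f has_integral I) {a<..<b}"
    using I has_integral_Icc_iff_Ioo by blast
  then have i: "(?g has_integral I) UNIV"
    by (subst (asm) has_integral_restrict_UNIV[symmetric])
      (auto elim!: has_integral_eq[rotated] simp: indicator_def)
  have "0 \<le> I" by (rule has_integral_nonneg[OF i]) (rule g0)
  have "integral\<^sup>N lborel ?g = ennreal I"
    by (rule nn_integral_has_integral_lborel[OF _ g0 i]) measurable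
  then show ?thesis
    using g0 \<open>0 \<le> I\<close> by (intro has_bochner_integral_nn_integral) auto
qed

text \<open>Minus the derivative of (t - r) powr a in r, on the window from s to t; its total mass
  is therefore (t - s) powr a.\<close>

definition rl_kernel :: "real \<Rightarrow> real \<Rightarrow> real \<Rightarrow> real \<Rightarrow> real" where
  "rl_kernel a s t r = indicator {s<..<t} r * (a * (t - r) powr (a - 1))"

text \<open>The Riemann--Liouville integral of order \<open>a\<close>, up to the factor \<open>Gamma (a + 1)\<close>.\<close>

definition rl_integral :: "real \<Rightarrow> real \<Rightarrow> (real \<Rightarrow> real) \<Rightarrow> real \<Rightarrow> real" where
  "rl_integral a s l t = (LINT r|lborel. rl_kernel a s t r * l r)"

lemma rl_kernel_measurable[measurable]: "rl_kernel a s t \<in> borel_measurable borel"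
  unfolding rl_kernel_def[abs_def] by measurable

lemma rl_kernel_nonneg: "0 < a \<Longrightarrow> 0 \<le> rl_kernel a s t r"
  by (simp add: rl_kernel_def)

lemma has_bochner_integral_rl_kernel:
  assumes "0 < a" "s \<le> t"
  shows "has_bochner_integral lborel (rl_kernel a s t) ((t - s) powr a)"
proof -
  have "((\<lambda>x. x powr (a - 1)) has_integral ((t - s) powr (a - 1 + 1) / (a - 1 + 1))) {0..t - s}"
    using assms by (intro has_integral_powr_from_0) auto
  from has_integral_mult_right[OF this, of a]
  have "((\<lambda>x. a * x powr (a - 1)) has_integral (t - s) powr a) {0..t - s}"
    using assms by simp
  then have "has_bochner_integral lborel (\<lambda>x. indicator {0<..<t - s} x * (a * x powr (a - 1))) ((t - s) powr a)"
    using assms by (intro has_bochner_integral_nonneg_Ioo) auto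
  then have "has_bochner_integral lborel (\<lambda>x. indicator {0<..<t - s} (t + (- 1) * x) * (a * (t + (- 1) * x) powr (a - 1))) ((t - s) powr a)"
    by (subst (asm) lborel_has_bochner_integral_real_affine_iff[of "-1" _ _ t]) auto
  moreover have "indicator {0<..<t - s} (t + (- 1) * x) * (a * (t + (- 1) * x) powr (a - 1)) = rl_kernel a s t x" for x
    by (auto simp: rl_kernel_def indicator_def)
  ultimately show ?thesis by simp
qed

lemma rl_kernel_integrable: "0 < a \<Longrightarrow> s \<le> t \<Longrightarrow> integrable lborel (rl_kernel a s t)"
  and rl_kernel_integral: "0 < a \<Longrightarrow> s \<le> t \<Longrightarrow> (LINT r|lborel. rl_kernel a s t r) = (t - s) powr a"
  using has_bochner_integral_rl_kernel by (auto simp: has_bochner_integral_iff)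

text \<open>Path regularity is available for nonnegative times, so measurability of \<open>l\<close>
  is expressed on the half-line beyond \<open>s\<close>, which contains the support of the
  kernel.\<close>

lemma rl_integrand_measurable:
  assumes "(\<lambda>r. indicator {s<..} r * l r) \<in> borel_measurable borel"
  shows "(\<lambda>r. rl_kernel a s t r * l r) \<in> borel_measurable borel"
proof -
  have "(\<lambda>r. rl_kernel a s t r * (indicator {s<..} r * l r)) \<in> borel_measurable borel"
    using assms by measurable
  moreover have "rl_kernel a s t r * (indicator {s<..} r * l r) = rl_kernel a s t r * l r" for r
    by (simp add: rl_kernel_def indicator_def)
  ultimately show ?thesis by simp
qed

lemma rl_integrand_integrable:
  assumes a: "0 < a" "s \<le> t" and m: "(\<lambda>r. indicator {s<..} r * l r) \<in> borel_measurable borel"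
    and K: "\<And>r. r \<in> {s<..<t} \<Longrightarrow> \<bar>l r\<bar> \<le> K"
  shows "integrable lborel (\<lambda>r. rl_kernel a s t r * l r)"
proof (rule Bochner_Integration.integrable_bound)
  show "integrable lborel (\<lambda>r. K * rl_kernel a s t r)"
    using rl_kernel_integrable[OF a] by simp
  show "AE r in lborel. norm (rl_kernel a s t r * l r) \<le> norm (K * rl_kernel a s t r)"
  proof (rule AE_I2)
    fix r
    show "norm (rl_kernel a s t r * l r) \<le> norm (K * rl_kernel a s t r)"
    proof (cases "r \<in> {s<..<t}")
      case True
      then show ?thesis
        using mult_left_mono[OF order_trans[OF K[OF True] abs_ge_self], of "\<bar>rl_kernel a s t r\<bar>"]
        by (simp add: abs_mult mult.commute)
    qed (simp add: rl_kernel_def)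
  qed
qed (use rl_integrand_measurable[OF m] in simp)

lemma rl_integral_bound:
  assumes a: "0 < a" "s \<le> t" and m: "(\<lambda>r. indicator {s<..} r * l r) \<in> borel_measurable borel"
    and K: "\<And>r. r \<in> {s<..<t} \<Longrightarrow> \<bar>l r\<bar> \<le> K"
  shows "\<bar>rl_integral a s l t\<bar> \<le> K * (t - s) powr a"
proof -
  have "\<bar>rl_integral a s l t\<bar> \<le> (LINT r|lborel. K * rl_kernel a s t r)"
    unfolding rl_integral_def
  proof (rule integral_abs_bound_integral[OF rl_integrand_integrable[OF a m K]])
    show "integrable lborel (\<lambda>r. K * rl_kernel a s t r)"
      using rl_kernel_integrable[OF a] by simp
    show "\<bar>rl_kernel a s t r * l r\<bar> \<le> K * rl_kernel a s t r" for r
    proof (cases "r \<in> {s<..<t}")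
      case True
      then show ?thesis
        using mult_left_mono[OF K[OF True], of "rl_kernel a s t r"] rl_kernel_nonneg[OF a(1), of s t r]
        by (simp add: abs_mult mult.commute)
    qed (simp add: rl_kernel_def)
  qed
  then show ?thesis using rl_kernel_integral[OF a] by simp
qed

text \<open>For a \<le> 1 the kernel at a fixed r decreases in t, so the distance of two kernels in
  L1 can be estimated by their total masses.\<close>

lemma rl_integral_holder:
  assumes a: "0 < a" "a \<le> 1" and st: "s \<le> t" "t \<le> t'"
    and m: "(\<lambda>r. indicator {s<..} r * l r) \<in> borel_measurable borel"
    and K: "\<And>r. r \<in> {s<..<t'} \<Longrightarrow> \<bar>l r\<bar> \<le> K" and K0: "0 \<le> K"
  shows "\<bar>rl_integral a s l t' - rl_integral a s l t\<bar> \<le> 2 * K * (t' - t) powr a"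
proof -
  let ?k = "rl_kernel a s t'" and ?k' = "rl_kernel a s t" and ?d = "rl_kernel a t t'"
  \<comment> \<open>Before t the kernels differ by \<open>?k' - ?k\<close>; beyond t the kernel
    \<open>?k\<close> equals \<open>?d\<close>, and adding twice \<open>?d\<close> to its negative
    restores it. The mass without K is (t - s) powr a - (t' - s) powr a + 2 (t' - t) powr a, at most
    its last term.\<close>
  let ?w = "\<lambda>r. K * (?k' r - ?k r + 2 * ?d r)"
  have i: "integrable lborel (\<lambda>r. ?k r * l r)" "integrable lborel (\<lambda>r. ?k' r * l r)"
    using a st m K by (auto intro!: rl_integrand_integrable[where K=K])
  have ki: "integrable lborel ?k" "integrable lborel ?k'" "integrable lborel ?d"
    using a st by (auto intro!: rl_kernel_integrable)
  have "\<bar>rl_integral a s l t' - rl_integral a s l t\<bar> = \<bar>LINT r|lborel. ?k r * l r - ?k' r * l r\<bar>"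
    unfolding rl_integral_def using i by simp
  also have "\<dots> \<le> (LINT r|lborel. \<bar>?k r * l r - ?k' r * l r\<bar>)"
    by (rule integral_abs_bound)
  also have "\<dots> \<le> (LINT r|lborel. ?w r)"
  proof (rule integral_mono_AE)
    show "integrable lborel (\<lambda>r. \<bar>?k r * l r - ?k' r * l r\<bar>)" using i by auto
    show "integrable lborel ?w" using ki by simp
    show "AE r in lborel. \<bar>?k r * l r - ?k' r * l r\<bar> \<le> ?w r"
      using AE_lborel_singleton[of t]
    proof eventually_elim
      case (elim r)
      have mult: "\<bar>(x::real) * y\<bar> \<le> K * x" if "0 \<le> x" "\<bar>y\<bar> \<le> K" for x y
        using that mult_left_mono[of "\<bar>y\<bar>" K x] by (simp add: abs_mult mult.commute)
      consider "r \<in> {s<..<t}" | "r \<in> {t<..<t'}" | "r \<notin> {s<..<t'}" using elim by fastforce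
      then show ?case
      proof cases
        case 1
        have "(t' - r) powr (a - 1) \<le> (t - r) powr (a - 1)"
          using 1 st a by (intro powr_mono2') auto
        then have "0 \<le> ?k' r - ?k r"
          using 1 st a by (auto simp: rl_kernel_def)
        then have "\<bar>(?k' r - ?k r) * l r\<bar> \<le> K * (?k' r - ?k r)"
          using 1 st K by (intro mult) auto
        moreover have "?d r = 0" using 1 by (simp add: rl_kernel_def)
        ultimately show ?thesis by (simp add: left_diff_distrib abs_minus_commute)
      next
        case 2
        then have "?k' r = 0" "?k r = ?d r" using st by (auto simp: rl_kernel_def indicator_def)
        moreover have "\<bar>?d r * l r\<bar> \<le> K * ?d r"
          using 2 st K rl_kernel_nonneg[OF a(1)] by (intro mult) auto
        ultimately show ?thesis by (simp add: algebra_simps)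
      next
        case 3
        then have "?k' r = 0" "?k r = 0" "?d r = 0" using st by (auto simp: rl_kernel_def indicator_def)
        then show ?thesis by simp
      qed
    qed
  qed
  also have "\<dots> = K * ((t - s) powr a - (t' - s) powr a + 2 * (t' - t) powr a)"
    using ki a st by (simp add: rl_kernel_integral)
  also have "\<dots> \<le> K * (2 * (t' - t) powr a)"
    using a st K0 powr_mono2[of a "t - s" "t' - s"] by (intro mult_left_mono) auto
  finally show ?thesis by (simp add: mult_ac)
qed

lemma continuous_on_rl_integral:
  assumes a: "0 < a" "a \<le> 1"
    and m: "(\<lambda>r. indicator {s<..} r * l r) \<in> borel_measurable borel"
    and K: "\<And>r. r \<in> {s<..<T} \<Longrightarrow> \<bar>l r\<bar> \<le> K"
  shows "continuous_on {s..T} (rl_integral a s l)"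
proof -
  define K' where "K' = max K 0"
  have holder: "\<bar>rl_integral a s l t' - rl_integral a s l t\<bar> \<le> 2 * K' * \<bar>t' - t\<bar> powr a"
    if "t \<in> {s..T}" "t' \<in> {s..T}" for t t'
  proof -
    have *: "\<bar>l r\<bar> \<le> K'" if "r \<in> {s<..<T}" for r
      using K[OF that] by (simp add: K'_def)
    have K': "0 \<le> K'" by (simp add: K'_def)
    show ?thesis
    proof (cases "t \<le> t'")
      case True
      then show ?thesis
        using rl_integral_holder[OF a _ True m _ K', of] * that by simp
    next
      case False
      then show ?thesis
        using rl_integral_holder[OF a _ _ m _ K', of t' t] * that by (simp add: abs_minus_commute)
    qed
  qed
  show ?thesis
    unfolding continuous_on_def
  proof (intro ballI, rule Lim_null[THEN iffD2], rule Lim_null_comparison)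
    fix t assume t: "t \<in> {s..T}"
    show "\<forall>\<^sub>F t' in at t within {s..T}. norm (rl_integral a s l t' - rl_integral a s l t) \<le> 2 * K' * \<bar>t' - t\<bar> powr a"
      using holder[OF t] by (auto simp: eventually_at_filter intro!: always_eventually)
    have "((\<lambda>t'. 2 * K' * \<bar>t' - t\<bar> powr a) \<longlongrightarrow> 2 * K' * \<bar>t - t\<bar> powr a) (at t within {s..T})"
      using a by (intro tendsto_intros) auto
    then show "((\<lambda>t'. 2 * K' * \<bar>t' - t\<bar> powr a) \<longlongrightarrow> 0) (at t within {s..T})"
      using a by simp
  qed
qed

text \<open>One-sided limits bound \<open>f\<close> near each point, and finitely many such
  neighbourhoods cover the interval.\<close>

lemma cadlag_bounded:
  assumes f: "cadlag_on_nonneg f" and s: "0 \<le> s"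
  shows "\<exists>K. \<forall>r\<in>{s..t}. \<bar>f r\<bar> \<le> K"
proof -
  have "\<exists>U. open U \<and> x \<in> U \<and> bounded (f ` (U \<inter> {s..t}))" if x: "x \<in> {s..t}" for x
  proof -
    have "0 \<le> x" using x s by simp
    obtain b where b: "x < b" "\<And>y. x < y \<Longrightarrow> y < b \<Longrightarrow> \<bar>f y - f x\<bar> < 1"
      using tendstoD[of f "f x" "at_right x" 1] f \<open>0 \<le> x\<close>
      unfolding cadlag_on_nonneg_def eventually_at_right_field dist_real_def by auto
    obtain a l where a: "a < x" "\<And>y. a < y \<Longrightarrow> y < x \<Longrightarrow> 0 \<le> y \<Longrightarrow> \<bar>f y - l\<bar> < 1"
    \<comment> \<open>At 0 there is no left limit, but also no nonnegative time to the left.\<close>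
    proof (cases "x = 0")
      case True
      then show ?thesis using that[of "-1" 0] by auto
    next
      case False
      then have "0 < x" using \<open>0 \<le> x\<close> by simp
      then obtain l where "(f \<longlongrightarrow> l) (at_left x)"
        using f unfolding cadlag_on_nonneg_def by blast
      then obtain a where "a < x" "\<And>y. a < y \<Longrightarrow> y < x \<Longrightarrow> \<bar>f y - l\<bar> < 1"
        using tendstoD[of f l "at_left x" 1] unfolding eventually_at_left_field dist_real_def by auto
      then show ?thesis using that by blast
    qed
    have "\<bar>f y\<bar> \<le> \<bar>f x\<bar> + \<bar>l\<bar> + 1" if "y \<in> {a<..<b} \<inter> {s..t}" for y
      using that s b(2)[of y] a(2)[of y] by (cases y x rule: linorder_cases) auto
    then have "bounded (f ` ({a<..<b} \<inter> {s..t}))"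
      unfolding bounded_iff by (intro exI[of _ "\<bar>f x\<bar> + \<bar>l\<bar> + 1"]) auto
    then show ?thesis
      using a(1) b(1) by (intro exI[of _ "{a<..<b}"]) auto
  qed
  then obtain U where U: "\<And>x. x \<in> {s..t} \<Longrightarrow> open (U x) \<and> x \<in> U x \<and> bounded (f ` (U x \<inter> {s..t}))"
    by metis
  have "compact {s..t}" by simp
  then obtain C where C: "C \<subseteq> {s..t}" "finite C" "{s..t} \<subseteq> (\<Union>c\<in>C. U c)"
    using U by (elim compactE_image[of _ "{s..t}" U]) auto
  have "bounded (\<Union>c\<in>C. f ` (U c \<inter> {s..t}))"
    using C U by (intro bounded_UN) auto
  moreover have "f ` {s..t} \<subseteq> (\<Union>c\<in>C. f ` (U c \<inter> {s..t}))"
    using C(3) by blast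
  ultimately have "bounded (f ` {s..t})"
    by (rule bounded_subset)
  then show ?thesis
    unfolding bounded_iff by auto
qed

lemma right_limit_sequence:
  fixes f :: "real \<Rightarrow> real"
  assumes f: "(f \<longlongrightarrow> f x) (at_right x)" and c: "c \<longlonglongrightarrow> x" "\<And>n. x \<le> c n"
  shows "(\<lambda>n. f (c n)) \<longlonglongrightarrow> f x"
proof -
  have "continuous (at x within {x..}) f"
    using f by (simp add: continuous_within at_within_Ici_at_right)
  then show ?thesis
    using c by (auto simp: continuous_within_sequentially comp_def)
qed

text \<open>By right-continuity \<open>f\<close> is the limit of its values at the next multiple of
  1 / (n + 1) strictly to the right, and these are constant on the cells of a countable
  partition.\<close>

lemma cadlag_measurable:
  assumes f: "cadlag_on_nonneg f" and s: "0 \<le> s"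
  shows "(\<lambda>r. indicator {s<..} r * f r) \<in> borel_measurable borel"
proof (rule borel_measurable_LIMSEQ_real)
  let ?c = "\<lambda>n r. (real_of_int \<lfloor>real (Suc n) * r\<rfloor> + 1) / real (Suc n)"
  show "(\<lambda>n. indicator {s<..} r * f (?c n r)) \<longlonglongrightarrow> indicator {s<..} r * f r" for r
  proof (cases "s < r")
    case True
    have c: "r \<le> ?c n r" "?c n r \<le> r + inverse (real (Suc n))" for n
    proof -
      define d where "d = real (Suc n)"
      have d: "0 < d" by (simp add: d_def)
      have k: "r * d \<le> real_of_int \<lfloor>d * r\<rfloor> + 1" "real_of_int \<lfloor>d * r\<rfloor> \<le> r * d"
        unfolding mult.commute[of r d] by linarith+
      have "(r + inverse d) * d = r * d + 1"
        using d by (simp add: distrib_right)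
      then have "r \<le> (real_of_int \<lfloor>d * r\<rfloor> + 1) / d" "(real_of_int \<lfloor>d * r\<rfloor> + 1) / d \<le> r + inverse d"
        using k d by (simp_all add: pos_le_divide_eq pos_divide_le_eq)
      then show "r \<le> ?c n r" "?c n r \<le> r + inverse (real (Suc n))"
        by (simp_all add: d_def)
    qed
    have "(\<lambda>n. r + inverse (real (Suc n))) \<longlonglongrightarrow> r + 0"
      by (intro tendsto_add tendsto_const LIMSEQ_inverse_real_of_nat)
    then have "(\<lambda>n. r + inverse (real (Suc n))) \<longlonglongrightarrow> r" by simp
    from tendsto_sandwich[OF _ _ tendsto_const this, of "\<lambda>n. ?c n r"]
    have c_lim: "(\<lambda>n. ?c n r) \<longlonglongrightarrow> r"
      using c(1) c(2) always_eventually by blast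
    have "(f \<longlongrightarrow> f r) (at_right r)"
      using f s True by (auto simp: cadlag_on_nonneg_def)
    from right_limit_sequence[OF this c_lim c(1)]
    have "(\<lambda>n. f (?c n r)) \<longlonglongrightarrow> f r" .
    then show ?thesis by (intro tendsto_mult tendsto_const)
  qed simp
  show "(\<lambda>r. indicator {s<..} r * f (?c n r)) \<in> borel_measurable borel" for n
  proof -
    have "(\<lambda>i::int. f ((real_of_int i + 1) / real (Suc n))) \<in> borel_measurable (count_space UNIV)" by simp
    moreover have "(\<lambda>r. \<lfloor>real (Suc n) * r\<rfloor>) \<in> measurable borel (count_space UNIV)"
      by measurable
    ultimately have "(\<lambda>r. f (?c n r)) \<in> borel_measurable borel"
      by (rule measurable_compose[rotated])
    then show ?thesis by measurable
  qed
qed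

context centered_levy
begin

lemma cadlag_path: "\<omega> \<in> space M \<Longrightarrow> cadlag_on_nonneg (\<lambda>t. L t \<omega>)"
  using levy unfolding levy_process_def by blast

lemma increment_path_measurable:
  assumes "\<omega> \<in> space M" "0 \<le> s"
  shows "(\<lambda>r. indicator {s<..} r * (L r \<omega> - L s \<omega>)) \<in> borel_measurable borel"
proof -
  have [measurable]: "(\<lambda>r. indicator {s<..} r * L r \<omega>) \<in> borel_measurable borel"
    by (rule cadlag_measurable[OF cadlag_path[OF assms(1)] assms(2)])
  have "(\<lambda>r. indicator {s<..} r * L r \<omega> - indicator {s<..} r * L s \<omega>) \<in> borel_measurable borel"
    by measurable
  then show ?thesis by (simp add: right_diff_distrib)
qed

lemma increment_path_bounded:
  assumes "\<omega> \<in> space M" "0 \<le> s"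
  obtains K where "\<And>r. r \<in> {s..t} \<Longrightarrow> \<bar>L r \<omega> - L s \<omega>\<bar> \<le> K"
proof -
  obtain K where "\<And>r. r \<in> {s..t} \<Longrightarrow> \<bar>L r \<omega>\<bar> \<le> K"
    using cadlag_bounded[OF cadlag_path[OF assms(1)] assms(2)] by blast
  then have "\<bar>L r \<omega> - L s \<omega>\<bar> \<le> K + K" if "r \<in> {s..t}" for r
    using that abs_triangle_ineq4[of "L r \<omega>" "L s \<omega>"] by (smt (verit) atLeastAtMost_iff)
  then show ?thesis using that by blast
qed

end

section \<open>Uniform grids and Riemann sums\<close>

definition grid :: "real \<Rightarrow> real \<Rightarrow> nat \<Rightarrow> nat \<Rightarrow> real" where
  "grid s t n i = s + (t - s) * real i / real (Suc n)"

lemma grid_0[simp]: "grid s t n 0 = s"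
  by (simp add: grid_def)

lemma grid_last[simp]: "grid s t n (Suc n) = t"
  by (simp add: grid_def del: of_nat_Suc)

lemma grid_Suc: "grid s t n (Suc i) = grid s t n i + (t - s) / real (Suc n)"
  by (simp add: grid_def add_divide_distrib distrib_left del: of_nat_Suc) (simp add: add_divide_distrib distrib_left)

lemma grid_less: "s < t \<Longrightarrow> i < j \<Longrightarrow> grid s t n i < grid s t n j"
  by (simp add: grid_def divide_strict_right_mono del: of_nat_Suc)

lemma grid_le: "s \<le> t \<Longrightarrow> i \<le> j \<Longrightarrow> grid s t n i \<le> grid s t n j"
  by (simp add: grid_def divide_right_mono mult_left_mono del: of_nat_Suc)

lemma grid_mem: "s \<le> t \<Longrightarrow> i \<le> Suc n \<Longrightarrow> grid s t n i \<in> {s..t}"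
  using grid_le[of s t 0 i n] grid_le[of s t i "Suc n" n] by simp

lemma grid_cell:
  assumes "x \<in> {s<..t}"
  shows "\<exists>i<Suc n. x \<in> {grid s t n i<..grid s t n (Suc i)}"
proof -
  define j where "j = (LEAST j. x \<le> grid s t n j)"
  have j: "x \<le> grid s t n j" "j \<le> Suc n"
    using LeastI[of "\<lambda>j. x \<le> grid s t n j" "Suc n"] Least_le[of "\<lambda>j. x \<le> grid s t n j" "Suc n"] assms
    by (auto simp: j_def)
  have "j \<noteq> 0" using j(1) assms by (cases j) auto
  then obtain i where i: "j = Suc i" by (cases j) auto
  have "\<not> x \<le> grid s t n i"
    using not_less_Least[of i "\<lambda>j. x \<le> grid s t n j"] i by (simp add: j_def)
  then show ?thesis using i j by (intro exI[of _ i]) auto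
qed

lemma grid_cell_less_iff:
  assumes "s < t" "x \<in> {grid s t n i<..grid s t n (Suc i)}"
  shows "grid s t n j < x \<longleftrightarrow> j \<le> i"
proof
  assume "grid s t n j < x"
  then have "grid s t n j < grid s t n (Suc i)" using assms by simp
  then show "j \<le> i" using grid_le[of s t "Suc i" j n] assms by (cases "j \<le> i") auto
next
  assume "j \<le> i"
  then show "grid s t n j < x" using grid_le[of s t j i n] assms by simp
qed

text \<open>Writing \<open>(t - s\<^sub>i) powr a\<close> as an integral of the kernel over \<open>{s\<^sub>i<..<t}\<close> turns the Riemann
  sum into the integral of the kernel against a step function approximating the path from
  the right, which is why right-continuity gives the limit.\<close>

lemma riemann_sums_tendsto_rl_integral:
  fixes f :: "real \<Rightarrow> real"
  assumes a: "0 < a" and s: "0 \<le> s" "s \<le> t" and f: "cadlag_on_nonneg f"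
  shows "(\<lambda>n. \<Sum>i<Suc n. (t - grid s t n i) powr a * (f (grid s t n (Suc i)) - f (grid s t n i)))
    \<longlonglongrightarrow> rl_integral a s (\<lambda>r. f r - f s) t"
proof (cases "s = t")
  case True
  have "rl_integral a s (\<lambda>r. f r - f s) t = 0"
    using True by (simp add: rl_integral_def rl_kernel_def)
  then show ?thesis using True by (simp add: grid_def)
next
  case False
  then have st: "s < t" using s by simp
  let ?k = "rl_kernel a s t"
  define F where "F n r = (\<Sum>i<Suc n. indicator {grid s t n i<..} r * (f (grid s t n (Suc i)) - f (grid s t n i)))" for n r
  obtain K where K: "\<And>r. r \<in> {s..t} \<Longrightarrow> \<bar>f r\<bar> \<le> K"
    using cadlag_bounded[OF f s(1)] by blast
  \<comment> \<open>Only terms whose left grid point lies before r contribute, and they telescope to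
    the value at the right end of the cell of r.\<close>
  have F_cell: "F n r = f (grid s t n (Suc i)) - f s" if "i < Suc n" "r \<in> {grid s t n i<..grid s t n (Suc i)}" for n r i
  proof -
    have "F n r = (\<Sum>j\<in>{..<Suc i}. f (grid s t n (Suc j)) - f (grid s t n j))"
      unfolding F_def
      by (intro sum.mono_neutral_cong_right)
        (use that grid_cell_less_iff[OF st that(2)] in \<open>auto simp: indicator_def less_Suc_eq_le\<close>)
    also have "\<dots> = f (grid s t n (Suc i)) - f (grid s t n 0)"
      by (rule sum_lessThan_telescope)
    finally show ?thesis by simp
  qed
  have sum_eq: "(\<Sum>i<Suc n. (t - grid s t n i) powr a * (f (grid s t n (Suc i)) - f (grid s t n i))) = (LINT r|lborel. ?k r * F n r)" for n
  proof -
    have k: "rl_kernel a (grid s t n i) t r = ?k r * indicator {grid s t n i<..} r" if "i < Suc n" for i r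
      using grid_mem[of s t i n] s that by (auto simp: rl_kernel_def indicator_def)
    have int: "integrable lborel (\<lambda>r. ?k r * indicator {grid s t n i<..} r)" if "i < Suc n" for i
    proof -
      have "rl_kernel a (grid s t n i) t = (\<lambda>r. ?k r * indicator {grid s t n i<..} r)"
        using k[OF that] by (rule ext)
      then show ?thesis
        using rl_kernel_integrable[OF a, of "grid s t n i" t] grid_mem[of s t i n] s that by simp
    qed
    have "(LINT r|lborel. ?k r * F n r) = (LINT r|lborel. (\<Sum>i<Suc n. (?k r * indicator {grid s t n i<..} r) * (f (grid s t n (Suc i)) - f (grid s t n i))))"
      by (simp only: F_def sum_distrib_left mult.assoc)
    also have "\<dots> = (\<Sum>i<Suc n. (LINT r|lborel. ?k r * indicator {grid s t n i<..} r) * (f (grid s t n (Suc i)) - f (grid s t n i)))"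
      using int by (subst Bochner_Integration.integral_sum) (auto simp del: sum.lessThan_Suc)
    also have "\<dots> = (\<Sum>i<Suc n. (t - grid s t n i) powr a * (f (grid s t n (Suc i)) - f (grid s t n i)))"
      using rl_kernel_integral[OF a, of "grid s t n _" t] grid_mem[of s t _ n] s
      by (intro sum.cong refl) (simp add: k[symmetric])
    finally show ?thesis by simp
  qed
  have F_meas: "F n \<in> borel_measurable borel" for n
    unfolding F_def[abs_def] by measurable
  have F_bound: "\<bar>F n r\<bar> \<le> 2 * K" if r: "s < r" "r \<le> t" for n r
  proof -
    have "r \<in> {s<..t}" using r by simp
    then obtain i where i: "i < Suc n" "r \<in> {grid s t n i<..grid s t n (Suc i)}"
      using grid_cell by blast
    then show ?thesis
      using F_cell[OF i] K[of "grid s t n (Suc i)"] K[of s] grid_mem[of s t "Suc i" n] s by simp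
  qed
  have F_lim: "(\<lambda>n. F n r) \<longlonglongrightarrow> f r - f s" if r: "s < r" "r \<le> t" for r
  proof -
    obtain i where i: "\<And>n. i n < Suc n" "\<And>n. r \<in> {grid s t n (i n)<..grid s t n (Suc (i n))}"
      using grid_cell[of r s t] r by (metis greaterThanAtMost_iff)
    let ?c = "\<lambda>n. grid s t n (Suc (i n))"
    have c: "r \<le> ?c n" "?c n \<le> r + (t - s) * inverse (real (Suc n))" for n
      using i(2)[of n] by (auto simp: grid_Suc divide_inverse)
    have "(\<lambda>n. r + (t - s) * inverse (real (Suc n))) \<longlonglongrightarrow> r + (t - s) * 0"
      by (intro tendsto_add tendsto_mult tendsto_const LIMSEQ_inverse_real_of_nat)
    then have "(\<lambda>n. r + (t - s) * inverse (real (Suc n))) \<longlonglongrightarrow> r" by simp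
    from tendsto_sandwich[OF _ _ tendsto_const this, of ?c]
    have c_lim: "?c \<longlonglongrightarrow> r"
      using c(1) c(2) always_eventually by blast
    have "(f \<longlongrightarrow> f r) (at_right r)"
      using f s r by (auto simp: cadlag_on_nonneg_def)
    from right_limit_sequence[OF this c_lim c(1)]
    have "(\<lambda>n. f (?c n)) \<longlonglongrightarrow> f r" .
    then show ?thesis
      unfolding F_cell[OF i] by (intro tendsto_diff tendsto_const)
  qed
  have m: "(\<lambda>r. indicator {s<..} r * (f r - f s)) \<in> borel_measurable borel"
  proof -
    have [measurable]: "(\<lambda>r. indicator {s<..} r * f r) \<in> borel_measurable borel"
      by (rule cadlag_measurable[OF f s(1)])
    have "(\<lambda>r. indicator {s<..} r * f r - indicator {s<..} r * f s) \<in> borel_measurable borel" by measurable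
    then show ?thesis by (simp add: right_diff_distrib)
  qed
  show ?thesis
    unfolding sum_eq rl_integral_def
  proof (rule integral_dominated_convergence[where w="\<lambda>r. 2 * K * ?k r"])
    show "(\<lambda>r. ?k r * (f r - f s)) \<in> borel_measurable lborel"
      using rl_integrand_measurable[OF m] by simp
    show "(\<lambda>r. ?k r * F n r) \<in> borel_measurable lborel" for n
      using F_meas by measurable
    show "integrable lborel (\<lambda>r. 2 * K * ?k r)"
      using rl_kernel_integrable[OF a s(2)] by simp
    show "AE r in lborel. (\<lambda>n. ?k r * F n r) \<longlonglongrightarrow> ?k r * (f r - f s)"
    proof (rule AE_I2)
      fix r show "(\<lambda>n. ?k r * F n r) \<longlonglongrightarrow> ?k r * (f r - f s)"
      proof (cases "r \<in> {s<..<t}")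
        case True
        then show ?thesis by (intro tendsto_mult tendsto_const F_lim) auto
      qed (simp add: rl_kernel_def)
    qed
    show "AE r in lborel. norm (?k r * F n r) \<le> 2 * K * ?k r" for n
    proof (rule AE_I2)
      fix r show "norm (?k r * F n r) \<le> 2 * K * ?k r"
      proof (cases "r \<in> {s<..<t}")
        case True
        then show ?thesis
          using mult_left_mono[OF F_bound[of r n], of "?k r"] rl_kernel_nonneg[OF a, of s t r]
          by (simp add: abs_mult mult.commute)
      qed (simp add: rl_kernel_def)
    qed
  qed
qed

section \<open>Step approximations of the kernel and the splitting of the integral at s\<close>

definition step_kernel :: "real \<Rightarrow> real \<Rightarrow> real \<Rightarrow> real \<Rightarrow> nat \<Rightarrow> real \<Rightarrow> real" where
  "step_kernel C a s t n x = (\<Sum>i<Suc n. C * (t - grid s t n i) powr a * indicator {grid s t n i<..grid s t n (Suc i)} x)"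

lemma step_kernel_cell:
  assumes "s < t" "i < Suc n" "x \<in> {grid s t n i<..grid s t n (Suc i)}"
  shows "step_kernel C a s t n x = C * (t - grid s t n i) powr a"
proof -
  have "x \<notin> {grid s t n j<..grid s t n (Suc j)}" if "j \<noteq> i" for j
    using grid_cell_less_iff[OF assms(1,3), of j] grid_cell_less_iff[OF assms(1,3), of "Suc j"] that by auto
  then have "step_kernel C a s t n x = C * (t - grid s t n i) powr a * indicator {grid s t n i<..grid s t n (Suc i)} x"
    unfolding step_kernel_def using assms(2)
    by (subst sum.remove[of _ i]) (auto intro!: sum.neutral simp del: sum.lessThan_Suc)
  then show ?thesis using assms by simp
qed

lemma step_kernel_outside:
  assumes "s < t" "x \<notin> {s<..t}"
  shows "step_kernel C a s t n x = 0"
proof -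
  have "x \<notin> {grid s t n i<..grid s t n (Suc i)}" if "i < Suc n" for i
    using grid_mem[of s t i n] grid_mem[of s t "Suc i" n] that assms by auto
  then show ?thesis
    unfolding step_kernel_def by (intro sum.neutral) auto
qed

lemma step_kernel_simple:
  assumes "s < t"
  shows "simple_integrand (step_kernel C a s t n)"
proof -
  have "simple_function borel (step_kernel C a s t n)"
    unfolding step_kernel_def[abs_def]
    by (intro simple_function_sum simple_function_mult simple_function_const simple_function_indicator) auto
  moreover have "{x. step_kernel C a s t n x \<noteq> 0} \<subseteq> {s<..t}"
    using step_kernel_outside[OF assms] by blast
  ultimately show ?thesis
    using bounded_subset[of "{s<..t}"] by (auto simp: simple_integrand_def)
qed

lemma step_kernel_close:
  assumes st: "s < t" and a: "0 < a" and e: "0 < e"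
  shows "\<exists>k. \<forall>n\<ge>k. \<forall>x\<in>{s<..t}. \<bar>step_kernel C a s t n x - C * (t - x) powr a\<bar> < e"
proof -
  have "continuous_on {s..t} (\<lambda>x. C * (t - x) powr a)"
    using a by (intro continuous_on_mult continuous_on_const continuous_on_powr' continuous_on_diff continuous_on_id) auto
  then have "uniformly_continuous_on {s..t} (\<lambda>x. C * (t - x) powr a)"
    by (intro compact_uniformly_continuous) auto
  then obtain d where d: "0 < d" "\<And>x y. x \<in> {s..t} \<Longrightarrow> y \<in> {s..t} \<Longrightarrow> \<bar>y - x\<bar> < d \<Longrightarrow>
    \<bar>C * (t - y) powr a - C * (t - x) powr a\<bar> < e"
    using e unfolding uniformly_continuous_on_def dist_real_def by metis
  obtain k where k: "(t - s) / d < real k"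
    using reals_Archimedean2 by blast
  have "\<bar>step_kernel C a s t n x - C * (t - x) powr a\<bar> < e" if "n \<ge> k" "x \<in> {s<..t}" for n x
  proof -
    have "x \<in> {s<..t}" by (rule that(2))
    then obtain i where i: "i < Suc n" "x \<in> {grid s t n i<..grid s t n (Suc i)}"
      using grid_cell by blast
    have "(t - s) / d < real (Suc n)" using k that by simp
    then have "(t - s) / real (Suc n) < d"
      using d(1) by (simp add: pos_divide_less_eq mult.commute)
    then have "\<bar>grid s t n i - x\<bar> < d"
      using i(2) by (auto simp: grid_Suc)
    then show ?thesis
      unfolding step_kernel_cell[OF st i] using that grid_mem[of s t i n] i st by (intro d) auto
  qed
  then show ?thesis by blast
qed

text \<open>\<open>simple_integral_over\<close> sums over values, not over cells. Evaluating the
  kernel at left endpoints gives positive and strictly decreasing values, so each nonzero level set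
  is a single cell and the integral is a Riemann sum.\<close>

lemma (in centered_levy) simple_integral_step_kernel:
  assumes st: "s < t" and a: "0 < a" and C: "0 < C"
  shows "AE \<omega> in M. simple_integral_over N {s<..t} (step_kernel C a s t n) \<omega> =
    C * (\<Sum>i<Suc n. (t - grid s t n i) powr a * (L (grid s t n (Suc i)) \<omega> - L (grid s t n i) \<omega>))"
proof -
  let ?g = "\<lambda>i. C * (t - grid s t n i) powr a"
  have lt: "grid s t n i < t" if "i < Suc n" for i
    using grid_less[OF st that, of n] by simp
  have gpos: "0 < ?g i" if "i < Suc n" for i
    using lt[OF that] C by simp
  have gless: "?g j < ?g i" if "i < j" "j < Suc n" for i j
    using grid_less[OF st that(1), of n] lt[OF that(2)] C a by (simp add: powr_less_mono2)
  have inj: "inj_on ?g {..<Suc n}"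
    by (rule inj_onI) (use gless in \<open>metis lessThan_iff less_irrefl linorder_neqE_nat\<close>)
  have range: "range (step_kernel C a s t n) - {0} = ?g ` {..<Suc n}"
  proof (intro equalityI subsetI)
    fix y assume "y \<in> range (step_kernel C a s t n) - {0}"
    then obtain x where x: "y = step_kernel C a s t n x" "y \<noteq> 0" by auto
    then have "x \<in> {s<..t}" using step_kernel_outside[OF st, of x] by blast
    then obtain i where i: "i < Suc n" "x \<in> {grid s t n i<..grid s t n (Suc i)}"
      using grid_cell by blast
    then show "y \<in> ?g ` {..<Suc n}" using step_kernel_cell[OF st i] x by auto
  next
    fix y assume "y \<in> ?g ` {..<Suc n}"
    then obtain i where i: "i < Suc n" "y = ?g i" by auto
    have "grid s t n (Suc i) \<in> {grid s t n i<..grid s t n (Suc i)}"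
      using grid_less[OF st, of i "Suc i" n] by simp
    from step_kernel_cell[OF st i(1) this] i gpos[OF i(1)]
    show "y \<in> range (step_kernel C a s t n) - {0}" by (metis Diff_iff less_irrefl rangeI singletonD)
  qed
  have level: "{s<..t} \<inter> step_kernel C a s t n -` {?g i} = {grid s t n i<..grid s t n (Suc i)}" if i: "i < Suc n" for i
  proof (intro equalityI subsetI)
    fix x assume x: "x \<in> {s<..t} \<inter> step_kernel C a s t n -` {?g i}"
    then obtain j where j: "j < Suc n" "x \<in> {grid s t n j<..grid s t n (Suc j)}"
      using grid_cell[of x s t n] by blast
    then have "?g j = ?g i" using x step_kernel_cell[OF st j, of C a] by simp
    then have "j = i" using inj i j by (auto dest: inj_onD)
    then show "x \<in> {grid s t n i<..grid s t n (Suc i)}" using j by simp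
  next
    fix x assume "x \<in> {grid s t n i<..grid s t n (Suc i)}"
    then show "x \<in> {s<..t} \<inter> step_kernel C a s t n -` {?g i}"
      using step_kernel_cell[OF st i, of x C a] grid_mem[of s t i n] grid_mem[of s t "Suc i" n] i st by auto
  qed
  have "AE \<omega> in M. \<forall>i\<in>{..<Suc n}. N {grid s t n i<..grid s t n (Suc i)} \<omega> = L (grid s t n (Suc i)) \<omega> - L (grid s t n i) \<omega>"
    using grid_less[OF st] by (intro AE_finite_allI N_Ioc) auto
  then show ?thesis
  proof eventually_elim
    case (elim \<omega>)
    have "simple_integral_over N {s<..t} (step_kernel C a s t n) \<omega> =
      (\<Sum>i<Suc n. ?g i * N ({s<..t} \<inter> step_kernel C a s t n -` {?g i}) \<omega>)"
      unfolding simple_integral_over_def range sum.reindex[OF inj] by (simp add: comp_def)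
    also have "\<dots> = (\<Sum>i<Suc n. ?g i * (L (grid s t n (Suc i)) \<omega> - L (grid s t n i) \<omega>))"
      using elim by (intro sum.cong refl) (simp add: level)
    finally show ?case unfolding sum_distrib_left by (simp add: mult.assoc del: sum.lessThan_Suc)
  qed
qed

context centered_levy
begin

text \<open>The integral involves uncountably many times, but it is a pointwise limit of Riemann
  sums, each built from finitely many increments inside the window.\<close>

lemma rl_integral_increment_measurable:
  assumes a: "0 < a" and s: "0 \<le> s" "s \<le> t"
  shows "(\<lambda>\<omega>. rl_integral a s (\<lambda>r. L r \<omega> - L s \<omega>) t) \<in> borel_measurable (increments {s..t})"
proof (rule borel_measurable_LIMSEQ_real)
  show "(\<lambda>n. \<Sum>i<Suc n. (t - grid s t n i) powr a * (L (grid s t n (Suc i)) \<omega> - L (grid s t n i) \<omega>))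
    \<longlonglongrightarrow> rl_integral a s (\<lambda>r. L r \<omega> - L s \<omega>) t" if "\<omega> \<in> space (increments {s..t})" for \<omega>
    using that riemann_sums_tendsto_rl_integral[OF a s cadlag_path] by simp
  show "(\<lambda>\<omega>. \<Sum>i<Suc n. (t - grid s t n i) powr a * (L (grid s t n (Suc i)) \<omega> - L (grid s t n i) \<omega>))
    \<in> borel_measurable (increments {s..t})" for n
    using grid_mem[of s t _ n] s
    by (intro borel_measurable_sum borel_measurable_times borel_measurable_const increments_measurable) auto
qed

text \<open>The simple integrals over \<open>{..s}\<close> are almost surely past-measurable, and
  they converge in probability to \<open>X\<close> minus the pathwise integral because those over
  \<open>{s<..t}\<close> converge to the latter. The limit inherits the measurability.\<close>

lemma past_future_decomposition:
  assumes a: "0 < a" and C: "0 < C" and s: "0 \<le> s" "s \<le> t"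
    and h: "\<And>n. simple_integrand (h n)"
    and lim: "AE x in lborel. x \<in> {s<..t} \<longrightarrow> (\<lambda>n. h n x) \<longlonglongrightarrow> C * (t - x) powr a"
    and conv: "\<And>B. B \<in> sets borel \<Longrightarrow> \<exists>W. converges_in_probability M (\<lambda>n. simple_integral_over N B (h n)) W"
    and X: "converges_in_probability M (\<lambda>n. simple_integral_over N {..t} (h n)) X"
  shows "almost_measurable M (increments {..s}) (\<lambda>\<omega>. X \<omega> - C * rl_integral a s (\<lambda>r. L r \<omega> - L s \<omega>) t)"
proof (cases "s = t")
  case True
  have "rl_integral a s (\<lambda>r. L r \<omega> - L s \<omega>) t = 0" for \<omega>
    using True by (simp add: rl_integral_def rl_kernel_def)
  moreover have "almost_measurable M (increments {..t}) X"
  proof (rule almost_measurable_limit)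
    show "(\<lambda>n. prob_size (\<lambda>\<omega>. simple_integral_over N {..t} (h n) \<omega> - X \<omega>)) \<longlonglongrightarrow> 0"
      by (rule converges_in_probability_prob_size[OF X])
  qed (use X in \<open>auto simp: converges_in_probability_def intro: simple_integral_past h\<close>)
  ultimately show ?thesis using True by simp
next
  case False
  then have st: "s < t" using s by simp
  define Z where "Z \<omega> = C * rl_integral a s (\<lambda>r. L r \<omega> - L s \<omega>) t" for \<omega>
  define R where "R n \<omega> = C * (\<Sum>i<Suc n. (t - grid s t n i) powr a * (L (grid s t n (Suc i)) \<omega> - L (grid s t n i) \<omega>))" for n \<omega>
  let ?\<phi> = "step_kernel C a s t"
  have Zm[measurable]: "Z \<in> borel_measurable M"
    unfolding Z_def[abs_def]
    using measurable_from_subalg[OF subalgebra_increments rl_integral_increment_measurable[OF a s]] by measurable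
  have Rm[measurable]: "R n \<in> borel_measurable M" for n
    unfolding R_def[abs_def] by measurable
  have Xm[measurable]: "X \<in> borel_measurable M"
    using X by (simp add: converges_in_probability_def)
  have [measurable]: "simple_integral_over N {..t} (h n) \<in> borel_measurable M"
    "simple_integral_over N {..s} (h n) \<in> borel_measurable M"
    "simple_integral_over N {s<..t} (h n) \<in> borel_measurable M"
    "simple_integral_over N {s<..t} (?\<phi> n) \<in> borel_measurable M" for n
    by (auto intro!: simple_integral_measurable h step_kernel_simple[OF st])
  have RZ: "(\<lambda>n. prob_size (\<lambda>\<omega>. R n \<omega> - Z \<omega>)) \<longlonglongrightarrow> 0"
  proof -
    have "(\<lambda>n. prob_size (\<lambda>\<omega>. R n \<omega> - Z \<omega>)) \<longlonglongrightarrow> expectation (\<lambda>\<omega>. 0)"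
      unfolding prob_size_def
    proof (rule integral_dominated_convergence[where w="\<lambda>_. 1"])
      show "AE \<omega> in M. (\<lambda>n. min 1 \<bar>R n \<omega> - Z \<omega>\<bar>) \<longlonglongrightarrow> 0"
        using AE_space
      proof eventually_elim
        case (elim \<omega>)
        have "(\<lambda>n. R n \<omega>) \<longlonglongrightarrow> Z \<omega>"
          unfolding R_def Z_def
          by (intro tendsto_mult tendsto_const riemann_sums_tendsto_rl_integral a s cadlag_path elim)
        then have "(\<lambda>n. min 1 \<bar>R n \<omega> - Z \<omega>\<bar>) \<longlonglongrightarrow> min 1 \<bar>Z \<omega> - Z \<omega>\<bar>"
          by (intro tendsto_intros)
        then show ?case by simp
      qed
    qed auto
    then show ?thesis by simp
  qed
  have close: "(\<lambda>n. prob_size (\<lambda>\<omega>. simple_integral_over N {s<..t} (h n) \<omega> - simple_integral_over N {s<..t} (?\<phi> n) \<omega>)) \<longlonglongrightarrow> 0"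
  proof (rule simple_integrals_close[OF h step_kernel_simple[OF st] s(1)])
    show "AE x in lborel. x \<in> {s<..t} \<longrightarrow> (\<lambda>n. h n x - ?\<phi> n x) \<longlonglongrightarrow> 0"
      using lim
    proof eventually_elim
      case (elim x)
      show ?case
      proof
        assume x: "x \<in> {s<..t}"
        have "(\<lambda>n. ?\<phi> n x) \<longlonglongrightarrow> C * (t - x) powr a"
        proof (rule LIMSEQ_I)
          fix r :: real assume "0 < r"
          then obtain k where "\<forall>n\<ge>k. \<forall>x\<in>{s<..t}. \<bar>?\<phi> n x - C * (t - x) powr a\<bar> < r"
            using step_kernel_close[OF st a, of r C] by blast
          then show "\<exists>k. \<forall>n\<ge>k. norm (?\<phi> n x - C * (t - x) powr a) < r"
            using x unfolding real_norm_def by blast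
        qed
        then show "(\<lambda>n. h n x - ?\<phi> n x) \<longlonglongrightarrow> 0"
          using tendsto_diff[OF mp[OF elim x]] by fastforce
      qed
    qed
    show "\<exists>W\<in>borel_measurable M. (\<lambda>n. prob_size (\<lambda>\<omega>. simple_integral_over N B (h n) \<omega> - W \<omega>)) \<longlonglongrightarrow> 0"
      if B: "B \<in> sets borel" for B
    proof -
      obtain W where W: "converges_in_probability M (\<lambda>n. simple_integral_over N B (h n)) W"
        using conv[OF B] by blast
      then show ?thesis
        using converges_in_probability_prob_size[OF W] by (auto simp: converges_in_probability_def)
    qed
    fix e :: real assume "0 < e"
    then obtain k where k: "\<And>n x. n \<ge> k \<Longrightarrow> x \<in> {s<..t} \<Longrightarrow> \<bar>?\<phi> n x - C * (t - x) powr a\<bar> < e / 2"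
      using step_kernel_close[OF st a half_gt_zero, of e C] by blast
    have "\<bar>?\<phi> m x - ?\<phi> n x\<bar> \<le> e" if "m \<ge> k" "n \<ge> k" "x \<in> {s<..t}" for m n x
      using k[OF that(1,3)] k[OF that(2,3)] by linarith
    then show "\<exists>k. \<forall>m\<ge>k. \<forall>n\<ge>k. \<forall>x\<in>{s<..t}. \<bar>?\<phi> m x - ?\<phi> n x\<bar> \<le> e" by blast
  qed
  have "almost_measurable M (increments {..s}) (\<lambda>\<omega>. X \<omega> - Z \<omega>)"
  proof (rule almost_measurable_limit)
    let ?S = "\<lambda>n. simple_integral_over N {..s} (h n)"
    let ?A = "\<lambda>n \<omega>. simple_integral_over N {..t} (h n) \<omega> - X \<omega>"
    let ?B = "\<lambda>n \<omega>. simple_integral_over N {s<..t} (h n) \<omega> - simple_integral_over N {s<..t} (?\<phi> n) \<omega>"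
    let ?D = "\<lambda>n \<omega>. R n \<omega> - Z \<omega>"
    show "almost_measurable M (increments {..s}) (?S n)" for n
      by (rule simple_integral_past[OF h])
    \<comment> \<open>As \<open>?S\<close> is the integral over \<open>{..t}\<close> minus the one
      over \<open>{s<..t}\<close>, the error is \<open>?A\<close> - \<open>?B\<close> -
      \<open>?D\<close>: convergence of the full integral, uniqueness of the integral, convergence
      of the Riemann sums.\<close>
    have le: "prob_size (\<lambda>\<omega>. ?S n \<omega> - (X \<omega> - Z \<omega>)) \<le> prob_size (?A n) + (prob_size (?B n) + prob_size (?D n))" for n
    proof -
      have "prob_size (\<lambda>\<omega>. ?S n \<omega> - (X \<omega> - Z \<omega>)) \<le> prob_size (?A n) + prob_size (\<lambda>\<omega>. ?B n \<omega> + ?D n \<omega>)"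
      proof (rule prob_size_le_add)
        have u: "{..s} \<union> {s<..t} = {..t}" using s by auto
        have "AE \<omega> in M. simple_integral_over N ({..s} \<union> {s<..t}) (h n) \<omega> = ?S n \<omega> + simple_integral_over N {s<..t} (h n) \<omega>"
          by (rule simple_integral_union[OF h]) auto
        then show "AE \<omega> in M. \<bar>?S n \<omega> - (X \<omega> - Z \<omega>)\<bar> \<le> \<bar>?A n \<omega>\<bar> + \<bar>?B n \<omega> + ?D n \<omega>\<bar>"
          unfolding u using simple_integral_step_kernel[OF st a C, of n]
          by eventually_elim (simp add: R_def[symmetric] del: sum.lessThan_Suc)
      qed auto
      also have "prob_size (\<lambda>\<omega>. ?B n \<omega> + ?D n \<omega>) \<le> prob_size (?B n) + prob_size (?D n)"
        by (rule prob_size_le_add) auto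
      finally show ?thesis by simp
    qed
    have "(\<lambda>n. prob_size (?A n) + (prob_size (?B n) + prob_size (?D n))) \<longlonglongrightarrow> 0 + (0 + 0)"
      by (intro tendsto_add close RZ converges_in_probability_prob_size X)
    then have lim0: "(\<lambda>n. prob_size (?A n) + (prob_size (?B n) + prob_size (?D n))) \<longlonglongrightarrow> 0" by simp
    show "(\<lambda>n. prob_size (\<lambda>\<omega>. ?S n \<omega> - (X \<omega> - Z \<omega>))) \<longlonglongrightarrow> 0"
      by (rule tendsto_sandwich[OF _ _ tendsto_const lim0]) (use le prob_size_nonneg in auto)
  qed auto
  then show ?thesis by (simp add: Z_def)
qed

end

section \<open>Small jumps\<close>

text \<open>The weight \<open>2 - 2 cos x\<close> vanishes to second order at the origin, so that it integrates any
  L\'evy measure, and multiplying a measure by it turns the characteristic function into a second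
  difference.\<close>

definition jump_weight :: "real \<Rightarrow> real" where
  "jump_weight x = 2 - 2 * cos x"

lemma jump_weight_measurable[measurable]: "jump_weight \<in> borel_measurable borel"
  unfolding jump_weight_def[abs_def] by measurable

lemma jump_weight_nonneg: "0 \<le> jump_weight x"
  by (simp add: jump_weight_def)

lemma jump_weight_le_4: "jump_weight x \<le> 4"
  using cos_ge_minus_one[of x] unfolding jump_weight_def by linarith

lemma jump_weight_pos: "x \<noteq> 0 \<Longrightarrow> \<bar>x\<bar> < 1 \<Longrightarrow> 0 < jump_weight x"
  using cos_monotone_0_pi[of 0 "\<bar>x\<bar>"] pi_gt3 by (simp add: jump_weight_def)

lemma jump_weight_iexp:
  "jump_weight x *\<^sub>R iexp (u * x) = 2 * iexp (u * x) - iexp ((u + 1) * x) - iexp ((u - 1) * x)"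
proof -
  have "complex_of_real (2 * cos x) = iexp x + iexp (- x)"
    by (simp add: cos_of_real[symmetric] cos_exp_eq)
  moreover have "iexp ((u + 1) * x) = iexp (u * x) * iexp x" "iexp ((u - 1) * x) = iexp (u * x) * iexp (- x)"
    by (simp_all add: exp_add[symmetric] ring_distribs)
  ultimately show ?thesis
    by (simp add: jump_weight_def scaleR_conv_of_real algebra_simps)
qed

text \<open>Second-order Taylor expansion for |x| \<le> 1 and the trivial bound 2 elsewhere; the
  factor covers both cases.\<close>

lemma norm_iexp_compensated_le:
  "norm (iexp (u * x) - 1 - \<i> * complex_of_real (u * x * indicator {-1..1} x)) \<le> (u\<^sup>2 + 2) * min 1 (x\<^sup>2)"
proof (cases "x \<in> {-1..1}")
  case True
  then have x2: "x\<^sup>2 \<le> 1" by (simp add: abs_square_le_1 abs_le_iff)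
  have "norm (iexp (u * x) - (1 + \<i> * complex_of_real (u * x))) \<le> (u * x)\<^sup>2 / 2"
    using iexp_approx1[of "u * x" 1] by (simp add: numeral_2_eq_2)
  also have "\<dots> \<le> (u\<^sup>2 + 2) * x\<^sup>2"
    by (simp add: power_mult_distrib distrib_right add_increasing2)
  finally show ?thesis
    using True x2 by (simp add: diff_diff_eq)
next
  case False
  then have "1 < \<bar>x\<bar>" by auto
  then have x2: "1 < x\<^sup>2" using one_less_power[of "\<bar>x\<bar>" 2] by simp
  have "norm (iexp (u * x) - 1) \<le> norm (iexp (u * x)) + norm (1::complex)"
    by (rule norm_triangle_ineq4)
  then have "norm (iexp (u * x) - 1) \<le> 2" by simp
  also have "2 \<le> (u\<^sup>2 + 2) * min 1 (x\<^sup>2)" using x2 by simp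
  finally show ?thesis using False by simp
qed

context
  fixes \<Lambda> :: "real measure"
  assumes levy_measure: "levy_measure \<Lambda>"
begin

lemma levy_measure_sets[measurable_cong]: "sets \<Lambda> = sets borel"
  using levy_measure by (simp add: levy_measure_def)

lemma levy_measure_integrable: "integrable \<Lambda> (\<lambda>x. min 1 (x\<^sup>2))"
proof (rule integrableI_bounded)
  show "(\<integral>\<^sup>+ x. ennreal (norm (min 1 (x\<^sup>2))) \<partial>\<Lambda>) < \<infinity>"
    using levy_measure by (simp add: levy_measure_def)
qed measurable

lemma compensated_integrable:
  "integrable \<Lambda> (\<lambda>x. iexp (u * x) - 1 - \<i> * complex_of_real (u * x * indicator {-1..1} x))"
proof (rule Bochner_Integration.integrable_bound[OF integrable_mult_right[OF levy_measure_integrable, of "u\<^sup>2 + 2"]])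
  show "AE x in \<Lambda>. norm (iexp (u * x) - 1 - \<i> * complex_of_real (u * x * indicator {-1..1} x)) \<le> norm ((u\<^sup>2 + 2) * min 1 (x\<^sup>2))"
    by (intro AE_I2 order_trans[OF norm_iexp_compensated_le]) simp
qed measurable

text \<open>Drift and compensator are affine in \<open>u\<close>, so the second difference removes
  them and only the weighted exponential remains.\<close>

lemma levy_exponent_second_difference:
  "(CLINT x|\<Lambda>. jump_weight x *\<^sub>R iexp (u * x)) =
    2 * levy_exponent b 0 \<Lambda> u - levy_exponent b 0 \<Lambda> (u + 1) - levy_exponent b 0 \<Lambda> (u - 1)"
  and jump_weight_iexp_integrable: "integrable \<Lambda> (\<lambda>x. jump_weight x *\<^sub>R iexp (u * x))"
proof -
  define g where "g = (\<lambda>u x. iexp (u * x) - 1 - \<i> * complex_of_real (u * x * indicator {-1..1} x))"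
  have eq: "jump_weight x *\<^sub>R iexp (u * x) = 2 * g u x - g (u + 1) x - g (u - 1) x" for x
    unfolding jump_weight_iexp g_def by (simp add: algebra_simps)
  have int: "integrable \<Lambda> (g u)" for u
    unfolding g_def by (rule compensated_integrable)
  show "integrable \<Lambda> (\<lambda>x. jump_weight x *\<^sub>R iexp (u * x))"
    unfolding eq using int by simp
  have "(CLINT x|\<Lambda>. jump_weight x *\<^sub>R iexp (u * x)) =
      2 * (CLINT x|\<Lambda>. g u x) - (CLINT x|\<Lambda>. g (u + 1) x) - (CLINT x|\<Lambda>. g (u - 1) x)"
    unfolding eq using int by simp
  then show "(CLINT x|\<Lambda>. jump_weight x *\<^sub>R iexp (u * x)) =
    2 * levy_exponent b 0 \<Lambda> u - levy_exponent b 0 \<Lambda> (u + 1) - levy_exponent b 0 \<Lambda> (u - 1)"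
    by (simp add: levy_exponent_def g_def algebra_simps)
qed

lemma jump_weight_integrable: "integrable \<Lambda> jump_weight"
  using integrable_norm[OF jump_weight_iexp_integrable[of 0]] jump_weight_nonneg by simp

lemma jump_weight_integral_pos:
  assumes f: "f \<in> borel_measurable borel" "integrable \<Lambda> (\<lambda>x. f x * jump_weight x)"
    and pos: "\<And>x. 0 \<le> f x" "\<And>x. x \<in> J \<Longrightarrow> 0 < f x * jump_weight x"
    and J: "J \<in> sets borel" "0 < emeasure \<Lambda> J"
  shows "0 < (LINT x|\<Lambda>. f x * jump_weight x)"
proof (rule ccontr)
  assume "\<not> ?thesis"
  moreover have nn: "AE x in \<Lambda>. 0 \<le> f x * jump_weight x"
    using pos jump_weight_nonneg by auto
  ultimately have "(LINT x|\<Lambda>. f x * jump_weight x) = 0"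
    using integral_nonneg_AE[OF nn] by linarith
  then have "AE x in \<Lambda>. f x * jump_weight x = 0"
    using integral_nonneg_eq_0_iff_AE[OF f(2) nn] by simp
  then have "AE x in \<Lambda>. x \<notin> J"
    by eventually_elim (use pos(2) in force)
  then have "emeasure \<Lambda> J = 0"
    using J levy_measure_sets AE_iff_measurable[of J \<Lambda> "\<lambda>x. x \<notin> J"] sets_eq_imp_space_eq[OF levy_measure_sets] by simp
  then show False using J by simp
qed

end

lemma integral_jump_weight_density:
  fixes f :: "real \<Rightarrow> 'b::{banach, second_countable_topology}"
  assumes P: "sets P = sets borel" and f: "f \<in> borel_measurable borel" and c: "0 < c"
  shows "(LINT x|density P (\<lambda>x. ennreal (jump_weight x / c)). f x) = (LINT x|P. jump_weight x *\<^sub>R f x) /\<^sub>R c"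
proof -
  have [measurable]: "f \<in> borel_measurable P" "jump_weight \<in> borel_measurable P"
    using f by (simp_all add: measurable_cong_sets[OF P refl])
  have "(LINT x|density P (\<lambda>x. ennreal (jump_weight x / c)). f x) = (LINT x|P. inverse c *\<^sub>R (jump_weight x *\<^sub>R f x))"
    using c jump_weight_nonneg by (subst integral_density) (auto simp: divide_inverse mult.commute less_imp_le)
  then show ?thesis by (simp only: integral_scaleR_right)
qed

lemma (in real_distribution) char_second_difference:
  "(CLINT x|M. jump_weight x *\<^sub>R iexp (u * x)) = 2 * char M u - char M (u + 1) - char M (u - 1)"
proof -
  have i: "integrable M (\<lambda>x. iexp (u * x))" for u
    by (rule integrable_const_bound[of _ 1]) auto
  show ?thesis
    unfolding jump_weight_iexp char_def using i[of u] i[of "u + 1"] i[of "u - 1"] by simp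
qed

lemma exp_difference_quotient:
  fixes \<psi> :: complex
  assumes "D \<longlonglongrightarrow> 0" "\<And>n. 0 < D n"
  shows "(\<lambda>n. (exp (complex_of_real (D n) * \<psi>) - 1) / complex_of_real (D n)) \<longlonglongrightarrow> \<psi>"
proof -
  have "((\<lambda>z. exp (z * \<psi>)) has_field_derivative \<psi>) (at 0)"
    by (auto intro!: derivative_eq_intros)
  then have "((\<lambda>z. (exp (z * \<psi>) - 1) / z) \<longlongrightarrow> \<psi>) (at 0)"
    by (simp add: has_field_derivative_iff)
  moreover have "filterlim (\<lambda>n. complex_of_real (D n)) (at 0) sequentially"
    using tendsto_of_real[OF assms(1), where 'a=complex] assms(2)
    by (auto simp: filterlim_at less_imp_neq[symmetric] intro!: always_eventually)
  ultimately show ?thesis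
    by (rule filterlim_compose)
qed

section \<open>Small-time probabilities of intervals away from 0\<close>

context centered_levy
begin

text \<open>The laws of \<open>L (D n)\<close>, weighted by \<open>jump_weight\<close> and divided
  by \<open>D n\<close>, converge to the weighted Levy measure, because their Fourier transforms are
  second differences of (exp (D \<psi>) - 1) / D, which tends to the exponent \<psi>. Positive limit
  mass of the interval therefore means a probability of order \<open>D n\<close>.\<close>

lemma small_time_mass:
  assumes trip: "characteristic_triplet M L b 0 \<Lambda>"
    and xy: "x < y" "0 \<notin> {x<..<y}" "{x<..<y} \<subseteq> {-1<..<1}" and mass: "0 < emeasure \<Lambda> {x<..<y}"
    and D: "D \<longlonglongrightarrow> 0" "\<And>n. 0 < D n"
  shows "\<exists>c>0. eventually (\<lambda>n. c * D n \<le> prob {\<omega>\<in>space M. L (D n) \<omega> \<in> {x<..<y}}) sequentially"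
proof -
  have lm: "levy_measure \<Lambda>"
    and chr: "\<And>t u. 0 \<le> t \<Longrightarrow> char (distr M borel (L t)) u = exp (complex_of_real t * levy_exponent b 0 \<Lambda> u)"
    using trip unfolding characteristic_triplet_def by blast+
  note sL[measurable_cong] = levy_measure_sets[OF lm]
  let ?P = "\<lambda>n. distr M borel (L (D n))"
  let ?w = jump_weight
  interpret P: real_distribution "?P n" for n
    by (intro real_distribution_distr) simp
  have int_w: "integrable (?P n) (\<lambda>x. ?w x *\<^sub>R f x)" if "f \<in> borel_measurable borel" "\<And>x. norm (f x) \<le> B"
    for n B and f :: "real \<Rightarrow> real"
  proof (rule P.integrable_const_bound[of _ "4 * B"])
    show "AE x in ?P n. norm (?w x *\<^sub>R f x) \<le> 4 * B"
    proof (rule AE_I2)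
      fix x
      have "\<bar>?w x\<bar> * \<bar>f x\<bar> \<le> 4 * B"
        using that(2)[of x] jump_weight_nonneg[of x] jump_weight_le_4[of x] by (intro mult_mono) auto
      then show "norm (?w x *\<^sub>R f x) \<le> 4 * B" by (simp add: abs_mult)
    qed
    show "(\<lambda>x. ?w x *\<^sub>R f x) \<in> borel_measurable (?P n)"
      using that(1) by simp
  qed
  define m where "m n = (LINT x|?P n. ?w x) / D n" for n
  define m0 where "m0 = (LINT x|\<Lambda>. ?w x)"
  define G where "G n u = (CLINT x|?P n. ?w x *\<^sub>R iexp (u * x)) / complex_of_real (D n)" for n u
  have G: "(\<lambda>n. G n u) \<longlonglongrightarrow> (CLINT x|\<Lambda>. ?w x *\<^sub>R iexp (u * x))" for u
  proof -
    define e where "e n u = (exp (complex_of_real (D n) * levy_exponent b 0 \<Lambda> u) - 1) / complex_of_real (D n)" for n u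
    \<comment> \<open>The coefficients 2, -1, -1 add up to 0, so 1 may be subtracted from each
      characteristic function.\<close>
    have eq: "(\<lambda>n. G n u) = (\<lambda>n. 2 * e n u - e n (u + 1) - e n (u - 1))"
    proof
      fix n
      have alg: "(2 * A - B - C) / z = 2 * ((A - 1) / z) - (B - 1) / z - (C - 1) / z" for A B C z :: complex
        by (simp add: divide_inverse algebra_simps)
      show "G n u = 2 * e n u - e n (u + 1) - e n (u - 1)"
        unfolding G_def P.char_second_difference e_def alg using D(2)[of n] by (simp add: chr less_imp_le)
    qed
    have "(\<lambda>n. e n u) \<longlonglongrightarrow> levy_exponent b 0 \<Lambda> u" for u
      unfolding e_def by (rule exp_difference_quotient[OF D])
    then show ?thesis
      unfolding levy_exponent_second_difference[OF lm, of u b] eq by (intro tendsto_intros)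
  qed
  have G0: "G n 0 = complex_of_real (m n)" for n
    by (simp add: G_def m_def scaleR_conv_of_real)
  have m: "m \<longlonglongrightarrow> m0"
  proof -
    have "(\<lambda>n. complex_of_real (m n)) \<longlonglongrightarrow> complex_of_real m0"
      using G[of 0] unfolding G0 by (simp add: m0_def scaleR_conv_of_real)
    then show ?thesis by (simp only: tendsto_of_real_iff)
  qed
  have m0: "0 < m0"
  proof -
    have "0 < jump_weight z" if "z \<in> {x<..<y}" for z
      using that xy by (intro jump_weight_pos) (auto simp: subset_iff)
    then show ?thesis
      using jump_weight_integral_pos[OF lm, of "\<lambda>_. 1" "{x<..<y}"] jump_weight_integrable[OF lm] mass
      by (simp add: m0_def)
  qed
  \<comment> \<open>The continuity theorem concerns probability measures. Beyond \<open>k\<close>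
    the masses \<open>m n\<close> exceed half of their positive limit, so normalising is
    possible.\<close>
  then obtain k where k: "\<And>n. n \<ge> k \<Longrightarrow> m0 / 2 < m n"
    using order_tendstoD(1)[OF m, of "m0 / 2"] by (auto simp: eventually_sequentially)
  define \<mu> where "\<mu> n = density (?P (n + k)) (\<lambda>x. ennreal (?w x / (D (n + k) * m (n + k))))" for n
  define \<mu>0 where "\<mu>0 = density \<Lambda> (\<lambda>x. ennreal (?w x / m0))"
  have mk: "0 < D (n + k) * m (n + k)" for n
    using D(2)[of "n + k"] k[of "n + k"] m0 by simp
  have \<mu>_complex: "(CLINT x|\<mu> n. f x) = (CLINT x|?P (n + k). ?w x *\<^sub>R f x) /\<^sub>R (D (n + k) * m (n + k))"
    if "f \<in> borel_measurable borel" for f n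
    unfolding \<mu>_def using that mk by (intro integral_jump_weight_density) auto
  have \<mu>_real: "(LINT x|\<mu> n. f x) = (LINT x|?P (n + k). ?w x *\<^sub>R f x) /\<^sub>R (D (n + k) * m (n + k))"
    if "f \<in> borel_measurable borel" for f :: "real \<Rightarrow> real" and n
    unfolding \<mu>_def using that mk by (intro integral_jump_weight_density) auto
  note \<mu>0_int = integral_jump_weight_density[OF sL _ m0, folded \<mu>0_def]
  have rd: "real_distribution (\<mu> n)" for n
  proof (intro real_distribution.intro real_distribution_axioms.intro prob_spaceI)
    have "integrable (?P (n + k)) ?w"
      using int_w[of "\<lambda>_. 1::real" 1 "n + k"] by simp
    then have "emeasure (\<mu> n) (space (\<mu> n)) = ennreal (LINT x|?P (n + k). ?w x / (D (n + k) * m (n + k)))"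
      unfolding \<mu>_def using mk[of n] jump_weight_nonneg
      by (simp add: emeasure_density nn_integral_eq_integral less_imp_le cong: nn_integral_cong)
    also have "(LINT x|?P (n + k). ?w x / (D (n + k) * m (n + k))) = 1"
      using mk[of n] D(2)[of "n + k"] by (simp add: m_def)
    finally show "emeasure (\<mu> n) (space (\<mu> n)) = 1" by simp
  qed (simp add: \<mu>_def)
  have rd0: "real_distribution \<mu>0"
  proof (intro real_distribution.intro real_distribution_axioms.intro prob_spaceI)
    have "emeasure \<mu>0 (space \<mu>0) = ennreal (LINT x|\<Lambda>. ?w x / m0)"
      unfolding \<mu>0_def using m0 jump_weight_nonneg jump_weight_integrable[OF lm]
      by (simp add: emeasure_density nn_integral_eq_integral less_imp_le cong: nn_integral_cong)
    also have "(LINT x|\<Lambda>. ?w x / m0) = 1" using m0 by (simp add: m0_def)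
    finally show "emeasure \<mu>0 (space \<mu>0) = 1" by simp
  qed (simp add: \<mu>0_def sL)
  have weak: "weak_conv_m \<mu> \<mu>0"
  proof (rule levy_continuity[OF rd rd0])
    fix u
    have "char (\<mu> n) u = G (n + k) u / complex_of_real (m (n + k))" for n
      unfolding char_def by (subst \<mu>_complex) (auto simp: G_def scaleR_conv_of_real divide_inverse)
    moreover have "char \<mu>0 u = (CLINT x|\<Lambda>. ?w x *\<^sub>R iexp (u * x)) / complex_of_real m0"
      unfolding char_def by (subst \<mu>0_int) (auto simp: scaleR_conv_of_real divide_inverse)
    moreover have "(\<lambda>n. G (n + k) u / complex_of_real (m (n + k))) \<longlonglongrightarrow> (CLINT x|\<Lambda>. ?w x *\<^sub>R iexp (u * x)) / complex_of_real m0"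
      using m0 by (intro tendsto_divide LIMSEQ_ignore_initial_segment[OF G] tendsto_of_real LIMSEQ_ignore_initial_segment[OF m]) auto
    ultimately show "(\<lambda>n. char (\<mu> n) u) \<longlonglongrightarrow> char \<mu>0 u" by simp
  qed
  \<comment> \<open>A tent supported on the interval: a continuous test function avoids the question
    whether the limit measure charges the endpoints.\<close>
  define f where "f z = max 0 (min (z - x) (y - z))" for z
  have f_bound: "0 \<le> f z" "f z \<le> (y - x) * indicator {x<..<y} z" for z
    using xy by (auto simp: f_def indicator_def)
  have f_le: "norm (f z) \<le> y - x" for z
    using xy by (auto simp: f_def)
  have f_meas[measurable]: "f \<in> borel_measurable borel"
    unfolding f_def[abs_def] by measurable
  have f_lim: "(\<lambda>n. LINT z|\<mu> n. f z) \<longlonglongrightarrow> (LINT z|\<mu>0. f z)"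
  proof (rule weak_conv_imp_integral_bdd_continuous_conv[OF rd rd0 weak _ f_le])
    show "isCont f z" for z
      unfolding f_def[abs_def] by (intro continuous_intros)
  qed
  define I where "I = (LINT z|\<mu>0. f z)"
  have "0 < I"
  proof -
    have "integrable \<Lambda> (\<lambda>z. f z * ?w z)"
    proof (rule Bochner_Integration.integrable_bound[OF integrable_mult_right[OF jump_weight_integrable[OF lm], of "y - x"]])
      show "AE z in \<Lambda>. norm (f z * ?w z) \<le> norm ((y - x) * ?w z)"
        using f_le jump_weight_nonneg xy by (intro AE_I2) (simp add: abs_mult mult_right_mono)
      show "(\<lambda>z. f z * ?w z) \<in> borel_measurable \<Lambda>"
        unfolding measurable_cong_sets[OF sL refl] by measurable
    qed
    then have "0 < (LINT z|\<Lambda>. f z * ?w z)"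
    proof (rule jump_weight_integral_pos[OF lm f_meas _ f_bound(1) _ _ mass])
      show "0 < f z * ?w z" if "z \<in> {x<..<y}" for z
        using that xy by (intro mult_pos_pos jump_weight_pos) (auto simp: f_def subset_iff)
    qed simp
    then show ?thesis
      using m0 by (simp add: I_def \<mu>0_int mult.commute)
  qed
  then obtain k2 where k2: "\<And>n. n \<ge> k2 \<Longrightarrow> I / 2 < (LINT z|\<mu> n. f z)"
    using order_tendstoD(1)[OF f_lim, of "I / 2"] by (auto simp: eventually_sequentially I_def)
  \<comment> \<open>The weight is at most 4 and the tent at most y - x, while I / 2 and m0 / 2 bound
    the test integral and the mass from below.\<close>
  define c where "c = (I / 2) * (m0 / 2) / (4 * (y - x))"
  have c: "0 < c" using \<open>0 < I\<close> m0 xy by (simp add: c_def)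
  have bound: "c * D (n + k) \<le> prob {\<omega>\<in>space M. L (D (n + k)) \<omega> \<in> {x<..<y}}" if n: "n \<ge> k2" for n
  proof -
    let ?p = "prob {\<omega>\<in>space M. L (D (n + k)) \<omega> \<in> {x<..<y}}"
    have meas: "measure (?P (n + k)) {x<..<y} = ?p"
      by (subst measure_distr) (auto intro!: arg_cong[where f=prob])
    have "(LINT z|?P (n + k). ?w z * f z) \<le> (LINT z|?P (n + k). (4 * (y - x)) * indicator {x<..<y} z)"
    proof (rule integral_mono)
      show "integrable (?P (n + k)) (\<lambda>z. ?w z * f z)"
        using int_w[of f "y - x"] f_le by simp
      show "integrable (?P (n + k)) (\<lambda>z. (4 * (y - x)) * indicator {x<..<y} z)"
        by (intro integrable_mult_right integrable_real_indicator) (auto simp: P.emeasure_eq_measure)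
      show "?w z * f z \<le> (4 * (y - x)) * indicator {x<..<y} z" for z
        unfolding mult.assoc using f_bound(1)[of z] by (intro mult_mono jump_weight_le_4 f_bound(2)) auto
    qed
    then have "(LINT z|?P (n + k). ?w z * f z) \<le> (4 * (y - x)) * ?p"
      by (simp add: meas)
    moreover have "(LINT z|\<mu> n. f z) * (D (n + k) * m (n + k)) = (LINT z|?P (n + k). ?w z * f z)"
    proof -
      have "X /\<^sub>R c * c = X" if "0 < c" for X c :: real using that by simp
      from this[OF mk[of n]] show ?thesis
        unfolding \<mu>_real[OF f_meas] by (simp only: real_scaleR_def)
    qed
    moreover have "(I / 2) * (D (n + k) * (m0 / 2)) \<le> (LINT z|\<mu> n. f z) * (D (n + k) * m (n + k))"
      using k2[OF n] k[of "n + k"] D(2)[of "n + k"] \<open>0 < I\<close> m0 by (intro mult_mono) auto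
    ultimately have "(I / 2) * (D (n + k) * (m0 / 2)) \<le> (4 * (y - x)) * ?p" by simp
    then show ?thesis
      using xy by (simp add: c_def field_simps)
  qed
  have "\<forall>n\<ge>k2 + k. c * D n \<le> prob {\<omega>\<in>space M. L (D n) \<omega> \<in> {x<..<y}}"
  proof (intro allI impI)
    fix n assume "k2 + k \<le> n"
    then show "c * D n \<le> prob {\<omega>\<in>space M. L (D n) \<omega> \<in> {x<..<y}}"
      using bound[of "n - k"] by simp
  qed
  then show ?thesis
    using c unfolding eventually_sequentially by blast
qed

end

section \<open>Support of the driving path\<close>

context centered_levy
begin

lemma increments_event:
  assumes "u \<in> I" "v \<in> I" "B \<in> sets borel"
  shows "{\<omega>\<in>space M. L u \<omega> - L v \<omega> \<in> B} \<in> sets (increments I)"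
proof -
  have "(\<lambda>\<omega>. L u \<omega> - L v \<omega>) -` B \<inter> space (increments I) \<in> sets (increments I)"
    by (rule measurable_sets[OF increments_measurable[OF assms(1,2)] assms(3)])
  moreover have "(\<lambda>\<omega>. L u \<omega> - L v \<omega>) -` B \<inter> space (increments I) = {\<omega>\<in>space M. L u \<omega> - L v \<omega> \<in> B}"
    by auto
  ultimately show ?thesis by simp
qed

lemma prob_increment_large:
  assumes s: "0 \<le> s" "s \<le> t" and d: "0 < d"
  shows "prob {\<omega>\<in>space M. d < \<bar>L t \<omega> - L s \<omega>\<bar>} \<le> sigma2 * (t - s) / d\<^sup>2"
proof -
  have "prob {\<omega>\<in>space M. d < \<bar>L t \<omega> - L s \<omega>\<bar>} \<le> prob {\<omega>\<in>space M. d \<le> \<bar>(L t \<omega> - L s \<omega>) - expectation (\<lambda>\<omega>. L t \<omega> - L s \<omega>)\<bar>}"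
    using s by (intro finite_measure_mono) (auto simp: expectation_L_diff)
  also have "\<dots> \<le> variance (\<lambda>\<omega>. L t \<omega> - L s \<omega>) / d\<^sup>2"
    using s d by (intro Chebyshev_inequality increment_square_integrable) auto
  also have "\<dots> = sigma2 * (t - s) / d\<^sup>2"
    using s by (simp add: expectation_L_diff expectation_increment_square)
  finally show ?thesis .
qed

definition grid_excursion :: "real \<Rightarrow> real \<Rightarrow> real \<Rightarrow> nat \<Rightarrow> 'a set" where
  "grid_excursion s t d n = {\<omega>\<in>space M. \<exists>i\<le>Suc n. d < \<bar>L (grid s t n i) \<omega> - L s \<omega>\<bar>}"

text \<open>An excursion beyond \<open>d\<close> that ends within \<open>d / 2\<close> consists of two independent large
  increments, which makes its probability quadratic in \<open>t - s\<close>.\<close>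

lemma prob_grid_excursion_return:
  assumes s: "0 \<le> s" "s < t" and d: "0 < d"
  shows "prob (grid_excursion s t d n \<inter> {\<omega>\<in>space M. \<bar>L t \<omega> - L s \<omega>\<bar> \<le> d / 2}) \<le> 2 * (4 * sigma2 * (t - s) / d\<^sup>2)\<^sup>2"
proof -
  \<comment> \<open>Chebyshev's bound for an increment exceeding d / 2 over a time of at most t -
    s.\<close>
  define q where "q = 4 * sigma2 * (t - s) / d\<^sup>2"
  have q: "0 \<le> q" using s sigma2_nonneg by (simp add: q_def)
  let ?p = "grid s t n"
  let ?E = "grid_excursion s t d n" and ?R = "{\<omega>\<in>space M. \<bar>L t \<omega> - L s \<omega>\<bar> \<le> d / 2}"
  \<comment> \<open>The first grid excursion occurs at index k. This event belongs to the past of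
    the k-th grid point, and \<open>F k\<close> to its future.\<close>
  define T where "T k = {\<omega>\<in>space M. d < \<bar>L (?p k) \<omega> - L s \<omega>\<bar>} - (\<Union>i<k. {\<omega>\<in>space M. d < \<bar>L (?p i) \<omega> - L s \<omega>\<bar>})" for k
  define F where "F k = {\<omega>\<in>space M. d / 2 < \<bar>L t \<omega> - L (?p k) \<omega>\<bar>}" for k
  have p: "s \<le> ?p k" "?p k \<le> t" if "k \<le> Suc n" for k
    using grid_mem[of s t k n] s that by auto
  have big: "{\<omega>\<in>space M. c < \<bar>L u \<omega> - L v \<omega>\<bar>} \<in> sets (increments I)" if "u \<in> I" "v \<in> I" for u v I and c :: real
  proof -
    have "{x. c < \<bar>x\<bar>} \<in> sets borel" by simp
    from increments_event[OF that this] show ?thesis by simp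
  qed
  have T: "T k \<in> sets (increments {..?p k})" if "k \<le> Suc n" for k
  proof -
    have "{\<omega>\<in>space M. d < \<bar>L (?p i) \<omega> - L s \<omega>\<bar>} \<in> sets (increments {..?p k})" if "i \<le> k" for i
      using that p[of k] \<open>k \<le> Suc n\<close> grid_le[of s t i k n] s by (intro big) auto
    then show ?thesis unfolding T_def by (intro sets.Diff sets.finite_UN) auto
  qed
  have F: "F k \<in> sets (increments {?p k..})" if "k \<le> Suc n" for k
    unfolding F_def using p[OF that] by (intro big) auto
  have Fq: "prob (F k) \<le> q" if "k \<le> Suc n" for k
  proof -
    have "prob (F k) \<le> sigma2 * (t - ?p k) / (d / 2)\<^sup>2"
      unfolding F_def using p[OF that] s d by (intro prob_increment_large) auto
    also have "\<dots> \<le> sigma2 * (t - s) / (d / 2)\<^sup>2"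
      using p[OF that] sigma2_nonneg by (intro divide_right_mono mult_left_mono) auto
    also have "\<dots> = q" by (simp add: q_def power_divide)
    finally show ?thesis .
  qed
  have ev: "T k \<in> events" "F k \<in> events" if "k \<le> Suc n" for k
    using T[OF that] F[OF that] sets_increments_events by blast+
  have disj: "disjoint_family_on T {..Suc n}"
  proof -
    have "T i \<inter> T j = {}" if "i < j" for i j
      using that by (auto simp: T_def)
    then show ?thesis
      unfolding disjoint_family_on_def by (metis Int_commute nat_neq_iff)
  qed
  have E: "?E = (\<Union>k\<le>Suc n. T k)"
  proof (intro equalityI subsetI)
    fix \<omega> assume w: "\<omega> \<in> ?E"
    define k where "k = (LEAST i. d < \<bar>L (?p i) \<omega> - L s \<omega>\<bar>)"
    obtain i where i: "i \<le> Suc n" "d < \<bar>L (?p i) \<omega> - L s \<omega>\<bar>"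
      using w by (auto simp: grid_excursion_def)
    have "d < \<bar>L (?p k) \<omega> - L s \<omega>\<bar>" "k \<le> Suc n"
      using LeastI[of "\<lambda>i. d < \<bar>L (?p i) \<omega> - L s \<omega>\<bar>", OF i(2)] Least_le[of "\<lambda>i. d < \<bar>L (?p i) \<omega> - L s \<omega>\<bar>", OF i(2)] i(1)
      by (auto simp: k_def)
    moreover have "\<not> d < \<bar>L (?p j) \<omega> - L s \<omega>\<bar>" if "j < k" for j
      using not_less_Least[of j "\<lambda>i. d < \<bar>L (?p i) \<omega> - L s \<omega>\<bar>"] that by (simp add: k_def)
    ultimately show "\<omega> \<in> (\<Union>k\<le>Suc n. T k)"
      using w by (auto simp: T_def grid_excursion_def intro!: bexI[of _ k])
  qed (auto simp: T_def grid_excursion_def)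
  have Ee: "?E \<in> events" unfolding E using ev by (intro sets.finite_UN) auto
  have Re: "?R \<in> events" by measurable
  have ret: "prob (?E \<inter> ?R) \<le> q * prob ?E"
  proof -
    have "prob (?E \<inter> ?R) \<le> prob (\<Union>k\<le>Suc n. T k \<inter> F k)"
    proof (rule finite_measure_mono)
      show "?E \<inter> ?R \<subseteq> (\<Union>k\<le>Suc n. T k \<inter> F k)"
      proof
        fix \<omega> assume w: "\<omega> \<in> ?E \<inter> ?R"
        then obtain k where k: "k \<le> Suc n" "\<omega> \<in> T k" unfolding E by auto
        then have "d < \<bar>L (?p k) \<omega> - L s \<omega>\<bar>" "\<bar>L t \<omega> - L s \<omega>\<bar> \<le> d / 2" "\<omega> \<in> space M"
          using w by (auto simp: T_def)
        moreover have "\<bar>L (?p k) \<omega> - L s \<omega>\<bar> \<le> \<bar>L t \<omega> - L s \<omega>\<bar> + \<bar>L t \<omega> - L (?p k) \<omega>\<bar>"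
          by (rule order_trans[OF _ abs_triangle_ineq4]) simp
        ultimately have "\<omega> \<in> F k" unfolding F_def by simp
        then show "\<omega> \<in> (\<Union>k\<le>Suc n. T k \<inter> F k)" using k by blast
      qed
    qed (use ev in \<open>intro sets.finite_UN sets.Int, auto\<close>)
    also have "\<dots> \<le> (\<Sum>k\<le>Suc n. prob (T k \<inter> F k))"
      using ev by (intro finite_measure_subadditive_finite) auto
    also have "\<dots> = (\<Sum>k\<le>Suc n. prob (T k) * prob (F k))"
      using T F by (intro sum.cong refl indep_past_future) auto
    also have "\<dots> \<le> (\<Sum>k\<le>Suc n. prob (T k) * q)"
      using Fq by (intro sum_mono mult_left_mono) auto
    also have "\<dots> = q * prob ?E"
      unfolding E using ev disj
      by (subst finite_measure_finite_Union) (auto simp: sum_distrib_left mult.commute simp del: sum.atMost_Suc)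
    finally show ?thesis .
  qed
  \<comment> \<open>An excursion either returns or ends beyond d / 2, so it has probability at most
    2 q; inserted into the bound for returning excursions, this yields the second factor q.\<close>
  have "prob ?E \<le> prob ((?E \<inter> ?R) \<union> F 0)"
    using Ee Re ev[of 0] by (intro finite_measure_mono) (auto simp: F_def grid_excursion_def)
  also have "\<dots> \<le> prob (?E \<inter> ?R) + prob (F 0)"
    using Ee Re ev[of 0] by (intro measure_Un_le) auto
  also have "\<dots> \<le> q * 1 + q"
    using ret Fq[of 0] mult_left_mono[OF prob_le_1[of ?E] q] by simp
  finally have "prob ?E \<le> 2 * q" by simp
  then have "q * prob ?E \<le> q * (2 * q)"
    using q by (intro mult_left_mono)
  then have "prob (?E \<inter> ?R) \<le> 2 * q\<^sup>2"
    using ret unfolding power2_eq_square by linarith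
  then show ?thesis by (simp only: q_def)
qed

text \<open>By right-continuity the displacement at the end of the cell of \<open>r\<close>
  converges to that at \<open>r\<close>, so an excursion at an arbitrary time is seen by all
  sufficiently fine grids.\<close>

lemma excursion_eventually_on_grid:
  assumes w: "\<omega> \<in> space M" and s: "0 \<le> s" "s < t" and r: "r \<in> {s..t}" "d < \<bar>L r \<omega> - L s \<omega>\<bar>"
    and d: "0 \<le> d"
  shows "eventually (\<lambda>n. \<omega> \<in> grid_excursion s t d n) sequentially"
proof -
  have "r \<noteq> s" using r d by auto
  then have rr: "r \<in> {s<..t}" using r by auto
  obtain i where i: "\<And>n. i n < Suc n" "\<And>n. r \<in> {grid s t n (i n)<..grid s t n (Suc (i n))}"
    using grid_cell[OF rr] by metis
  let ?c = "\<lambda>n. grid s t n (Suc (i n))"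
  have c: "r \<le> ?c n" "?c n \<le> r + (t - s) * inverse (real (Suc n))" for n
    using i(2)[of n] by (auto simp: grid_Suc divide_inverse)
  have "(\<lambda>n. r + (t - s) * inverse (real (Suc n))) \<longlonglongrightarrow> r + (t - s) * 0"
    by (intro tendsto_add tendsto_mult tendsto_const LIMSEQ_inverse_real_of_nat)
  then have "(\<lambda>n. r + (t - s) * inverse (real (Suc n))) \<longlonglongrightarrow> r" by simp
  from tendsto_sandwich[OF _ _ tendsto_const this, of ?c]
  have c_lim: "?c \<longlonglongrightarrow> r"
    using c(1) c(2) always_eventually by blast
  have "0 \<le> r" using rr s by simp
  from right_limit_sequence[OF right_continuous[OF w this] c_lim c(1)]
  have "(\<lambda>n. \<bar>L (?c n) \<omega> - L s \<omega>\<bar>) \<longlonglongrightarrow> \<bar>L r \<omega> - L s \<omega>\<bar>"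
    by (intro tendsto_intros)
  from order_tendstoD(1)[OF this r(2)]
  show ?thesis
  proof eventually_elim
    case (elim n)
    then show ?case
      using w i(1)[of n] by (auto simp: grid_excursion_def intro!: exI[of _ "Suc (i n)"])
  qed
qed

text \<open>The event is demanded in the sigma-algebra of the window so that events of successive
  windows are independent.\<close>

definition step_possible :: "real set \<Rightarrow> real \<Rightarrow> real \<Rightarrow> real \<Rightarrow> bool" where
  "step_possible J d s t \<longleftrightarrow> (\<exists>E\<in>sets (increments {s..t}). 0 < prob E \<and>
    (\<forall>\<omega>\<in>E. L t \<omega> - L s \<omega> \<in> J \<and> (\<forall>r\<in>{s..t}. \<bar>L r \<omega> - L s \<omega>\<bar> \<le> d)))"

text \<open>The grids are not nested, so excursions are collected in the limit inferior
  \<open>W\<close> of the grid events; as a limit of increasing events it inherits their common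
  bound. The part of \<open>G\<close> outside \<open>W\<close> then has positive
  probability.\<close>

lemma step_event:
  assumes s: "0 \<le> s" "s < t" and d: "0 < d" and J: "J \<in> sets borel" "J \<subseteq> {- (d / 2)..d / 2}"
    and p: "2 * (4 * sigma2 * (t - s) / d\<^sup>2)\<^sup>2 < prob {\<omega>\<in>space M. L (t - s) \<omega> \<in> J}"
  shows "step_possible J d s t"
proof -
  let ?R = "{\<omega>\<in>space M. \<bar>L t \<omega> - L s \<omega>\<bar> \<le> d / 2}"
  define B where "B n = grid_excursion s t d n \<inter> ?R" for n
  define W where "W = (\<Union>m. \<Inter>n\<in>{m..}. B n)"
  define G where "G = {\<omega>\<in>space M. L t \<omega> - L s \<omega> \<in> J}"
  have [simp]: "s \<le> t" using s by simp
  have R: "?R \<in> sets (increments {s..t})"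
    using increments_event[of t "{s..t}" s "{x. \<bar>x\<bar> \<le> d / 2}"] by simp
  have B: "B n \<in> sets (increments {s..t})" for n
  proof -
    have "grid_excursion s t d n = (\<Union>i\<le>Suc n. {\<omega>\<in>space M. L (grid s t n i) \<omega> - L s \<omega> \<in> {x. d < \<bar>x\<bar>}})"
      by (auto simp: grid_excursion_def)
    moreover have "\<dots> \<in> sets (increments {s..t})"
      using grid_mem[of s t _ n] s by (intro sets.finite_UN increments_event) auto
    ultimately show ?thesis unfolding B_def using R by auto
  qed
  have W: "W \<in> sets (increments {s..t})"
    unfolding W_def using B by (intro sets.countable_UN sets.countable_INT') auto
  have G: "G \<in> sets (increments {s..t})"
    unfolding G_def using J s by (intro increments_event) auto
  have ev: "B n \<in> events" "W \<in> events" "G \<in> events" for n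
    using B W G sets_increments_events by blast+
  have "prob W \<le> 2 * (4 * sigma2 * (t - s) / d\<^sup>2)\<^sup>2"
  proof -
    have I: "(\<Inter>n\<in>{m..}. B n) \<in> events" for m
      using ev by (intro sets.countable_INT') auto
    have "incseq (\<lambda>m. \<Inter>n\<in>{m..}. B n)"
      by (rule incseq_SucI) force
    then have "(\<lambda>m. prob (\<Inter>n\<in>{m..}. B n)) \<longlonglongrightarrow> prob W"
      unfolding W_def using I by (intro finite_Lim_measure_incseq) auto
    moreover have "prob (\<Inter>n\<in>{m..}. B n) \<le> 2 * (4 * sigma2 * (t - s) / d\<^sup>2)\<^sup>2" for m
    proof -
      have "prob (\<Inter>n\<in>{m..}. B n) \<le> prob (B m)"
        using ev by (intro finite_measure_mono) auto
      also have "\<dots> \<le> 2 * (4 * sigma2 * (t - s) / d\<^sup>2)\<^sup>2"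
        unfolding B_def by (rule prob_grid_excursion_return[OF s d])
      finally show ?thesis .
    qed
    ultimately show ?thesis by (intro LIMSEQ_le_const2) auto
  qed
  moreover have "prob G = prob {\<omega>\<in>space M. L (t - s) \<omega> \<in> J}"
  proof -
    have "measure (distr M borel (\<lambda>\<omega>. L (s + (t - s)) \<omega> - L s \<omega>)) J = measure (distr M borel (L (t - s))) J"
      using distr_increment[of s "t - s"] s by simp
    moreover have "measure (distr M borel (\<lambda>\<omega>. L (s + (t - s)) \<omega> - L s \<omega>)) J = prob G"
      using J by (subst measure_distr) (auto simp: G_def intro!: arg_cong[where f=prob])
    moreover have "measure (distr M borel (L (t - s))) J = prob {\<omega>\<in>space M. L (t - s) \<omega> \<in> J}"
      using J by (subst measure_distr) (auto intro!: arg_cong[where f=prob])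
    ultimately show ?thesis by simp
  qed
  moreover have "prob G \<le> prob (G - W) + prob W"
  proof -
    have "prob G \<le> prob ((G - W) \<union> W)" using ev by (intro finite_measure_mono) auto
    also have "\<dots> \<le> prob (G - W) + prob W" using ev by (intro measure_Un_le) auto
    finally show ?thesis .
  qed
  ultimately have "0 < prob (G - W)" using p by linarith
  moreover have "\<bar>L r \<omega> - L s \<omega>\<bar> \<le> d" if "\<omega> \<in> G - W" "r \<in> {s..t}" for \<omega> r
  proof (rule ccontr)
    assume "\<not> \<bar>L r \<omega> - L s \<omega>\<bar> \<le> d"
    moreover have w: "\<omega> \<in> space M" using that by (auto simp: G_def)
    ultimately have "eventually (\<lambda>n. \<omega> \<in> grid_excursion s t d n) sequentially"
      using that s d by (intro excursion_eventually_on_grid[of \<omega> s t r d]) auto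
    moreover have "\<omega> \<in> ?R"
    proof -
      have "L t \<omega> - L s \<omega> \<in> {- (d / 2)..d / 2}" using that J(2) by (auto simp: G_def)
      then have "\<bar>L t \<omega> - L s \<omega>\<bar> \<le> d / 2" unfolding abs_le_iff by auto
      then show ?thesis using w by simp
    qed
    ultimately have "eventually (\<lambda>n. \<omega> \<in> B n) sequentially"
      by (auto simp: B_def elim: eventually_mono)
    then have "\<omega> \<in> W" unfolding W_def eventually_sequentially by auto
    then show False using that by simp
  qed
  ultimately show ?thesis
    unfolding step_possible_def using G W by (intro bexI[of _ "G - W"]) (auto simp: G_def)
qed

lemma eventually_step_event:
  assumes trip: "characteristic_triplet M L b 0 \<Lambda>" and d: "0 < d"
    and J: "x < y" "0 \<notin> {x<..<y}" "{x<..<y} \<subseteq> {-1<..<1}" "{x<..<y} \<subseteq> {- (d / 2)..d / 2}"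
    and mass: "0 < emeasure \<Lambda> {x<..<y}"
    and D: "D \<longlonglongrightarrow> 0" "\<And>n. 0 < D n"
  shows "eventually (\<lambda>n. \<forall>s t. 0 \<le> s \<longrightarrow> t - s = D n \<longrightarrow> step_possible {x<..<y} d s t) sequentially"
proof -
  obtain c where c: "0 < c" and ev: "eventually (\<lambda>n. c * D n \<le> prob {\<omega>\<in>space M. L (D n) \<omega> \<in> {x<..<y}}) sequentially"
    using small_time_mass[OF trip J(1-3) mass D] by blast
  \<comment> \<open>The bound on returning excursions is \<open>K * (D n)\<^sup>2\<close>,
    eventually below the linear lower bound \<open>c * D n\<close>.\<close>
  define K where "K = 2 * (4 * sigma2 / d\<^sup>2)\<^sup>2"
  have "(\<lambda>n. K * D n) \<longlonglongrightarrow> K * 0" by (intro tendsto_mult tendsto_const D)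
  then have "eventually (\<lambda>n. K * D n < c) sequentially"
    using order_tendstoD(2)[of "\<lambda>n. K * D n" 0 sequentially c] c by simp
  with ev show ?thesis
  proof eventually_elim
    case (elim n)
    show ?case
    proof (intro allI impI)
      fix s t :: real assume st: "0 \<le> s" "t - s = D n"
      have "2 * (4 * sigma2 * (t - s) / d\<^sup>2)\<^sup>2 = (K * D n) * D n"
        unfolding K_def st(2) by (simp add: power2_eq_square)
      also have "\<dots> < c * D n" using elim(2) D(2)[of n] by (intro mult_strict_right_mono)
      also have "\<dots> \<le> prob {\<omega>\<in>space M. L (t - s) \<omega> \<in> {x<..<y}}" using elim(1) st(2) by simp
      finally show "step_possible {x<..<y} d s t"
        using st D(2)[of n] d J by (intro step_event) auto
    qed
  qed
qed

end

text \<open>The interval is an increasing union of intervals bounded away from 0. The gap serves the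
  steering, where a jump has to outweigh the oscillation of the target during one grid step.\<close>

lemma positive_mass_away_from_zero:
  fixes \<Lambda> :: "real measure"
  assumes "sets \<Lambda> = sets borel" "0 < emeasure \<Lambda> {0<..<e}"
  shows "\<exists>x>0. x < e \<and> 0 < emeasure \<Lambda> {x<..<e}"
    and "0 < emeasure \<Lambda> {-e<..<0} \<Longrightarrow> \<exists>x>0. x < e \<and> 0 < emeasure \<Lambda> {-e<..<-x}"
proof -
  have arch: "\<exists>n. inverse (real (Suc n)) < z" if "0 < z" for z :: real
    by (rule reals_Archimedean[OF that])
  show "\<exists>x>0. x < e \<and> 0 < emeasure \<Lambda> {x<..<e}"
  proof (rule ccontr)
    assume *: "\<not> ?thesis"
    have "emeasure \<Lambda> {inverse (real (Suc n))<..<e} = 0" for n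
    proof (cases "inverse (real (Suc n)) < e")
      case True
      then show ?thesis using *[simplified, rule_format, of "inverse (real (Suc n))"] by (simp add: zero_less_iff_neq_zero)
    qed simp
    then have "emeasure \<Lambda> (\<Union>n. {inverse (real (Suc n))<..<e}) = 0"
      using assms by (intro emeasure_UN_eq_0) auto
    moreover have "(\<Union>n. {inverse (real (Suc n))<..<e}) = {0<..<e}"
      using arch by (auto simp del: of_nat_Suc) (metis inverse_positive_iff_positive less_trans of_nat_0_less_iff zero_less_Suc)
    ultimately show False using assms by simp
  qed
  assume neg: "0 < emeasure \<Lambda> {-e<..<0}"
  show "\<exists>x>0. x < e \<and> 0 < emeasure \<Lambda> {-e<..<-x}"
  proof (rule ccontr)
    assume *: "\<not> ?thesis"
    have "emeasure \<Lambda> {-e<..<- inverse (real (Suc n))} = 0" for n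
    proof (cases "inverse (real (Suc n)) < e")
      case True
      then show ?thesis using *[simplified, rule_format, of "inverse (real (Suc n))"] by (simp add: zero_less_iff_neq_zero)
    qed simp
    then have "emeasure \<Lambda> (\<Union>n. {-e<..<- inverse (real (Suc n))}) = 0"
      using assms by (intro emeasure_UN_eq_0) auto
    moreover have "(\<Union>n. {-e<..<- inverse (real (Suc n))}) = {-e<..<0}"
    proof (intro equalityI subsetI)
      fix z assume z: "z \<in> {-e<..<0}"
      then obtain n where "inverse (real (Suc n)) < - z" using arch[of "- z"] by auto
      then show "z \<in> (\<Union>n. {-e<..<- inverse (real (Suc n))})" using z by (intro UN_I[of n]) auto
    next
      fix z assume "z \<in> (\<Union>n. {-e<..<- inverse (real (Suc n))})"
      then obtain n where "-e < z" "z < - inverse (real (Suc n))" by auto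
      moreover have "0 < inverse (real (Suc n))" by simp
      ultimately show "z \<in> {-e<..<0}" unfolding greaterThanLessThan_iff by linarith
    qed
    ultimately show False using neg by simp
  qed
qed

section \<open>Steering the path along a continuous function\<close>

context centered_levy
begin

text \<open>On a fine grid the error is kept within 2 d at grid times and within 4 d in between. The
  choice of direction is not made path by path: at each grid time one sign of the error has positive
  probability, and only that part of the event is continued.\<close>

lemma path_support:
  fixes l :: "real \<Rightarrow> real"
  assumes trip: "characteristic_triplet M L b 0 \<Lambda>"
    and jumps: "\<And>\<epsilon>::real. \<epsilon> > 0 \<Longrightarrow> emeasure \<Lambda> {-\<epsilon><..<0} > 0 \<and> emeasure \<Lambda> {0<..<\<epsilon>} > 0"
    and s: "0 \<le> s" "s < t" and l: "continuous_on {s..t} l" "l s = 0" and e: "0 < e"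
  shows "\<exists>E\<in>sets (increments {s..t}). 0 < prob E \<and> (\<forall>\<omega>\<in>E. \<forall>r\<in>{s..t}. \<bar>L r \<omega> - L s \<omega> - l r\<bar> \<le> e)"
proof -
  \<comment> \<open>The final error bound is 4 d; d \<le> 1 keeps the jump sizes where the weight is
    positive.\<close>
  define d where "d = min (e / 4) 1"
  have d: "0 < d" "4 * d \<le> e" "d \<le> 1" using e by (auto simp: d_def)
  have S: "sets \<Lambda> = sets borel"
    using trip by (simp add: characteristic_triplet_def levy_measure_def)
  obtain x where x: "0 < x" "x < d / 2" "0 < emeasure \<Lambda> {x<..<d / 2}"
    using positive_mass_away_from_zero(1)[OF S, of "d / 2"] jumps[of "d / 2"] d by auto
  obtain x' where x': "0 < x'" "x' < d / 2" "0 < emeasure \<Lambda> {-(d / 2)<..<-x'}"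
    using positive_mass_away_from_zero(2)[OF S, of "d / 2"] jumps[of "d / 2"] d by auto
  define D where "D n = (t - s) / real (Suc n)" for n
  have "(\<lambda>n. (t - s) * inverse (real (Suc n))) \<longlonglongrightarrow> (t - s) * 0"
    by (intro tendsto_mult tendsto_const LIMSEQ_inverse_real_of_nat)
  then have D: "D \<longlonglongrightarrow> 0" "\<And>n. 0 < D n"
    using s by (simp_all add: D_def[abs_def] divide_inverse)
  have "uniformly_continuous_on {s..t} l"
    using l by (intro compact_uniformly_continuous) auto
  \<comment> \<open>On one grid cell the target moves by less than the smallest admissible
    jump.\<close>
  then obtain \<delta> where \<delta>: "0 < \<delta>" "\<And>u v. u \<in> {s..t} \<Longrightarrow> v \<in> {s..t} \<Longrightarrow> \<bar>v - u\<bar> < \<delta> \<Longrightarrow> \<bar>l v - l u\<bar> < min x x'"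
    using x(1) x'(1) unfolding uniformly_continuous_on_def dist_real_def by (metis min_less_iff_conj)
  have "eventually (\<lambda>n. D n < \<delta>) sequentially"
    using order_tendstoD(2)[OF D(1) \<delta>(1)] .
  moreover have "eventually (\<lambda>n. \<forall>s t. 0 \<le> s \<longrightarrow> t - s = D n \<longrightarrow> step_possible {x<..<d / 2} d s t) sequentially"
    by (rule eventually_step_event[OF trip d(1) x(2) _ _ _ x(3) D]) (use x d in \<open>auto intro: order_less_le_trans\<close>)
  moreover have "eventually (\<lambda>n. \<forall>s t. 0 \<le> s \<longrightarrow> t - s = D n \<longrightarrow> step_possible {-(d / 2)<..<-x'} d s t) sequentially"
    by (rule eventually_step_event[OF trip d(1) _ _ _ _ x'(3) D]) (use x' d in auto)
  ultimately have "eventually (\<lambda>n. D n < \<delta> \<and>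
     (\<forall>s t. 0 \<le> s \<longrightarrow> t - s = D n \<longrightarrow> step_possible {x<..<d / 2} d s t) \<and>
     (\<forall>s t. 0 \<le> s \<longrightarrow> t - s = D n \<longrightarrow> step_possible {-(d / 2)<..<-x'} d s t)) sequentially"
    by (intro eventually_conj)
  from eventually_happens'[OF sequentially_bot this]
  obtain n where n: "D n < \<delta>"
    and up: "\<And>s t. 0 \<le> s \<Longrightarrow> t - s = D n \<Longrightarrow> step_possible {x<..<d / 2} d s t"
    and down: "\<And>s t. 0 \<le> s \<Longrightarrow> t - s = D n \<Longrightarrow> step_possible {-(d / 2)<..<-x'} d s t"
    by blast
  let ?p = "grid s t n"
  have pm: "?p i \<in> {s..t}" if "i \<le> Suc n" for i
    using grid_mem[of s t i n] s that by auto
  have pS: "?p (Suc i) - ?p i = D n" for i by (simp add: grid_Suc D_def)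
  have "\<exists>E\<in>sets (increments {s..?p i}). 0 < prob E \<and>
     (\<forall>\<omega>\<in>E. \<bar>L (?p i) \<omega> - L s \<omega> - l (?p i)\<bar> \<le> 2 * d \<and> (\<forall>r\<in>{s..?p i}. \<bar>L r \<omega> - L s \<omega> - l r\<bar> \<le> 4 * d))"
    if "i \<le> Suc n" for i
    using that
  proof (induction i)
    case 0
    show ?case
      using d l(2) sets.top[of "increments {s..s}"] prob_space by (intro bexI[of _ "space M"]) auto
  next
    case (Suc i)
    let ?u = "?p i" and ?v = "?p (Suc i)"
    have uv: "s \<le> ?u" "?u < ?v" "?v \<le> t" "0 \<le> ?u"
      using pm[of i] pm[of "Suc i"] Suc.prems grid_less[OF s(2), of i "Suc i" n] s by auto
    obtain E where E: "E \<in> sets (increments {s..?u})" "0 < prob E"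
      and track: "\<And>\<omega>. \<omega> \<in> E \<Longrightarrow> \<bar>L ?u \<omega> - L s \<omega> - l ?u\<bar> \<le> 2 * d"
        "\<And>\<omega> r. \<omega> \<in> E \<Longrightarrow> r \<in> {s..?u} \<Longrightarrow> \<bar>L r \<omega> - L s \<omega> - l r\<bar> \<le> 4 * d"
      using Suc.IH Suc.prems by (auto simp: Ball_def)
    let ?lo = "{\<omega>\<in>space M. L ?u \<omega> - L s \<omega> \<in> {..l ?u}}" and ?hi = "{\<omega>\<in>space M. L ?u \<omega> - L s \<omega> \<in> {l ?u<..}}"
    have side: "?lo \<in> sets (increments {s..?u})" "?hi \<in> sets (increments {s..?u})"
      using uv(1) by (intro increments_event; simp)+
    have Esp: "E \<subseteq> space M" using sets.sets_into_space[OF E(1)] by simp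
    have combine: ?case
      if A: "A \<in> sets (increments {s..?u})" "A \<subseteq> E" "0 < prob A"
        and S: "S \<in> sets (increments {?u..?v})" "0 < prob S"
        and small: "\<And>\<omega> r. \<omega> \<in> S \<Longrightarrow> r \<in> {?u..?v} \<Longrightarrow> \<bar>L r \<omega> - L ?u \<omega>\<bar> \<le> d"
        and next_ok: "\<And>\<omega>. \<omega> \<in> A \<inter> S \<Longrightarrow> \<bar>L ?v \<omega> - L s \<omega> - l ?v\<bar> \<le> 2 * d" for A S
    proof (intro bexI[of _ "A \<inter> S"] conjI ballI)
      have "prob (A \<inter> S) = prob A * prob S"
        using A(1) S(1) sets_increments_mono[of "{s..?u}" "{..?u}"] sets_increments_mono[of "{?u..?v}" "{?u..}"]
        by (intro indep_past_future[of _ ?u]) auto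
      then show "0 < prob (A \<inter> S)" using A S by simp
      show "A \<inter> S \<in> sets (increments {s..?v})"
        using A(1) S(1) sets_increments_mono[of "{s..?u}" "{s..?v}"] sets_increments_mono[of "{?u..?v}" "{s..?v}"] uv
        by (intro sets.Int) auto
      fix \<omega> assume w: "\<omega> \<in> A \<inter> S"
      show "\<bar>L ?v \<omega> - L s \<omega> - l ?v\<bar> \<le> 2 * d" by (rule next_ok[OF w])
      fix r assume r: "r \<in> {s..?v}"
      show "\<bar>L r \<omega> - L s \<omega> - l r\<bar> \<le> 4 * d"
      proof (cases "r \<le> ?u")
        case True
        then show ?thesis using track(2)[of \<omega> r] w r A(2) by auto
      next
        case False
        then have "\<bar>l r - l ?u\<bar> < min x x'"
          using r uv n pS[of i] by (intro \<delta>(2)) auto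
        moreover have "\<bar>L r \<omega> - L ?u \<omega>\<bar> \<le> d" using small[of \<omega> r] w r False by auto
        moreover have "\<bar>L ?u \<omega> - L s \<omega> - l ?u\<bar> \<le> 2 * d" using track(1) w A(2) by auto
        \<comment> \<open>At most 2 d from the last grid time, d from the path and d / 2 from the
          target.\<close>
        ultimately show ?thesis using x(2) by linarith
      qed
    qed
    have osc: "\<bar>l ?v - l ?u\<bar> < min x x'"
      using uv n pS[of i] by (intro \<delta>(2)) auto
    have ev: "E \<in> events" "?lo \<in> events" "?hi \<in> events"
      using E side sets_increments_events by blast+
    have "prob E \<le> prob ((E \<inter> ?lo) \<union> (E \<inter> ?hi))"
      using Esp ev by (intro finite_measure_mono) auto
    also have "\<dots> \<le> prob (E \<inter> ?lo) + prob (E \<inter> ?hi)"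
      using ev by (intro measure_Un_le) auto
    finally have "0 < prob (E \<inter> ?lo) \<or> 0 < prob (E \<inter> ?hi)" using E(2) by linarith
    then show ?case
    proof
      assume pos: "0 < prob (E \<inter> ?lo)"
      obtain S where S: "S \<in> sets (increments {?u..?v})" "0 < prob S"
        "\<And>\<omega>. \<omega> \<in> S \<Longrightarrow> L ?v \<omega> - L ?u \<omega> \<in> {x<..<d / 2}" "\<And>\<omega> r. \<omega> \<in> S \<Longrightarrow> r \<in> {?u..?v} \<Longrightarrow> \<bar>L r \<omega> - L ?u \<omega>\<bar> \<le> d"
        using up[OF uv(4) pS] unfolding step_possible_def by blast
      show ?case
      proof (rule combine[OF _ _ pos S(1,2) S(4)])
        show "E \<inter> ?lo \<in> sets (increments {s..?u})" using E(1) side(1) by (rule sets.Int)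
        fix \<omega> assume w: "\<omega> \<in> E \<inter> ?lo \<inter> S"
        \<comment> \<open>A jump in (x, d / 2) against a target move below x changes the error by an
          amount in (0, d), so an error in [-2 d, 0] ends in [-2 d, d].\<close>
        then show "\<bar>L ?v \<omega> - L s \<omega> - l ?v\<bar> \<le> 2 * d"
          using S(3)[of \<omega>] track(1)[of \<omega>] osc x(2) d(1) by (auto simp: abs_le_iff abs_less_iff)
      qed auto
    next
      assume pos: "0 < prob (E \<inter> ?hi)"
      obtain S where S: "S \<in> sets (increments {?u..?v})" "0 < prob S"
        "\<And>\<omega>. \<omega> \<in> S \<Longrightarrow> L ?v \<omega> - L ?u \<omega> \<in> {-(d / 2)<..<-x'}" "\<And>\<omega> r. \<omega> \<in> S \<Longrightarrow> r \<in> {?u..?v} \<Longrightarrow> \<bar>L r \<omega> - L ?u \<omega>\<bar> \<le> d"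
        using down[OF uv(4) pS] unfolding step_possible_def by blast
      show ?case
      proof (rule combine[OF _ _ pos S(1,2) S(4)])
        show "E \<inter> ?hi \<in> sets (increments {s..?u})" using E(1) side(2) by (rule sets.Int)
        fix \<omega> assume w: "\<omega> \<in> E \<inter> ?hi \<inter> S"
        then show "\<bar>L ?v \<omega> - L s \<omega> - l ?v\<bar> \<le> 2 * d"
          using S(3)[of \<omega>] track(1)[of \<omega>] osc x'(2) d(1) by (auto simp: abs_le_iff abs_less_iff)
      qed auto
    qed
  qed
  from this[of "Suc n"] show ?thesis
    using d(2) order_trans by (auto simp: Ball_def) blast
qed

end

section \<open>Density of the range of the Riemann--Liouville integral\<close>

text \<open>The substitution u = (r - s) / (t - s) reduces the claim to the Beta integral; the
  powers of t - s come from the two factors and from dr.\<close>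

lemma has_bochner_integral_rl_powr:
  assumes a: "0 < a" and b: "0 < b" and st: "s \<le> t"
  shows "has_bochner_integral lborel (\<lambda>r. rl_kernel a s t r * (r - s) powr b) (a * Beta (b + 1) a * (t - s) powr (a + b))"
proof (cases "s = t")
  case True
  have "(\<lambda>r. rl_kernel a s t r * (r - s) powr b) = (\<lambda>_. 0)"
    using True by (auto simp: rl_kernel_def)
  then show ?thesis using True by (simp add: has_bochner_integral_zero)
next
  case False
  define h where "h = t - s"
  have h: "0 < h" using False st by (simp add: h_def)
  let ?f = "\<lambda>u. indicator {0<..<1} u * (u powr b * (1 - u) powr (a - 1))"
  have "((\<lambda>u. u powr (b + 1 - 1) * (1 - u) powr (a - 1)) has_integral Beta (b + 1) a) {0..1}"
    using a b by (intro has_integral_Beta_real) auto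
  then have "has_bochner_integral lborel ?f (Beta (b + 1) a)"
    by (intro has_bochner_integral_nonneg_Ioo) auto
  then have "has_bochner_integral lborel (\<lambda>r. ?f (- s / h + (1 / h) * r)) (Beta (b + 1) a /\<^sub>R \<bar>1 / h\<bar>)"
    using h by (subst (asm) lborel_has_bochner_integral_real_affine_iff[of "1 / h" _ _ "- s / h"]) auto
  from has_bochner_integral_mult_right[OF this, of "a * h powr (a + b - 1)"]
  have scaled: "has_bochner_integral lborel (\<lambda>r. a * h powr (a + b - 1) * ?f (- s / h + (1 / h) * r))
      (a * h powr (a + b - 1) * (Beta (b + 1) a /\<^sub>R \<bar>1 / h\<bar>))" .
  have total: "a * h powr (a + b - 1) * (Beta (b + 1) a /\<^sub>R \<bar>1 / h\<bar>) = a * Beta (b + 1) a * (t - s) powr (a + b)"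
  proof -
    have "h powr (a + b) = h powr (a + b - 1) * h powr 1"
      unfolding powr_add[symmetric] by simp
    then show ?thesis using h by (simp add: h_def[symmetric])
  qed
  have integrand: "a * h powr (a + b - 1) * ?f (- s / h + (1 / h) * r) = rl_kernel a s t r * (r - s) powr b" for r
  proof (cases "r \<in> {s<..<t}")
    case True
    have "1 - (r - s) / h = (h - (r - s)) / h"
      using h by (simp add: diff_divide_distrib)
    moreover have "h - (r - s) = t - r" by (simp add: h_def)
    ultimately have u: "- s / h + (1 / h) * r = (r - s) / h" "1 - (r - s) / h = (t - r) / h"
      by (simp_all add: diff_divide_distrib)
    have in01: "(r - s) / h \<in> {0<..<1}"
      using True h by (simp add: h_def)
    have "h powr (a + b - 1) = h powr b * h powr (a - 1)"
      unfolding powr_add[symmetric] by (simp add: algebra_simps)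
    then show ?thesis
      unfolding u using in01 True h by (simp add: u powr_divide rl_kernel_def)
  next
    case False
    have "- s / h + (1 / h) * r = (r - s) / h"
      by (simp add: diff_divide_distrib)
    moreover have "(r - s) / h \<notin> {0<..<1}"
      using False h by (auto simp: h_def pos_less_divide_eq pos_divide_less_eq)
    ultimately show ?thesis using False by (simp add: rl_kernel_def)
  qed
  show ?thesis
    using scaled unfolding total integrand .
qed

text \<open>Rational coefficients make the family countable, and without a constant term every
  member vanishes at \<open>s\<close>, as increments from \<open>s\<close> do.\<close>

definition rat_poly :: "real \<Rightarrow> rat list \<Rightarrow> real \<Rightarrow> real" where
  "rat_poly s q t = (\<Sum>i<length q. of_rat (q ! i) * (t - s) ^ Suc i)"

text \<open>By the Beta integral the order-\<open>a\<close> integral of \<open>(r - s) powr (k - a)\<close> is a multiple of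
  \<open>(t - s) ^ k\<close>; this path is the resulting preimage of \<open>rat_poly s q\<close>.\<close>

definition rat_poly_preimage :: "real \<Rightarrow> real \<Rightarrow> real \<Rightarrow> rat list \<Rightarrow> real \<Rightarrow> real" where
  "rat_poly_preimage C a s q r =
    (\<Sum>i<length q. of_rat (q ! i) / (C * (a * Beta (real (Suc i) - a + 1) a)) * (r - s) powr (real (Suc i) - a))"

lemma rl_integral_rat_poly_preimage:
  assumes a: "0 < a" "a < 1" and C: "0 < C" and st: "s \<le> t"
  shows "C * rl_integral a s (rat_poly_preimage C a s q) t = rat_poly s q t"
    and "integrable lborel (\<lambda>r. rl_kernel a s t r * rat_poly_preimage C a s q r)"
proof -
  let ?B = "\<lambda>i. a * Beta (real (Suc i) - a + 1) a"
  let ?c = "\<lambda>i. of_rat (q ! i) / (C * ?B i) :: real"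
  have B: "0 < ?B i" for i
    using a by (simp add: Beta_def Gamma_real_pos)
  have "has_bochner_integral lborel (\<lambda>r. \<Sum>i<length q. ?c i * (rl_kernel a s t r * (r - s) powr (real (Suc i) - a)))
    (\<Sum>i<length q. ?c i * (?B i * (t - s) powr (a + (real (Suc i) - a))))"
    using a st by (intro has_bochner_integral_sum has_bochner_integral_mult_right has_bochner_integral_rl_powr) auto
  moreover have "(\<lambda>r. \<Sum>i<length q. ?c i * (rl_kernel a s t r * (r - s) powr (real (Suc i) - a))) =
      (\<lambda>r. rl_kernel a s t r * rat_poly_preimage C a s q r)"
    by (simp add: rat_poly_preimage_def sum_distrib_left mult_ac)
  ultimately have h: "has_bochner_integral lborel (\<lambda>r. rl_kernel a s t r * rat_poly_preimage C a s q r)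
    (\<Sum>i<length q. ?c i * (?B i * (t - s) powr (a + (real (Suc i) - a))))" by simp
  then show "integrable lborel (\<lambda>r. rl_kernel a s t r * rat_poly_preimage C a s q r)"
    by (simp add: has_bochner_integral_iff)
  have "C * (?c i * (?B i * (t - s) powr (a + (real (Suc i) - a)))) = of_rat (q ! i) * (t - s) ^ Suc i" for i
  proof -
    have "(t - s) powr (a + (real (Suc i) - a)) = (t - s) powr real (Suc i)" by simp
    also have "\<dots> = (t - s) ^ Suc i"
      using st by (cases "s = t") (simp_all add: powr_realpow del: of_nat_Suc)
    finally have pow: "(t - s) powr (a + (real (Suc i) - a)) = (t - s) ^ Suc i" .
    have "C * (z / (C * B') * (B' * y)) = z * y" if "0 < B'" for z y B' :: real
      using C that by simp
    from this[OF B] show ?thesis unfolding pow .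
  qed
  then show "C * rl_integral a s (rat_poly_preimage C a s q) t = rat_poly s q t"
    using h by (simp add: rl_integral_def has_bochner_integral_iff rat_poly_def sum_distrib_left)
qed

text \<open>The smallest exponent is 1 - a, which is positive, so the powers are continuous at
  \<open>s\<close> as well.\<close>

lemma rat_poly_preimage_continuous:
  assumes "a < 1"
  shows "continuous_on {s..t} (rat_poly_preimage C a s q)"
  unfolding rat_poly_preimage_def[abs_def] using assms
  by (intro continuous_on_sum continuous_on_mult continuous_on_const continuous_on_powr' continuous_on_diff continuous_on_id)
    auto

lemma rat_poly_preimage_start: "rat_poly_preimage C a s q s = 0"
  by (simp add: rat_poly_preimage_def)

text \<open>Weierstrass gives a real polynomial; its constant term is small because f vanishes at s,
  and the other coefficients are replaced by nearby rationals.\<close>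

lemma rat_poly_dense:
  assumes st: "s \<le> t" and f: "continuous_on {s..t} f" "f s = 0" and e: "0 < e"
  shows "\<exists>q. \<forall>r\<in>{s..t}. \<bar>f r - rat_poly s q r\<bar> \<le> e"
proof -
  have "continuous_on {0..t - s} (\<lambda>x. f (s + x))"
    by (rule continuous_on_compose2[OF f(1)]) (auto intro!: continuous_intros)
  then obtain g where g: "real_polynomial_function g" "\<And>x. x \<in> {0..t - s} \<Longrightarrow> \<bar>f (s + x) - g x\<bar> < e / 4"
    using Stone_Weierstrass_real_polynomial_function[of "{0..t - s}" "\<lambda>x. f (s + x)" "e / 4"] e by auto
  obtain c n where c: "g = (\<lambda>x. \<Sum>i\<le>n. c i * x ^ i)"
    using g(1) real_polynomial_function_iff_sum by blast
  \<comment> \<open>\<open>W\<close> bounds the effect of changing every coefficient by 1. The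
    errors are e / 4 for Weierstrass, e / 4 for the constant term and e / 2 for the
    coefficients.\<close>
  define W where "W = (\<Sum>i<n. (t - s) ^ Suc i)"
  have W: "0 \<le> W" unfolding W_def using st by (intro sum_nonneg) auto
  define d where "d = e / 2 / (W + 1)"
  have d: "0 < d" using e W by (simp add: d_def)
  have dW: "d * W \<le> e / 2"
  proof -
    have "d * W \<le> d * (W + 1)" using d by simp
    also have "\<dots> = e / 2"
      using nonzero_eq_divide_eq[of "W + 1" d "e / 2"] W by (simp add: d_def)
    finally show ?thesis .
  qed
  have "\<exists>q. \<bar>c (Suc i) - of_rat q\<bar> \<le> d" for i
  proof -
    obtain q where "c (Suc i) - d < of_rat q" "of_rat q < c (Suc i) + d"
      using of_rat_dense[of "c (Suc i) - d" "c (Suc i) + d"] d by auto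
    then show ?thesis by (intro exI[of _ q]) (simp add: abs_le_iff)
  qed
  then obtain q where q: "\<And>i. \<bar>c (Suc i) - of_rat (q i)\<bar> \<le> d" by metis
  have "\<bar>f r - rat_poly s (map q [0..<n]) r\<bar> \<le> e" if r: "r \<in> {s..t}" for r
  proof -
    have x: "r - s \<in> {0..t - s}" "0 \<in> {0..t - s}" using r by auto
    have "\<bar>f r - g (r - s)\<bar> < e / 4" using g(2)[OF x(1)] by simp
    moreover have "\<bar>c 0\<bar> < e / 4"
    proof -
      have "g 0 = c 0" unfolding c by (subst sum.remove[of _ 0]) (auto intro!: sum.neutral)
      then show ?thesis using g(2)[OF x(2)] f(2) by simp
    qed
    moreover have "g (r - s) = c 0 + (\<Sum>i<n. c (Suc i) * (r - s) ^ Suc i)"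
      unfolding c by (subst sum.atMost_shift) simp
    moreover have "\<bar>(\<Sum>i<n. c (Suc i) * (r - s) ^ Suc i) - rat_poly s (map q [0..<n]) r\<bar> \<le> d * W"
    proof -
      have "\<bar>(\<Sum>i<n. c (Suc i) * (r - s) ^ Suc i) - rat_poly s (map q [0..<n]) r\<bar>
        = \<bar>\<Sum>i<n. (c (Suc i) - of_rat (q i)) * (r - s) ^ Suc i\<bar>"
        by (simp add: rat_poly_def sum_subtractf[symmetric] left_diff_distrib)
      also have "\<dots> \<le> (\<Sum>i<n. \<bar>(c (Suc i) - of_rat (q i)) * (r - s) ^ Suc i\<bar>)" by (rule sum_abs)
      also have "\<dots> \<le> (\<Sum>i<n. d * (t - s) ^ Suc i)"
      proof (rule sum_mono)
        fix i
        have "\<bar>(r - s) ^ Suc i\<bar> \<le> (t - s) ^ Suc i"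
          using r by (simp only: power_abs) (intro power_mono, auto)
        then show "\<bar>(c (Suc i) - of_rat (q i)) * (r - s) ^ Suc i\<bar> \<le> d * (t - s) ^ Suc i"
          unfolding abs_mult[of "_ - _"] using q[of i] d by (intro mult_mono) auto
      qed
      also have "\<dots> = d * W" by (simp add: W_def sum_distrib_left)
      finally show ?thesis .
    qed
    ultimately show ?thesis using dW by linarith
  qed
  then show ?thesis by blast
qed

section \<open>Approximating polynomials by the pathwise integral\<close>

context centered_levy
begin

text \<open>The pathwise integral has norm at most \<open>c\<close> for the supremum norm, so it
  suffices that the path follows the preimage of the polynomial within e / c.\<close>

lemma rl_integral_support:
  assumes trip: "characteristic_triplet M L b 0 \<Lambda>"
    and jumps: "\<And>\<epsilon>::real. \<epsilon> > 0 \<Longrightarrow> emeasure \<Lambda> {-\<epsilon><..<0} > 0 \<and> emeasure \<Lambda> {0<..<\<epsilon>} > 0"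
    and a: "0 < a" "a < 1" and C: "0 < C" and s: "0 \<le> s" "s < t" and e: "0 < e"
  shows "\<exists>E\<in>sets (increments {s..t}). 0 < prob E \<and>
    (\<forall>\<omega>\<in>E. \<forall>r\<in>{s..t}. \<bar>C * rl_integral a s (\<lambda>u. L u \<omega> - L s \<omega>) r - rat_poly s q r\<bar> \<le> e)"
proof -
  let ?l = "rat_poly_preimage C a s q"
  define c where "c = C * (t - s) powr a"
  define d where "d = e / c"
  have c: "0 < c" using C s by (simp add: c_def)
  have d: "0 < d" using e c by (simp add: d_def)
  have "c * d = e" using c by (simp add: d_def)
  then have de: "C * (d * (t - s) powr a) = e" by (simp add: c_def mult_ac)
  obtain E where E: "E \<in> sets (increments {s..t})" "0 < prob E"
    and close: "\<And>\<omega> r. \<omega> \<in> E \<Longrightarrow> r \<in> {s..t} \<Longrightarrow> \<bar>L r \<omega> - L s \<omega> - ?l r\<bar> \<le> d"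
    using path_support[where l="?l", OF trip jumps s rat_poly_preimage_continuous[OF a(2)] rat_poly_preimage_start d] by blast
  have "\<bar>C * rl_integral a s (\<lambda>u. L u \<omega> - L s \<omega>) r - rat_poly s q r\<bar> \<le> e" if w: "\<omega> \<in> E" and r: "r \<in> {s..t}" for \<omega> r
  proof -
    have sp: "\<omega> \<in> space M" using w sets.sets_into_space[OF E(1)] by auto
    have m: "(\<lambda>u. indicator {s<..} u * (L u \<omega> - L s \<omega>)) \<in> borel_measurable borel"
      by (rule increment_path_measurable[OF sp s(1)])
    obtain K where K: "\<And>u. u \<in> {s..r} \<Longrightarrow> \<bar>L u \<omega> - L s \<omega>\<bar> \<le> K"
      using increment_path_bounded[OF sp s(1)] by blast
    have i: "integrable lborel (\<lambda>u. rl_kernel a s r u * (L u \<omega> - L s \<omega>))"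
      using a r K by (intro rl_integrand_integrable[OF _ _ m, of _ _ K]) auto
    note p = rl_integral_rat_poly_preimage[OF a C, of s r q]
    have "rl_integral a s (\<lambda>u. L u \<omega> - L s \<omega>) r - rl_integral a s ?l r = rl_integral a s (\<lambda>u. L u \<omega> - L s \<omega> - ?l u) r"
      unfolding rl_integral_def using i p(2) r by (simp add: right_diff_distrib)
    moreover have "\<bar>rl_integral a s (\<lambda>u. L u \<omega> - L s \<omega> - ?l u) r\<bar> \<le> d * (r - s) powr a"
    proof (rule rl_integral_bound)
      have "?l \<in> borel_measurable borel"
        unfolding rat_poly_preimage_def[abs_def] by measurable
      then have "(\<lambda>u. indicator {s<..} u * (L u \<omega> - L s \<omega>) - indicator {s<..} u * ?l u) \<in> borel_measurable borel"
        using m by measurable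
      then show "(\<lambda>u. indicator {s<..} u * (L u \<omega> - L s \<omega> - ?l u)) \<in> borel_measurable borel"
        by (simp add: right_diff_distrib)
      show "\<bar>L u \<omega> - L s \<omega> - ?l u\<bar> \<le> d" if "u \<in> {s<..<r}" for u
        using close[OF w, of u] that r by auto
    qed (use a r in auto)
    moreover have "d * (r - s) powr a \<le> d * (t - s) powr a"
      using d a r by (intro mult_left_mono powr_mono2) auto
    ultimately have "\<bar>rl_integral a s (\<lambda>u. L u \<omega> - L s \<omega>) r - rl_integral a s ?l r\<bar> \<le> d * (t - s) powr a"
      by linarith
    then have "\<bar>C * (rl_integral a s (\<lambda>u. L u \<omega> - L s \<omega>) r - rl_integral a s ?l r)\<bar> \<le> C * (d * (t - s) powr a)"
      using C by (simp add: abs_mult)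
    then show ?thesis
      using p(1) r de by (simp add: right_diff_distrib)
  qed
  then show ?thesis using E by blast
qed

lemma rl_integral_path_continuous:
  assumes "\<omega> \<in> space M" "0 < a" "a \<le> 1" "0 \<le> s"
  shows "continuous_on {s..t} (rl_integral a s (\<lambda>u. L u \<omega> - L s \<omega>))"
proof -
  obtain K where K: "\<And>u. u \<in> {s..t} \<Longrightarrow> \<bar>L u \<omega> - L s \<omega>\<bar> \<le> K"
    using increment_path_bounded[OF assms(1,4)] by blast
  show ?thesis
    by (rule continuous_on_rl_integral[OF assms(2,3) increment_path_measurable[OF assms(1,4)], of _ K]) (use K in auto)
qed

end

section \<open>Conditional full support\<close>

definition rat_below :: "real \<Rightarrow> nat \<Rightarrow> rat" where
  "rat_below t k = of_int \<lfloor>t * real (Suc k)\<rfloor> / of_nat (Suc k)"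

lemma rat_below_bounds:
  "of_rat (rat_below t k) \<le> t" "t - inverse (real (Suc k)) \<le> of_rat (rat_below t k)"
  "0 \<le> t \<Longrightarrow> 0 \<le> rat_below t k"
proof -
  define d where "d = real (Suc k)"
  have d: "0 < d" by (simp add: d_def)
  have r: "of_rat (rat_below t k) = real_of_int \<lfloor>t * d\<rfloor> / d"
    by (simp add: rat_below_def of_rat_divide d_def del: of_nat_Suc)
  have "real_of_int \<lfloor>t * d\<rfloor> \<le> t * d" "t * d - 1 \<le> real_of_int \<lfloor>t * d\<rfloor>" by linarith+
  moreover have "(t - inverse d) * d = t * d - 1" using d by (simp add: left_diff_distrib)
  ultimately show "of_rat (rat_below t k) \<le> t" "t - inverse (real (Suc k)) \<le> of_rat (rat_below t k)"
    unfolding r d_def[symmetric] using d by (simp_all add: pos_divide_le_eq pos_le_divide_eq)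
  show "0 \<le> rat_below t k" if "0 \<le> t"
  proof -
    have "0 \<le> \<lfloor>t * real (Suc k)\<rfloor>" using that by (simp only: zero_le_floor) simp
    then show ?thesis unfolding rat_below_def by (intro divide_nonneg_nonneg) auto
  qed
qed

lemma rat_below_tendsto: "(\<lambda>k. real_of_rat (rat_below t k)) \<longlonglongrightarrow> t"
proof -
  have "(\<lambda>k. t - inverse (real (Suc k))) \<longlonglongrightarrow> t - 0"
    by (intro tendsto_diff tendsto_const LIMSEQ_inverse_real_of_nat)
  then have "(\<lambda>k. t - inverse (real (Suc k))) \<longlonglongrightarrow> t" by simp
  then show ?thesis
    by (rule tendsto_sandwich[OF always_eventually always_eventually _ tendsto_const, rotated 2])
      (intro allI rat_below_bounds)+
qed

text \<open>Continuous extendability of a function on the nonnegative rationals, expressed by countably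
  many conditions.\<close>

definition rat_uniform :: "(rat \<Rightarrow> real) \<Rightarrow> bool" where
  "rat_uniform f \<longleftrightarrow> (\<forall>n k::nat. \<exists>m::nat. \<forall>p q::rat.
     0 \<le> p \<and> 0 \<le> q \<and> real_of_rat p \<le> real n \<and> real_of_rat q \<le> real n \<and>
     \<bar>real_of_rat p - real_of_rat q\<bar> < inverse (real (Suc m)) \<longrightarrow> \<bar>f p - f q\<bar> \<le> inverse (real (Suc k)))"

lemma rat_uniform_of_continuous:
  assumes g: "\<And>n. continuous_on {0..real n} g" and f: "\<And>q. 0 \<le> q \<Longrightarrow> f q = g (real_of_rat q)"
  shows "rat_uniform f"
  unfolding rat_uniform_def
proof (intro allI)
  fix n k :: nat
  have "uniformly_continuous_on {0..real n} g"
    by (intro compact_uniformly_continuous g) auto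
  then obtain d where d: "0 < d" "\<And>x y. x \<in> {0..real n} \<Longrightarrow> y \<in> {0..real n} \<Longrightarrow> \<bar>y - x\<bar> < d \<Longrightarrow> \<bar>g y - g x\<bar> < inverse (real (Suc k))"
    unfolding uniformly_continuous_on_def dist_real_def
    by (metis inverse_positive_iff_positive of_nat_0_less_iff zero_less_Suc)
  obtain m where m: "inverse (real (Suc m)) < d"
    using reals_Archimedean[OF d(1)] by blast
  have "\<bar>f p - f q\<bar> \<le> inverse (real (Suc k))"
    if "0 \<le> p \<and> 0 \<le> q \<and> real_of_rat p \<le> real n \<and> real_of_rat q \<le> real n \<and> \<bar>real_of_rat p - real_of_rat q\<bar> < inverse (real (Suc m))"
    for p q
    using d(2)[of "real_of_rat q" "real_of_rat p"] that m f by (simp add: less_imp_le del: of_nat_Suc)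
  then show "\<exists>m::nat. \<forall>p q::rat. 0 \<le> p \<and> 0 \<le> q \<and> real_of_rat p \<le> real n \<and> real_of_rat q \<le> real n \<and>
     \<bar>real_of_rat p - real_of_rat q\<bar> < inverse (real (Suc m)) \<longrightarrow> \<bar>f p - f q\<bar> \<le> inverse (real (Suc k))"
    by blast
qed

text \<open>For t \<ge> 0, \<open>rat_below t\<close> runs through rationals in [0, t] tending to t;
  uniform continuity makes the values along it a Cauchy sequence and passes to the limit.\<close>

lemma rat_uniform_extension:
  assumes f: "rat_uniform f"
  shows "continuous_on {0..} (\<lambda>t. lim (\<lambda>k. f (rat_below t k)))"
proof -
  define g where "g t = lim (\<lambda>k. f (rat_below t k))" for t
  have close: "eventually (\<lambda>j. \<bar>real_of_rat (rat_below t j) - real_of_rat (rat_below t' j)\<bar> < d) sequentially"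
    if "\<bar>t - t'\<bar> < d" for t t' d
  proof -
    have "(\<lambda>j. \<bar>real_of_rat (rat_below t j) - real_of_rat (rat_below t' j)\<bar>) \<longlonglongrightarrow> \<bar>t - t'\<bar>"
      by (intro tendsto_intros rat_below_tendsto)
    from order_tendstoD(2)[OF this that] show ?thesis .
  qed
  have lim: "(\<lambda>k. f (rat_below t k)) \<longlonglongrightarrow> g t" if t: "0 \<le> t" for t
  proof -
    have "Cauchy (\<lambda>k. f (rat_below t k))"
    proof (rule metric_CauchyI)
      fix e :: real assume "0 < e"
      then obtain k where k: "inverse (real (Suc k)) < e" using reals_Archimedean by blast
      obtain n where n: "t \<le> real n" using real_arch_simple by blast
      obtain m where m: "\<And>p q. 0 \<le> p \<and> 0 \<le> q \<and> real_of_rat p \<le> real n \<and> real_of_rat q \<le> real n \<and>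
        \<bar>real_of_rat p - real_of_rat q\<bar> < inverse (real (Suc m)) \<Longrightarrow> \<bar>f p - f q\<bar> \<le> inverse (real (Suc k))"
        using f unfolding rat_uniform_def by blast
      have "Cauchy (\<lambda>k. real_of_rat (rat_below t k))"
        using rat_below_tendsto LIMSEQ_imp_Cauchy by blast
      moreover have "0 < inverse (real (Suc m))" by simp
      ultimately obtain j where j: "\<And>i i'. j \<le> i \<Longrightarrow> j \<le> i' \<Longrightarrow>
          \<bar>real_of_rat (rat_below t i) - real_of_rat (rat_below t i')\<bar> < inverse (real (Suc m))"
        unfolding Cauchy_def dist_real_def by blast
      have "dist (f (rat_below t i)) (f (rat_below t i')) < e" if "j \<le> i" "j \<le> i'" for i i'
      proof -
        have "\<bar>f (rat_below t i) - f (rat_below t i')\<bar> \<le> inverse (real (Suc k))"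
          using j[OF that] rat_below_bounds(1)[of t i] rat_below_bounds(1)[of t i'] rat_below_bounds(3)[OF t] n
          by (intro m) (auto intro: order_trans)
        then show ?thesis using k by (simp add: dist_real_def)
      qed
      then show "\<exists>M. \<forall>m\<ge>M. \<forall>n\<ge>M. dist (f (rat_below t m)) (f (rat_below t n)) < e" by blast
    qed
    then have "convergent (\<lambda>k. f (rat_below t k))" by (rule Cauchy_convergent)
    then show ?thesis unfolding g_def convergent_LIMSEQ_iff .
  qed
  have "continuous_on {0..} g"
    unfolding continuous_on_iff
  proof (intro ballI allI impI)
    fix t e :: real assume t: "t \<in> {0..}" and "0 < e"
    then obtain k where k: "inverse (real (Suc k)) < e" using reals_Archimedean by blast
    \<comment> \<open>Neighbours of t are taken within distance 1 / (m + 1) \<le> 1, so they and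
      their rational approximations stay below n.\<close>
    obtain n where n: "t + 1 \<le> real n" using real_arch_simple by blast
    obtain m where m: "\<And>p q. 0 \<le> p \<and> 0 \<le> q \<and> real_of_rat p \<le> real n \<and> real_of_rat q \<le> real n \<and>
      \<bar>real_of_rat p - real_of_rat q\<bar> < inverse (real (Suc m)) \<Longrightarrow> \<bar>f p - f q\<bar> \<le> inverse (real (Suc k))"
      using f unfolding rat_uniform_def by blast
    have m1: "inverse (real (Suc m)) \<le> 1" by (simp add: inverse_le_1_iff)
    have "dist (g t') (g t) < e" if t': "t' \<in> {0..}" "dist t' t < inverse (real (Suc m))" for t'
    proof -
      have "t' \<le> real n" using t' m1 n by (simp add: dist_real_def abs_less_iff)
      then have n': "real_of_rat (rat_below t j) \<le> real n" "real_of_rat (rat_below t' j) \<le> real n" for j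
        using rat_below_bounds(1)[of t j] rat_below_bounds(1)[of t' j] n by linarith+
      have "\<bar>t' - t\<bar> < inverse (real (Suc m))" using t' by (simp add: dist_real_def)
      from close[OF this]
      have "eventually (\<lambda>j. \<bar>f (rat_below t' j) - f (rat_below t j)\<bar> \<le> inverse (real (Suc k))) sequentially"
      proof eventually_elim
        case (elim j)
        then show ?case
          using n' rat_below_bounds(3)[of t j] rat_below_bounds(3)[of t' j] t t' by (intro m) auto
      qed
      moreover have "(\<lambda>j. \<bar>f (rat_below t' j) - f (rat_below t j)\<bar>) \<longlonglongrightarrow> \<bar>g t' - g t\<bar>"
        using t t' by (intro tendsto_intros lim) auto
      ultimately have "\<bar>g t' - g t\<bar> \<le> inverse (real (Suc k))"
        by (intro tendsto_upperbound) auto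
      then show ?thesis using k by (simp add: dist_real_def)
    qed
    then show "\<exists>d>0. \<forall>x'\<in>{0..}. dist x' t < d \<longrightarrow> dist (g x') (g t) < e"
      by (intro exI[of _ "inverse (real (Suc m))"]) auto
  qed
  then show ?thesis by (simp add: g_def[abs_def])
qed

text \<open>\<open>s\<close> is added because increments are measured from \<open>s\<close>, which
  may be irrational. All later times are reached from the left by continuity.\<close>

definition dense_times :: "real \<Rightarrow> real \<Rightarrow> real set" where
  "dense_times s t = insert s (\<rat> \<inter> {s..t})"

lemma countable_dense_times: "countable (dense_times s t)"
  by (simp add: dense_times_def countable_rat countable_Int1)

lemma dense_times_bound:
  fixes h :: "real \<Rightarrow> real"
  assumes h: "continuous_on {s..t} h" and D: "\<And>r. r \<in> dense_times s t \<Longrightarrow> \<bar>h r\<bar> \<le> c" and r: "r \<in> {s..t}"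
  shows "\<bar>h r\<bar> \<le> c"
proof (rule ccontr)
  assume *: "\<not> \<bar>h r\<bar> \<le> c"
  then have "r \<noteq> s" using D[of s] by (auto simp: dense_times_def)
  have "0 < \<bar>h r\<bar> - c" using * by simp
  then obtain d where d: "0 < d" "\<And>u. u \<in> {s..t} \<Longrightarrow> \<bar>u - r\<bar> < d \<Longrightarrow> \<bar>h u - h r\<bar> < \<bar>h r\<bar> - c"
    using h r unfolding continuous_on_iff dist_real_def by meson
  have "max s (r - d) < r" using d r \<open>r \<noteq> s\<close> by auto
  then obtain q where q: "q \<in> \<rat>" "max s (r - d) < q" "q < r"
    using Rats_dense_in_real by blast
  then have "\<bar>h q - h r\<bar> < \<bar>h r\<bar> - c" using r by (intro d) auto
  moreover have "\<bar>h q\<bar> \<le> c" using q r by (intro D) (auto simp: dense_times_def)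
  ultimately show False by linarith
qed

text \<open>A strict bound on the supremum leaves a gap of some 1 / (n + 1), and by continuity
  countably many times suffice; this makes the event measurable.\<close>

lemma sup_less_iff_dense_times:
  fixes h :: "real \<Rightarrow> real"
  assumes h: "continuous_on {s..t} h" and st: "s \<le> t"
  shows "(SUP r\<in>{s..t}. \<bar>h r\<bar>) < e \<longleftrightarrow> (\<exists>n. \<forall>r\<in>dense_times s t. \<bar>h r\<bar> \<le> e - inverse (real (Suc n)))"
proof
  assume "(SUP r\<in>{s..t}. \<bar>h r\<bar>) < e"
  then obtain n where n: "inverse (real (Suc n)) < e - (SUP r\<in>{s..t}. \<bar>h r\<bar>)"
    using reals_Archimedean[of "e - (SUP r\<in>{s..t}. \<bar>h r\<bar>)"] by auto
  have "compact ((\<lambda>r. \<bar>h r\<bar>) ` {s..t})"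
    using h by (intro compact_continuous_image continuous_intros) auto
  then have "bdd_above ((\<lambda>r. \<bar>h r\<bar>) ` {s..t})"
    by (intro bounded_imp_bdd_above compact_imp_bounded)
  note bdd = this
  have "\<bar>h r\<bar> \<le> e - inverse (real (Suc n))" if "r \<in> {s..t}" for r
    using cSUP_upper[OF that bdd] n by linarith
  moreover have "dense_times s t \<subseteq> {s..t}" using st by (auto simp: dense_times_def)
  ultimately show "\<exists>n. \<forall>r\<in>dense_times s t. \<bar>h r\<bar> \<le> e - inverse (real (Suc n))"
    by blast
next
  assume "\<exists>n. \<forall>r\<in>dense_times s t. \<bar>h r\<bar> \<le> e - inverse (real (Suc n))"
  then obtain n where n: "\<And>r. r \<in> dense_times s t \<Longrightarrow> \<bar>h r\<bar> \<le> e - inverse (real (Suc n))" by blast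
  have "(SUP r\<in>{s..t}. \<bar>h r\<bar>) \<le> e - inverse (real (Suc n))"
  proof (rule cSUP_least)
    show "\<bar>h r\<bar> \<le> e - inverse (real (Suc n))" if "r \<in> {s..t}" for r
      by (rule dense_times_bound[OF h n that])
  qed (use st in simp)
  moreover have "0 < inverse (real (Suc n))" by simp
  ultimately show "(SUP r\<in>{s..t}. \<bar>h r\<bar>) < e" by linarith
qed

lemma flp_constant_pos:
  assumes "1/2 < H" "H < 1"
  shows "0 < flp_constant H"
proof -
  have "0 < sin (pi * H)" using assms by (intro sin_gt_zero) auto
  moreover have "0 < Gamma (2 * H)" "0 < Gamma (H + 1/2)" using assms by (auto intro!: Gamma_real_pos)
  ultimately show ?thesis using assms by (simp add: flp_constant_def)
qed

lemma flp_kernel_nonneg_time: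
  assumes "0 < x" "x \<le> t"
  shows "flp_kernel H t x = flp_constant H * (t - x) powr (H - 1/2)"
  using assms by (simp add: flp_kernel_def)

text \<open>Every time has its own approximating functions and possibly its own random measure. As
  \<open>decomposition\<close> mentions \<open>L\<close> but not \<open>N\<close>, all times can be
  treated together.\<close>

locale past_future_process = centered_levy +
  fixes X :: "real \<Rightarrow> 'a \<Rightarrow> real" and a C :: real
  assumes a: "0 < a" "a < 1" and C: "0 < C"
    and X_measurable[measurable]: "\<And>t. 0 \<le> t \<Longrightarrow> X t \<in> borel_measurable M"
    and X_continuous: "\<And>\<omega>. \<omega> \<in> space M \<Longrightarrow> continuous_on {0..} (\<lambda>t. X t \<omega>)"
    and decomposition: "\<And>s t. 0 \<le> s \<Longrightarrow> s \<le> t \<Longrightarrow>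
      almost_measurable M (increments {..s}) (\<lambda>\<omega>. X t \<omega> - C * rl_integral a s (\<lambda>r. L r \<omega> - L s \<omega>) t)"
begin

section \<open>Future part, past part and the adapted version\<close>

definition future :: "real \<Rightarrow> 'a \<Rightarrow> real \<Rightarrow> real" where
  "future s \<omega> t = C * rl_integral a s (\<lambda>r. L r \<omega> - L s \<omega>) t"

lemma future_continuous: "\<omega> \<in> space M \<Longrightarrow> 0 \<le> s \<Longrightarrow> continuous_on {s..t} (future s \<omega>)"
  unfolding future_def[abs_def] using a
  by (intro continuous_on_mult continuous_on_const rl_integral_path_continuous) auto

lemma future_start: "future s \<omega> s = 0"
  by (simp add: future_def rl_integral_def rl_kernel_def)

lemma future_measurable:
  assumes "0 \<le> s" "s \<le> t"
  shows "(\<lambda>\<omega>. future s \<omega> t) \<in> borel_measurable (increments {s..t})"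
  unfolding future_def using rl_integral_increment_measurable[OF a(1) assms] by measurable

text \<open>The version is chosen for each pair of times separately, so nothing is known about its
  paths in \<open>t\<close>, and it is compared with \<open>X\<close> at countably many times
  only.\<close>

definition past :: "real \<Rightarrow> real \<Rightarrow> 'a \<Rightarrow> real" where
  "past s t = (SOME g. g \<in> borel_measurable (increments {..s}) \<and> (AE \<omega> in M. X t \<omega> - future s \<omega> t = g \<omega>))"

lemma past:
  assumes "0 \<le> s" "s \<le> t"
  shows "past s t \<in> borel_measurable (increments {..s})" "AE \<omega> in M. X t \<omega> - future s \<omega> t = past s t \<omega>"
proof -
  have "\<exists>g. g \<in> borel_measurable (increments {..s}) \<and> (AE \<omega> in M. X t \<omega> - future s \<omega> t = g \<omega>)"
    using decomposition[OF assms] by (auto simp: almost_measurable_def future_def)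
  from someI_ex[OF this]
  show "past s t \<in> borel_measurable (increments {..s})" "AE \<omega> in M. X t \<omega> - future s \<omega> t = past s t \<omega>"
    unfolding past_def by auto
qed

definition past_rat :: "'a \<Rightarrow> rat \<Rightarrow> real" where
  "past_rat \<omega> q = (if 0 \<le> q then past 0 (real_of_rat q) \<omega> else 0)"

text \<open>The path of \<open>X\<close> minus \<open>future 0\<close> is continuous and almost
  surely given by \<open>past_rat\<close> at rational times, so its continuous extension depends on
  increments up to 0 alone. The default 0 keeps every path continuous, and the condition for it is
  measurable with respect to the past.\<close>

definition adapted_version :: "real \<Rightarrow> 'a \<Rightarrow> real" where
  "adapted_version t \<omega> =
    (if rat_uniform (past_rat \<omega>) then lim (\<lambda>k. past_rat \<omega> (rat_below t k)) else 0) + future 0 \<omega> t"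

lemma adapted_version_indistinguishable: "AE \<omega> in M. \<forall>t\<ge>0. X t \<omega> = adapted_version t \<omega>"
proof -
  have "AE \<omega> in M. \<forall>q. 0 \<le> q \<longrightarrow> X (real_of_rat q) \<omega> - future 0 \<omega> (real_of_rat q) = past_rat \<omega> q"
  proof (subst AE_all_countable, intro allI)
    fix q :: rat
    show "AE \<omega> in M. 0 \<le> q \<longrightarrow> X (real_of_rat q) \<omega> - future 0 \<omega> (real_of_rat q) = past_rat \<omega> q"
      using past(2)[of 0 "real_of_rat q"] by (cases "0 \<le> q") (simp_all add: past_rat_def)
  qed
  then show ?thesis
    using AE_space
  proof eventually_elim
    case (elim \<omega>)
    let ?g = "\<lambda>t. X t \<omega> - future 0 \<omega> t"
    have g: "continuous_on {0..T} ?g" for T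
      using elim by (intro continuous_on_diff future_continuous continuous_on_subset[OF X_continuous]) auto
    have eq: "past_rat \<omega> q = ?g (real_of_rat q)" if "0 \<le> q" for q
      using elim(1) that by simp
    have unif: "rat_uniform (past_rat \<omega>)"
      by (rule rat_uniform_of_continuous[OF g eq])
    show ?case
    proof (intro allI impI)
      fix t :: real assume t: "0 \<le> t"
      have "(\<lambda>k. ?g (real_of_rat (rat_below t k))) \<longlonglongrightarrow> ?g t"
        using rat_below_bounds(1,3)[of t] t
        by (intro continuous_on_tendsto_compose[OF g[of t] rat_below_tendsto]) auto
      moreover have "past_rat \<omega> (rat_below t k) = ?g (real_of_rat (rat_below t k))" for k
        using rat_below_bounds(3)[OF t] by (rule eq)
      ultimately have "lim (\<lambda>k. past_rat \<omega> (rat_below t k)) = ?g t"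
        by (simp add: limI)
      then show "X t \<omega> = adapted_version t \<omega>"
        using unif by (simp add: adapted_version_def)
    qed
  qed
qed

lemma adapted_version_continuous:
  assumes "\<omega> \<in> space M"
  shows "continuous_on {0..T} (\<lambda>t. adapted_version t \<omega>)"
  unfolding adapted_version_def
proof (intro continuous_on_add future_continuous assms)
  show "continuous_on {0..T} (\<lambda>t. if rat_uniform (past_rat \<omega>) then lim (\<lambda>k. past_rat \<omega> (rat_below t k)) else 0)"
    using continuous_on_subset[OF rat_uniform_extension[of "past_rat \<omega>"], of "{0..T}"]
    by (cases "rat_uniform (past_rat \<omega>)") auto
qed simp

lemma adapted_version_measurable:
  assumes t: "0 \<le> t"
  shows "adapted_version t \<in> borel_measurable (increments {..t})"
proof -
  have sub: "g \<in> borel_measurable (increments {..t})" if "g \<in> borel_measurable (increments I)" "I \<subseteq> {..t}"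
    for g :: "'a \<Rightarrow> real" and I
    using that sets_increments_mono[OF that(2)]
    by (intro measurable_from_subalg[of "increments {..t}" "increments I"]) (auto simp: subalgebra_def)
  have [measurable]: "(\<lambda>\<omega>. past_rat \<omega> q) \<in> borel_measurable (increments {..t})" for q
    using t by (cases "0 \<le> q") (auto simp: past_rat_def intro!: sub[OF past(1)])
  have [measurable]: "(\<lambda>\<omega>. future 0 \<omega> t) \<in> borel_measurable (increments {..t})"
    using t by (intro sub[OF future_measurable]) auto
  have "Measurable.pred (increments {..t}) (\<lambda>\<omega>. rat_uniform (past_rat \<omega>))"
    unfolding rat_uniform_def by measurable
  then have [measurable]: "{\<omega>\<in>space (increments {..t}). rat_uniform (past_rat \<omega>)} \<in> sets (increments {..t})"
    by (rule predE)
  show ?thesis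
    unfolding adapted_version_def[abs_def]
    by (intro borel_measurable_add measurable_If borel_measurable_lim_metric borel_measurable_const) measurable
qed

text \<open>Where the conditional probability is not positive, on \<open>D\<close>, the event
  \<open>V\<close> has probability 0. If \<open>D\<close> had positive probability, so would some
  \<open>D \<inter> E q\<close>, on which the part still to be covered is near one polynomial; the
  future event \<open>W\<close> for that polynomial is independent of the past, and the three events
  together lead into \<open>V\<close>.\<close>

lemma conditional_probability_pos:
  assumes trip: "characteristic_triplet M L b 0 \<Lambda>"
    and jumps: "\<And>\<epsilon>::real. \<epsilon> > 0 \<Longrightarrow> emeasure \<Lambda> {-\<epsilon><..<0} > 0 \<and> emeasure \<Lambda> {0<..<\<epsilon>} > 0"
    and s: "0 \<le> s" "s < t" and f: "continuous_on {s..t} f" "f s = 0" and e: "0 < e"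
  shows "AE \<omega> in M. 0 < real_cond_exp M (increment_filtration M L s)
    (indicator {\<omega>\<in>space M. (SUP r\<in>{s..t}. \<bar>adapted_version r \<omega> - adapted_version s \<omega> - f r\<bar>) < e}) \<omega>"
proof -
  let ?Y = adapted_version and ?F = "increment_filtration M L s" and ?T = "dense_times s t"
  define V where "V = {\<omega>\<in>space M. (SUP r\<in>{s..t}. \<bar>?Y r \<omega> - ?Y s \<omega> - f r\<bar>) < e}"
  have T: "?T \<subseteq> {s..t}" using s by (auto simp: dense_times_def)
  have cont: "continuous_on {s..t} (\<lambda>r. ?Y r \<omega> - ?Y s \<omega> - f r)" if "\<omega> \<in> space M" for \<omega>
    using that s f(1)
    by (intro continuous_on_diff continuous_on_const continuous_on_subset[OF adapted_version_continuous[of \<omega> t]]) auto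
  have V: "V = {\<omega>\<in>space M. \<exists>n. \<forall>r\<in>?T. \<bar>?Y r \<omega> - ?Y s \<omega> - f r\<bar> \<le> e - inverse (real (Suc n))}"
    unfolding V_def using sup_less_iff_dense_times[OF cont] s by (auto simp del: of_nat_Suc)
  have Ym: "?Y r \<in> borel_measurable M" if "0 \<le> r" for r
    using measurable_from_subalg[OF subalgebra_increments adapted_version_measurable[OF that]] .
  have Vm: "V \<in> events"
    unfolding V
  proof (intro sets.sets_Collect_countable_Ex sets.sets_Collect_countable_All' countable_dense_times)
    fix n r assume "r \<in> ?T"
    then have [measurable]: "?Y r \<in> borel_measurable M" "?Y s \<in> borel_measurable M"
      using T s by (auto intro!: Ym)
    show "{\<omega>\<in>space M. \<bar>?Y r \<omega> - ?Y s \<omega> - f r\<bar> \<le> e - inverse (real (Suc n))} \<in> events" by measurable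
  qed
  have subF: "subalgebra M ?F"
    unfolding subalgebra_def using sets_increment_filtration[of s] sets_increments_events
    by (auto dest: sets_eq_imp_space_eq)
  interpret F: finite_measure_subalgebra M ?F
    by (intro finite_measure_subalgebra.intro finite_measure_subalgebra_axioms.intro subF finite_measure_axioms)
  define c where "c = real_cond_exp M ?F (indicator V)"
  have c[measurable]: "c \<in> borel_measurable ?F" by (simp add: c_def)
  have spF: "space ?F = space M" using subF by (simp add: subalgebra_def)
  define D where "D = {\<omega>\<in>space M. c \<omega> \<le> 0}"
  have DF: "D \<in> sets ?F"
    unfolding D_def spF[symmetric] by measurable
  then have Dpast: "D \<in> sets (increments {..s})" by (simp add: sets_increment_filtration)
  then have Dev: "D \<in> events" using sets_increments_events by blast
  have DV: "prob (D \<inter> V) = 0"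
  proof -
    have i: "integrable M (indicator V :: 'a \<Rightarrow> real)" using Vm by (simp add: less_top[symmetric])
    have "prob (D \<inter> V) = (LINT \<omega>:D|M. indicator V \<omega>)"
      using Dev Vm by (simp add: set_lebesgue_integral_def indicator_inter_arith[symmetric])
    also have "\<dots> = (LINT \<omega>:D|M. c \<omega>)"
      unfolding c_def by (rule F.real_cond_exp_intA[OF i DF])
    also have "\<dots> \<le> 0"
    proof -
      have "0 \<le> (LINT \<omega>|M. - (indicator D \<omega> *\<^sub>R c \<omega>))"
        by (intro integral_nonneg_AE AE_I2) (auto simp: D_def indicator_def)
      then show ?thesis by (simp add: set_lebesgue_integral_def)
    qed
    finally show ?thesis using measure_nonneg[of M "D \<inter> V"] by linarith
  qed
  have "prob D = 0"
  proof (rule ccontr)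
    assume "prob D \<noteq> 0"
    have past_eq: "AE \<omega> in M. \<forall>r\<in>?T. ?Y r \<omega> - future s \<omega> r = past s r \<omega>"
    proof -
      have "AE \<omega> in M. \<forall>r\<in>?T. X r \<omega> - future s \<omega> r = past s r \<omega>"
        using T past(2)[OF s(1)] by (intro AE_ball_countable' countable_dense_times) auto
      with adapted_version_indistinguishable show ?thesis
        by eventually_elim (use T s in fastforce)
    qed
    \<comment> \<open>The target minus the known past part is within e / 4 of the polynomial
      \<open>q\<close>. Restriction to \<open>dense_times s t\<close> makes this an event of the
      past.\<close>
    define E where "E q = {\<omega>\<in>space M. \<forall>r\<in>?T. \<bar>f r - (past s r \<omega> - past s s \<omega>) - rat_poly s q r\<bar> \<le> e / 4}" for q
    have E: "E q \<in> sets (increments {..s})" for q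
    proof -
      have "{\<omega>\<in>space (increments {..s}). \<forall>r\<in>?T. \<bar>f r - (past s r \<omega> - past s s \<omega>) - rat_poly s q r\<bar> \<le> e / 4} \<in> sets (increments {..s})"
      proof (intro sets.sets_Collect_countable_All' countable_dense_times)
        fix r assume "r \<in> ?T"
        then have [measurable]: "past s r \<in> borel_measurable (increments {..s})" "past s s \<in> borel_measurable (increments {..s})"
          using T s by (auto intro!: past)
        show "{\<omega>\<in>space (increments {..s}). \<bar>f r - (past s r \<omega> - past s s \<omega>) - rat_poly s q r\<bar> \<le> e / 4} \<in> sets (increments {..s})"
          by measurable
      qed
      then show ?thesis by (simp add: E_def)
    qed
    have Eev: "E q \<in> events" for q using E sets_increments_events by blast
    have "AE \<omega> in M. \<exists>q. \<omega> \<in> E q"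
      using past_eq AE_space
    proof eventually_elim
      case (elim \<omega>)
      \<comment> \<open>This continuous expression agrees with \<open>past s\<close> at the dense
        times, so that approximation by polynomials applies to it.\<close>
      let ?p = "\<lambda>r. ?Y r \<omega> - future s \<omega> r"
      have "continuous_on {s..t} (\<lambda>r. f r - (?p r - ?p s))"
        using s f(1) elim
        by (intro continuous_on_diff continuous_on_const future_continuous
            continuous_on_subset[OF adapted_version_continuous[of \<omega> t]]) auto
      then have "\<exists>q. \<forall>r\<in>{s..t}. \<bar>f r - (?p r - ?p s) - rat_poly s q r\<bar> \<le> e / 4"
        by (rule rat_poly_dense[rotated]) (use s f(2) e in auto)
      then obtain q where q: "\<And>r. r \<in> {s..t} \<Longrightarrow> \<bar>f r - (?p r - ?p s) - rat_poly s q r\<bar> \<le> e / 4"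
        by blast
      have "s \<in> ?T" by (simp add: dense_times_def)
      then have "\<bar>f r - (past s r \<omega> - past s s \<omega>) - rat_poly s q r\<bar> \<le> e / 4" if "r \<in> ?T" for r
        using q[of r] that T elim(1) by auto
      then show ?case using elim(2) by (auto simp: E_def)
    qed
    then have "\<exists>q. prob (D \<inter> E q) \<noteq> 0"
    proof (rule contrapos_pp)
      assume "\<nexists>q. prob (D \<inter> E q) \<noteq> 0"
      then have "AE \<omega> in M. \<forall>q. \<omega> \<notin> D \<inter> E q"
        using Dev Eev by (subst AE_all_countable) (auto simp: prob_eq_0)
      show "\<not> (AE \<omega> in M. \<exists>q. \<omega> \<in> E q)"
      proof
        assume "AE \<omega> in M. \<exists>q. \<omega> \<in> E q"
        with \<open>AE \<omega> in M. \<forall>q. \<omega> \<notin> D \<inter> E q\<close> have "AE \<omega> in M. \<omega> \<notin> D"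
          by eventually_elim auto
        then show False using \<open>prob D \<noteq> 0\<close> Dev by (simp add: prob_eq_0)
      qed
    qed
    then obtain q where q: "0 < prob (D \<inter> E q)"
      using measure_nonneg[of M] by (metis less_eq_real_def)
    obtain W where W: "W \<in> sets (increments {s..t})" "0 < prob W"
      and close: "\<And>\<omega> r. \<omega> \<in> W \<Longrightarrow> r \<in> {s..t} \<Longrightarrow> \<bar>future s \<omega> r - rat_poly s q r\<bar> \<le> e / 4"
    proof -
      have "0 < e / 4" using e by simp
      from rl_integral_support[OF trip jumps a C s this, of q] show ?thesis
        using that unfolding future_def by blast
    qed
    have Wf: "W \<in> sets (increments {s..})"
      using W(1) sets_increments_mono[of "{s..t}" "{s..}"] by auto
    have Wev: "W \<in> events" using W(1) sets_increments_events by blast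
    have "prob (D \<inter> E q \<inter> W) = prob (D \<inter> E q) * prob W"
      using Dpast E Wf by (intro indep_past_future) auto
    then have "0 < prob (D \<inter> E q \<inter> W)" using q W(2) by simp
    moreover have "prob (D \<inter> E q \<inter> W) \<le> prob (D \<inter> V)"
    proof (rule finite_measure_mono_AE)
      show "AE \<omega> in M. \<omega> \<in> D \<inter> E q \<inter> W \<longrightarrow> \<omega> \<in> D \<inter> V"
        using past_eq
      proof eventually_elim
        case (elim \<omega>)
        show ?case
        proof
          assume w: "\<omega> \<in> D \<inter> E q \<inter> W"
          \<comment> \<open>The errors e / 4 of the past and of the future add up to e / 2, which
            leaves room for a gap below e.\<close>
          obtain n where "inverse (real (Suc n)) < e / 2" using reals_Archimedean[of "e / 2"] e by auto
          then have n: "e / 2 \<le> e - inverse (real (Suc n))" by simp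
          have "\<bar>?Y r \<omega> - ?Y s \<omega> - f r\<bar> \<le> e - inverse (real (Suc n))" if r: "r \<in> ?T" for r
          proof -
            have "s \<in> ?T" by (simp add: dense_times_def)
            then have "?Y r \<omega> - future s \<omega> r = past s r \<omega>" "?Y s \<omega> - future s \<omega> s = past s s \<omega>"
              using elim r by auto
            moreover have "\<bar>f r - (past s r \<omega> - past s s \<omega>) - rat_poly s q r\<bar> \<le> e / 4"
              using w r by (auto simp: E_def)
            moreover have "\<bar>future s \<omega> r - rat_poly s q r\<bar> \<le> e / 4"
              using close w r T by auto
            ultimately have "\<bar>?Y r \<omega> - ?Y s \<omega> - f r\<bar> \<le> e / 2"
              unfolding future_start by (simp only: abs_le_iff) linarith
            then show ?thesis using n by linarith
          qed
          moreover have "\<omega> \<in> space M" using w by (auto simp: E_def)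
          ultimately show "\<omega> \<in> D \<inter> V" using w unfolding V by blast
        qed
      qed
    qed (use Dev Vm in auto)
    ultimately show False using DV by simp
  qed
  then have "AE \<omega> in M. \<omega> \<notin> D" using Dev by (simp add: prob_eq_0)
  then have "AE \<omega> in M. 0 < c \<omega>"
    using AE_space by eventually_elim (auto simp: D_def)
  then show ?thesis by (simp add: c_def V_def)
qed

lemma adapted_version_conditional_full_support:
  assumes trip: "characteristic_triplet M L b 0 \<Lambda>"
    and jumps: "\<And>\<epsilon>::real. \<epsilon> > 0 \<Longrightarrow> emeasure \<Lambda> {-\<epsilon><..<0} > 0 \<and> emeasure \<Lambda> {0<..<\<epsilon>} > 0"
  shows "conditional_full_support M (increment_filtration M L) T adapted_version"
  unfolding conditional_full_support_def
proof (intro conjI ballI allI impI)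
  fix s \<epsilon> :: real and f :: "real \<Rightarrow> real"
  assume "s \<in> {0..<T}" "continuous_on {s..T} f" "f s = 0" "0 < \<epsilon>"
  then show "AE \<omega> in M. 0 < real_cond_exp M (increment_filtration M L s)
    (indicator {\<omega>\<in>space M. (SUP r\<in>{s..T}. \<bar>adapted_version r \<omega> - adapted_version s \<omega> - f r\<bar>) < \<epsilon>}) \<omega>"
    by (intro conditional_probability_pos[OF trip jumps]) auto
qed (auto simp: measurable_increment_filtration adapted_version_continuous adapted_version_measurable)

end

theorem corollary3p1:
  fixes M :: "'a measure" and L X :: "real \<Rightarrow> 'a \<Rightarrow> real"
    and H b :: real and \<Lambda> :: "real measure"
  assumes "prob_space M"
    and "1/2 < H" "H < 1"
    and "two_sided_levy_process M L"
    and "characteristic_triplet M L b 0 \<Lambda>"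
    and "integrable M (\<lambda>\<omega>. (L 1 \<omega>)\<^sup>2)"
    and "(\<integral>\<omega>. L 1 \<omega> \<partial>M) = 0"
    and "fractional_levy_process M L H X"
    and "\<And>\<epsilon>::real. \<epsilon> > 0 \<Longrightarrow> emeasure \<Lambda> {-\<epsilon><..<0} > 0 \<and> emeasure \<Lambda> {0<..<\<epsilon>} > 0"
  shows "\<exists>Y. indistinguishable M X Y \<and>
    (\<forall>T>0. conditional_full_support M (increment_filtration M L) T Y)"
proof -
  let ?a = "H - 1/2" and ?C = "flp_constant H"
  have levy: "levy_process M L"
    using assms(4) by (simp add: two_sided_levy_process_def)
  have cl: "centered_levy M L N" if "levy_random_measure M L N" for N
    using assms(1) levy two_sided_levy_measurable[OF assms(4)] that assms(6,7)
    by (intro centered_levy.intro centered_levy_axioms.intro)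
  have integral: "\<exists>N h. levy_random_measure M L N \<and> (\<forall>n. simple_integrand (h n)) \<and>
      (AE x in lborel. (\<lambda>n. h n x) \<longlonglongrightarrow> flp_kernel H t x) \<and>
      (\<forall>B\<in>sets borel. \<exists>W. converges_in_probability M (\<lambda>n. simple_integral_over N B (h n)) W) \<and>
      converges_in_probability M (\<lambda>n. simple_integral_over N {..t} (h n)) (X t)" if "0 \<le> t" for t
    using assms(8) that unfolding fractional_levy_process_def has_levy_integral_def by blast
  obtain N where "levy_random_measure M L N"
    using integral[of 0] by auto
  then interpret centered_levy M L N by (rule cl)
  interpret past_future_process M L N X ?a ?C
  proof
    show "0 < ?a" "?a < 1" "0 < ?C" using assms(2,3) flp_constant_pos by auto
    show "X t \<in> borel_measurable M" if t: "0 \<le> t" for t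
      using integral[OF t] by (auto simp: converges_in_probability_def)
    show "continuous_on {0..} (\<lambda>t. X t \<omega>)" if "\<omega> \<in> space M" for \<omega>
      using assms(8) that by (simp add: fractional_levy_process_def)
    fix s t :: real assume st: "0 \<le> s" "s \<le> t"
    then have "0 \<le> t" by simp
    from integral[OF this] obtain N' h where N': "levy_random_measure M L N'"
      and h: "\<And>n. simple_integrand (h n)" "AE x in lborel. (\<lambda>n. h n x) \<longlonglongrightarrow> flp_kernel H t x"
      and conv: "\<And>B. B \<in> sets borel \<Longrightarrow> \<exists>W. converges_in_probability M (\<lambda>n. simple_integral_over N' B (h n)) W"
      and X: "converges_in_probability M (\<lambda>n. simple_integral_over N' {..t} (h n)) (X t)"
      by blast
    \<comment> \<open>The random measure belonging to time \<open>t\<close> may differ from the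
      fixed \<open>N\<close>; the conclusion involves increments of \<open>L\<close> only.\<close>
    interpret N': centered_levy M L N' by (rule cl[OF N'])
    show "almost_measurable M (increments {..s}) (\<lambda>\<omega>. X t \<omega> - ?C * rl_integral ?a s (\<lambda>r. L r \<omega> - L s \<omega>) t)"
    proof (rule N'.past_future_decomposition[OF _ _ st h(1) _ conv X])
      show "AE x in lborel. x \<in> {s<..t} \<longrightarrow> (\<lambda>n. h n x) \<longlonglongrightarrow> ?C * (t - x) powr ?a"
        using h(2) by eventually_elim (use st in \<open>auto simp: flp_kernel_nonneg_time\<close>)
    qed (use assms(2,3) flp_constant_pos in auto)
  qed
  have "indistinguishable M X adapted_version"
    unfolding indistinguishable_def by (rule adapted_version_indistinguishable)
  moreover have "conditional_full_support M (increment_filtration M L) T adapted_version" for T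
    by (rule adapted_version_conditional_full_support[OF assms(5,9)])
  ultimately show ?thesis by blast
qed

end
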